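(* Let $K$ be a local field with residue characteristic $p$ and with $\mu_p(K)\neq\{1\}$; let $f_K$ be its residue degree over $\mathbb{F}_p$ and $\rho_K=\rho_{e,p}$ with $e=v_K(p)$. Then the action (by precomposition) of the group $\mathrm{Aut}_{\mathrm{filt}}(M_{\rho_K}^{f_K-1}\oplus M_{\rho_K}^{*})$ on the set $\mathrm{Epi}_{\mathrm{filt}}(M_{\rho_K}^{f_K-1}\oplus M_{\rho_K}^{*},\,U_\bullet(K))$ is transitive.
   Context: A local field $K$ is a field with a non-archimedean absolute value for which it is a non-discrete locally compact space; $v_K$ is its normalized valuation, $O$ its ring of integers, $m$ its maximal ideal, $p$ its residue characteristic, $|O/m|=p^{f_K}$. $\mu_p(K)=\{\alpha\in K:\alpha^p=1\}$ (so $\mu_p(K)\ne\{1\}$ forces $\mathrm{char}(K)=0$). $U_i(K)=1+m^i$; $U_1(K)$ is a (multiplicatively written) $\mathbb{Z}_p$-module. A filtered $\mathbb{Z}_p$-module $M_\bullet$ is a sequence of $\mathbb{Z}_p$-modules $M_1\supseteq M_2\supseteq\cdots$ with $\bigcap_i M_i=\{0\}$; its weight map is $w(x)=\sup\{i: x\in M_i\}$ and determines the filtration. A morphism $M_\bullet\to N_\bullet$ is a $\mathbb{Z}_p$-linear map $\phi:M_1\to N_1$ with $\phi(M_i)\subseteq N_i$ for all $i$. $\mathrm{Epi}_{\mathrm{filt}}(M_\bullet,N_\bullet)$ is the set of morphisms of filtered modules for which $M_1\to N_1$ is surjective; $\mathrm{Aut}_{\mathrm{filt}}(M_\bullet)$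 is the group of invertible morphisms $M_\bullet\to M_\bullet$ (with inverse a morphism). $U_\bullet(K)$ denotes $U_1(K)$ with the filtration $(U_i(K))_{i\ge1}$. Products and direct sums carry the termwise filtration. A shift is a strictly increasing function $\rho:\mathbb{Z}_{\ge1}\to\mathbb{Z}_{\ge1}$ with $\rho(1)>1$; $T_\rho=\mathbb{Z}_{\ge1}\setminus\rho(\mathbb{Z}_{\ge1})$. If $T_\rho$ is finite, $e^*=e^*_\rho=\max(T_\rho)+1$ and $T_\rho^*=T_\rho\cup\{e^*\}$. $\rho_{e,p}(i)=\min\{i+e,pi\}$. For $i\ge1$, $S_i$ is $\mathbb{Z}_p$ with weight map $w(x)=\rho^{\mathrm{ord}_p(x)}(i)$ (iterate of $\rho$; $w(0)=\infty$). $M_\rho=\prod_{i\in T_\rho}S_i$, $M_\rho^*=\prod_{i\in T_\rho^*}S_i$, and $M_\rho^{f-1}$ is the direct sum of $f-1$ copies of $M_\rho$. *)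

theory Defs
  imports
    "HOL-Analysis.Abstract_Metric_Spaces"
    "HOL-Algebra.Module"
    "HOL-Algebra.QuotRing"
    "HOL-Algebra.Ideal_Product"
    "HOL-Algebra.Group_Action"
    "HOL-Computational_Algebra.Primes"
    "HOL-Library.Extended_Nat"
begin

section \<open>The ring of p-adic integers\<close>

text \<open>A p-adic integer is the compatible sequence of its residues modulo the powers of p,
  the residue modulo \<open>p ^ n\<close> being represented in \<open>{0..<p ^ n}\<close>.\<close>

type_synonym padic = "nat \<Rightarrow> int"

definition Zp :: "nat \<Rightarrow> padic ring" where
  "Zp p = \<lparr>
     carrier = {x. \<forall>n. x n \<in> {0..<int p ^ n} \<and> x (Suc n) mod int p ^ n = x n},
     monoid.mult = (\<lambda>x y n. (x n * y n) mod int p ^ n),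
     one = (\<lambda>n. 1 mod int p ^ n),
     zero = (\<lambda>n. 0),
     add = (\<lambda>x y n. (x n + y n) mod int p ^ n)\<rparr>"

definition ord_p :: "nat \<Rightarrow> padic \<Rightarrow> enat" where
  "ord_p p x = Sup {enat k | k. \<exists>y\<in>carrier (Zp p). x = add_pow (Zp p) (p ^ k) y}"


section \<open>Filtered modules\<close>

text \<open>The filtration is indexed by positive integers; \<open>fil M 0\<close> carries no information.
  The fields \<open>mult\<close> and \<open>one\<close>, which every module record inherits from rings, are irrelevant too.\<close>

record ('r, 'm) filt_module = "('r, 'm) module" +
  fil :: "nat \<Rightarrow> 'm set"

locale filtered_module = Module.module R M
  for R :: "('r, 'x) ring_scheme" and M :: "('r, 'm, 'y) filt_module_scheme" +
  assumes fil_1: "fil M 1 = carrier M"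
    and fil_submodule: "i \<ge> 1 \<Longrightarrow> submodule (fil M i) R M"
    and fil_antimono: "1 \<le> i \<Longrightarrow> i \<le> j \<Longrightarrow> fil M j \<subseteq> fil M i"
    and fil_Inter: "(\<Inter>i\<in>{1..}. fil M i) = {\<zero>\<^bsub>M\<^esub>}"

definition weight :: "('r, 'm, 'y) filt_module_scheme \<Rightarrow> 'm \<Rightarrow> enat" where
  "weight M x = Sup {enat i | i. i \<ge> 1 \<and> x \<in> fil M i}"

text \<open>Maps are extensional (\<open>undefined\<close> outside the carrier), so that
  equality of morphisms is equality of functions.\<close>

definition linear_maps ::
  "('r, 'x) ring_scheme \<Rightarrow> ('r, 'm, 'y) module_scheme \<Rightarrow> ('r, 'n, 'z) module_scheme \<Rightarrow> ('m \<Rightarrow> 'n) set"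
where
  "linear_maps R M N = {h \<in> carrier M \<rightarrow>\<^sub>E carrier N.
     (\<forall>x\<in>carrier M. \<forall>y\<in>carrier M. h (x \<oplus>\<^bsub>M\<^esub> y) = h x \<oplus>\<^bsub>N\<^esub> h y) \<and>
     (\<forall>a\<in>carrier R. \<forall>x\<in>carrier M. h (a \<odot>\<^bsub>M\<^esub> x) = a \<odot>\<^bsub>N\<^esub> h x)}"

definition Hom_filt ::
  "('r, 'x) ring_scheme \<Rightarrow> ('r, 'm) filt_module \<Rightarrow> ('r, 'n) filt_module \<Rightarrow> ('m \<Rightarrow> 'n) set"
where
  "Hom_filt R M N = {h \<in> linear_maps R M N. \<forall>i\<ge>1. h ` fil M i \<subseteq> fil N i}"

definition Epi_filt ::
  "('r, 'x) ring_scheme \<Rightarrow> ('r, 'm) filt_module \<Rightarrow> ('r, 'n) filt_module \<Rightarrow> ('m \<Rightarrow> 'n) set"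
where
  "Epi_filt R M N = {h \<in> Hom_filt R M N. h ` carrier M = carrier N}"

definition End_filt ::
  "('r, 'x) ring_scheme \<Rightarrow> ('r, 'm) filt_module \<Rightarrow> ('m \<Rightarrow> 'm) monoid"
where
  "End_filt R M = \<lparr>
     carrier = Hom_filt R M M,
     monoid.mult = compose (carrier M),
     one = (\<lambda>x\<in>carrier M. x)\<rparr>"

definition Aut_filt ::
  "('r, 'x) ring_scheme \<Rightarrow> ('r, 'm) filt_module \<Rightarrow> ('m \<Rightarrow> 'm) monoid"
where
  "Aut_filt R M = units_of (End_filt R M)"

text \<open>Precomposition is a right action; as usual it becomes a left action
  (the convention of \<^locale>\<open>group_action\<close>) by letting \<open>\<alpha>\<close> send \<open>\<phi>\<close> to \<open>\<phi> \<circ> \<alpha>\<inverse>\<close>.\<close>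

definition precomp_action ::
  "('r, 'x) ring_scheme \<Rightarrow> ('r, 'm) filt_module \<Rightarrow> ('r, 'n) filt_module \<Rightarrow>
   ('m \<Rightarrow> 'm) \<Rightarrow> ('m \<Rightarrow> 'n) \<Rightarrow> ('m \<Rightarrow> 'n)"
where
  "precomp_action R M N \<alpha> =
     (\<lambda>\<phi>\<in>Epi_filt R M N. compose (carrier M) \<phi> (inv\<^bsub>Aut_filt R M\<^esub> \<alpha>))"

definition prod_filt :: "'i set \<Rightarrow> ('i \<Rightarrow> ('r, 'm) filt_module) \<Rightarrow> ('r, 'i \<Rightarrow> 'm) filt_module" where
  "prod_filt I M = \<lparr>
     carrier = (\<Pi>\<^sub>E i\<in>I. carrier (M i)),
     monoid.mult = undefined, one = undefined,
     zero = (\<lambda>i\<in>I. \<zero>\<^bsub>M i\<^esub>),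
     add = (\<lambda>x y. \<lambda>i\<in>I. x i \<oplus>\<^bsub>M i\<^esub> y i),
     smult = (\<lambda>a x. \<lambda>i\<in>I. a \<odot>\<^bsub>M i\<^esub> x i),
     fil = (\<lambda>j. \<Pi>\<^sub>E i\<in>I. fil (M i) j)\<rparr>"

definition power_filt :: "('r, 'm) filt_module \<Rightarrow> nat \<Rightarrow> ('r, nat \<Rightarrow> 'm) filt_module" where
  "power_filt M n = prod_filt {..<n} (\<lambda>_. M)"

definition dsum_filt ::
  "('r, 'm) filt_module \<Rightarrow> ('r, 'n) filt_module \<Rightarrow> ('r, 'm \<times> 'n) filt_module" (infixr \<open>\<oplus>\<^sub>f\<close> 65)
where
  "M \<oplus>\<^sub>f N = \<lparr>
     carrier = carrier M \<times> carrier N,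
     monoid.mult = undefined, one = undefined,
     zero = (\<zero>\<^bsub>M\<^esub>, \<zero>\<^bsub>N\<^esub>),
     add = (\<lambda>(x, y) (x', y'). (x \<oplus>\<^bsub>M\<^esub> x', y \<oplus>\<^bsub>N\<^esub> y')),
     smult = (\<lambda>a (x, y). (a \<odot>\<^bsub>M\<^esub> x, a \<odot>\<^bsub>N\<^esub> y)),
     fil = (\<lambda>j. fil M j \<times> fil N j)\<rparr>"


section \<open>Shifts and the modules attached to them\<close>

text \<open>Functions on the positive integers are functions on \<^typ>\<open>nat\<close> whose value at 0 is ignored.\<close>

definition shift :: "(nat \<Rightarrow> nat) \<Rightarrow> bool" where
  "shift \<rho> \<longleftrightarrow> strict_mono_on {1..} \<rho> \<and> \<rho> 1 > 1"

definition T_set :: "(nat \<Rightarrow> nat) \<Rightarrow> nat set" where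
  "T_set \<rho> = {1..} - \<rho> ` {1..}"

definition e_star :: "(nat \<Rightarrow> nat) \<Rightarrow> nat" where
  "e_star \<rho> = Max (T_set \<rho>) + 1"

definition T_star :: "(nat \<Rightarrow> nat) \<Rightarrow> nat set" where
  "T_star \<rho> = insert (e_star \<rho>) (T_set \<rho>)"

definition rho :: "nat \<Rightarrow> nat \<Rightarrow> nat \<Rightarrow> nat" where
  "rho e p i = min (i + e) (p * i)"

definition S_weight :: "nat \<Rightarrow> (nat \<Rightarrow> nat) \<Rightarrow> nat \<Rightarrow> padic \<Rightarrow> enat" where
  "S_weight p \<rho> i x = (case ord_p p x of enat k \<Rightarrow> enat ((\<rho> ^^ k) i) | \<infinity> \<Rightarrow> \<infinity>)"

definition S_mod :: "nat \<Rightarrow> (nat \<Rightarrow> nat) \<Rightarrow> nat \<Rightarrow> (padic, padic) filt_module" where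
  "S_mod p \<rho> i = \<lparr>
     carrier = carrier (Zp p),
     monoid.mult = undefined, one = undefined,
     zero = \<zero>\<^bsub>Zp p\<^esub>,
     add = add (Zp p),
     smult = monoid.mult (Zp p),
     fil = (\<lambda>j. {x \<in> carrier (Zp p). enat j \<le> S_weight p \<rho> i x})\<rparr>"

lemma weight_S_mod:
  assumes "x \<in> carrier (Zp p)"
  shows "weight (S_mod p \<rho> i) x = S_weight p \<rho> i x"
proof (rule antisym)
  show "weight (S_mod p \<rho> i) x \<le> S_weight p \<rho> i x"
    by (auto simp: weight_def S_mod_def intro!: Sup_least)
  show "S_weight p \<rho> i x \<le> weight (S_mod p \<rho> i) x"
  proof (rule ccontr)
    assume "\<not> ?thesis"
    then have less: "weight (S_mod p \<rho> i) x < S_weight p \<rho> i x" by simp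
    then obtain n where n: "weight (S_mod p \<rho> i) x = enat n"
      by (cases "weight (S_mod p \<rho> i) x") auto
    have "enat (Suc n) \<le> S_weight p \<rho> i x"
      using less n by (metis Suc_ile_eq)
    then have "enat (Suc n) \<le> weight (S_mod p \<rho> i) x"
      using assms by (auto simp: weight_def S_mod_def intro!: Sup_upper)
    then show False using n by simp
  qed
qed

definition M_mod :: "nat \<Rightarrow> (nat \<Rightarrow> nat) \<Rightarrow> (padic, nat \<Rightarrow> padic) filt_module" where
  "M_mod p \<rho> = prod_filt (T_set \<rho>) (S_mod p \<rho>)"

definition M_star :: "nat \<Rightarrow> (nat \<Rightarrow> nat) \<Rightarrow> (padic, nat \<Rightarrow> padic) filt_module" where
  "M_star p \<rho> = prod_filt (T_star \<rho>) (S_mod p \<rho>)"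

lemma shift_rho:
  assumes "e \<ge> 1" and "p \<ge> 2"
  shows "shift (rho e p)"
proof -
  have "rho e p i < rho e p j" if "i < j" for i j
  proof -
    have "p * i < p * j" using that assms by simp
    then show ?thesis using that unfolding rho_def by linarith
  qed
  then show ?thesis using assms by (auto simp: shift_def strict_mono_on_def rho_def)
qed

lemma finite_T_set_rho:
  assumes "p \<ge> 2"
  shows "finite (T_set (rho e p))"
proof (rule finite_subset)
  show "T_set (rho e p) \<subseteq> {..2 * e}"
  proof
    fix n assume n: "n \<in> T_set (rho e p)"
    show "n \<in> {..2 * e}"
    proof (rule ccontr)
      assume "n \<notin> {..2 * e}"
      then have gt: "n > 2 * e" by simp
      define i where "i = n - e"
      have "2 * i \<le> p * i" using assms by simp
      moreover have "i + e = n" "i \<ge> 1" "n \<le> 2 * i" using gt by (auto simp: i_def)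
      ultimately have "rho e p i = n" "i \<in> {1..}"
        unfolding rho_def atLeast_iff by linarith+
      then show False using n by (force simp: T_set_def)
    qed
  qed
qed simp


section \<open>Local fields and their principal units\<close>

abbreviation abs_topology :: "('a::field \<Rightarrow> real) \<Rightarrow> 'a topology" where
  "abs_topology absv \<equiv> Metric_space.mtopology UNIV (\<lambda>x y. absv (x - y))"

locale local_field =
  fixes absv :: "'a::field \<Rightarrow> real"
  assumes absv_nonneg: "absv x \<ge> 0"
    and absv_eq_0_iff: "absv x = 0 \<longleftrightarrow> x = 0"
    and absv_mult: "absv (x * y) = absv x * absv y"
    and absv_ultrametric: "absv (x + y) \<le> max (absv x) (absv y)"
    and non_discrete: "abs_topology absv \<noteq> discrete_topology UNIV"
    and locally_compact: "locally_compact_space (abs_topology absv)"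

definition int_ring :: "('a::field \<Rightarrow> real) \<Rightarrow> 'a ring" where
  "int_ring absv = \<lparr>carrier = {x. absv x \<le> 1}, monoid.mult = (*), one = 1, zero = 0, add = (+)\<rparr>"

definition max_ideal :: "('a::field \<Rightarrow> real) \<Rightarrow> 'a set" where
  "max_ideal absv = {x. absv x < 1}"

primrec ideal_pow :: "('a, 'b) ring_scheme \<Rightarrow> 'a set \<Rightarrow> nat \<Rightarrow> 'a set" where
  "ideal_pow R I 0 = carrier R"
| "ideal_pow R I (Suc n) = ideal_prod R (ideal_pow R I n) I"

definition residue_field :: "('a::field \<Rightarrow> real) \<Rightarrow> 'a set ring" where
  "residue_field absv = int_ring absv Quot max_ideal absv"

definition residue_char :: "('a::field \<Rightarrow> real) \<Rightarrow> nat" where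
  "residue_char absv = (LEAST n. n > 0 \<and>
     add_pow (residue_field absv) n \<one>\<^bsub>residue_field absv\<^esub> = \<zero>\<^bsub>residue_field absv\<^esub>)"

definition residue_degree :: "('a::field \<Rightarrow> real) \<Rightarrow> nat" where
  "residue_degree absv = (THE f. card (carrier (residue_field absv)) = residue_char absv ^ f)"

definition uniformizer :: "('a::field \<Rightarrow> real) \<Rightarrow> 'a \<Rightarrow> bool" where
  "uniformizer absv \<pi> \<longleftrightarrow>
     \<pi> \<noteq> 0 \<and> \<pi> \<in> max_ideal absv \<and> (\<forall>y\<in>max_ideal absv. absv y \<le> absv \<pi>)"

text \<open>The normalized valuation of a nonzero element (the value at 0, which should be
  infinite, is unspecified).\<close>

definition norm_val :: "('a::field \<Rightarrow> real) \<Rightarrow> 'a \<Rightarrow> int" where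
  "norm_val absv x = (THE n. \<exists>\<pi>. uniformizer absv \<pi> \<and> absv x = absv \<pi> powi n)"

definition mu :: "nat \<Rightarrow> 'a::field set" where
  "mu n = {\<alpha>. \<alpha> ^ n = 1}"

definition U :: "('a::field \<Rightarrow> real) \<Rightarrow> nat \<Rightarrow> 'a set" where
  "U absv i = {1 + x | x. x \<in> ideal_pow (int_ring absv) (max_ideal absv) i}"

text \<open>For a principal unit \<open>u\<close> and a p-adic integer \<open>a\<close>, the power \<open>u\<^sup>a\<close> is the limit of the
  powers of \<open>u\<close> with exponents the residues of \<open>a\<close> modulo \<open>p ^ n\<close>.\<close>

definition padic_pow :: "('a::field \<Rightarrow> real) \<Rightarrow> padic \<Rightarrow> 'a \<Rightarrow> 'a" where
  "padic_pow absv a u = (THE l. limitin (abs_topology absv) (\<lambda>n. u ^ nat (a n)) l sequentially)"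

definition U_filt :: "('a::field \<Rightarrow> real) \<Rightarrow> (padic, 'a) filt_module" where
  "U_filt absv = \<lparr>
     carrier = U absv 1,
     monoid.mult = undefined, one = undefined,
     zero = 1,
     add = (*),
     smult = padic_pow absv,
     fil = U absv\<rparr>"

end

theory Submission
  imports
    Defs
    "HOL-Algebra.Sylow"
    "HOL-Algebra.Multiplicative_Group"
    "HOL-Computational_Algebra.Polynomial"
begin

text \<open>Let \<open>q\<close> be the order of the residue field, write \<open>U\<^sub>i\<close> for \<open>U absv i\<close>, \<open>M\<^sub>i\<close> for \<open>fil M i\<close>, and
let \<open>\<phi>\<close> be a filtered epimorphism from \<open>M\<close> onto the principal units. The proof compares
\<open>M\<close> and the units modulo \<open>p\<close>, and then lifts epimorphisms through each other.

\<^bold>\<open>Counting.\<close> The image of \<open>M\<^sub>i\<close> in \<open>M/pM\<close> has \<open>p\<^sup>c\<close> elements, where \<open>c\<close> is the number of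
generators of weight at least \<open>i\<close>. The image of \<open>U\<^sub>i\<close> in \<open>U\<^sub>1/U\<^sub>1\<^sup>p\<close> has equally many
elements (\<open>card_U_mod_powers\<close>, \<open>card_T_set_ge\<close>, \<open>card_T_star_ge\<close>). As \<open>\<phi>\<close> is onto, it induces a
bijection from \<open>M/pM\<close> to \<open>U\<^sub>1/U\<^sub>1\<^sup>p\<close>, and this bijection matches the two filtrations. So the kernel of
\<open>\<phi>\<close> lies in \<open>pM\<close>, and \<open>U\<^sub>i\<close> is contained in \<open>\<phi>(M\<^sub>i) U\<^sub>1\<^sup>p\<close>.

\<^bold>\<open>Strictness.\<close> For \<open>i > 1\<close>, a \<open>p\<close>-th power that lies in \<open>U\<^sub>i\<close> is the \<open>p\<close>-th power of an element of some
\<open>U\<^sub>k\<close> with \<open>k < i \<le> \<rho> k\<close> (\<open>power_lift\<close>), and \<open>p M\<^sub>k\<close> is contained in \<open>M\<^sub>i\<close>. By induction on \<open>i\<close>,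
\<open>\<phi>(M\<^sub>i) = U\<^sub>i\<close> for every \<open>i\<close>, although surjectivity was only assumed for \<open>i = 1\<close> (\<open>Epi_strict\<close>).

\<^bold>\<open>Lifting.\<close> Since \<open>M\<close> is free, two epimorphisms \<open>\<phi>\<close> and \<open>\<psi>\<close> therefore factor through each other:
\<open>\<phi> = \<psi> \<alpha>\<close> and \<open>\<psi> = \<phi> \<beta>\<close>. Then \<open>\<psi> \<alpha> \<beta> = \<psi>\<close>, so \<open>\<alpha> \<beta>\<close> is the identity modulo the kernel
of \<open>\<psi>\<close>, hence modulo \<open>p\<close>; such an endomorphism is invertible because \<open>M\<close> is \<open>p\<close>-adically complete
(\<open>Unit_if_cong_id\<close>). The same holds for \<open>\<beta> \<alpha>\<close>, so \<open>\<alpha>\<close> is an automorphism.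

\<^bold>\<open>Arithmetic.\<close> Everything needed about \<open>p\<close>-th powers follows from
\<open>v\<^sup>p - 1 = \<Prod>\<^sub>\<zeta> (v - \<zeta>)\<close>, the product over all \<open>p\<close>-th roots of unity. These are at the same distance
from each other, of valuation \<open>e/(p-1)\<close>. If \<open>v\<close> is divided by the root of unity closest to it, the
quotient \<open>v'\<close> satisfies the exact formula \<open>val (v\<^sup>p - 1) = \<rho> (val (v' - 1))\<close>
(\<open>normalize_by_mu\<close>). The indices then come from \<open>[U\<^sub>i : U\<^bsub>i+1\<^esub>] = q\<close> by multiplicativity.\<close>

section \<open>Precomposition with filtered automorphisms\<close>

lemma compose_Hom_filt:
  assumes "g \<in> Hom_filt R M N" "h \<in> Hom_filt R N P"
    and "\<And>i. i \<ge> 1 \<Longrightarrow> fil M i \<subseteq> carrier M"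
    and "Module.module R M"
  shows "compose (carrier M) h g \<in> Hom_filt R M P"
proof -
  interpret Module.module R M by fact
  have g: "g x \<in> carrier N" if "x \<in> carrier M" for x
    using assms(1) that by (auto simp: Hom_filt_def linear_maps_def)
  have "compose (carrier M) h g \<in> linear_maps R M P"
    using assms(1,2) g by (auto simp: Hom_filt_def linear_maps_def compose_def)
  moreover have "compose (carrier M) h g ` fil M i \<subseteq> fil P i" if "i \<ge> 1" for i
  proof -
    have "g ` fil M i \<subseteq> fil N i" "h ` fil N i \<subseteq> fil P i"
      using assms(1,2) that by (auto simp: Hom_filt_def)
    then show ?thesis using assms(3)[OF that] by (auto simp: compose_def image_subset_iff subset_iff)
  qed
  ultimately show ?thesis by (auto simp: Hom_filt_def)
qed

lemma compose_Epi_filt: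
  assumes "g \<in> Epi_filt R M N" "h \<in> Epi_filt R N P"
    and "\<And>i. i \<ge> 1 \<Longrightarrow> fil M i \<subseteq> carrier M"
    and "Module.module R M"
  shows "compose (carrier M) h g \<in> Epi_filt R M P"
proof -
  have "compose (carrier M) h g ` carrier M = h ` (g ` carrier M)"
    by (auto simp: compose_def image_image)
  then show ?thesis
    using assms compose_Hom_filt[of g R M N h P] by (auto simp: Epi_filt_def)
qed

context filtered_module
begin

lemma fil_subset: "i \<ge> 1 \<Longrightarrow> fil M i \<subseteq> carrier M"
  using fil_1 fil_antimono[of 1 i] by auto

end

lemma monoid_End_filt:
  fixes M :: "('r, 'm) filt_module"
  assumes "filtered_module R M"
  shows "Group.monoid (End_filt R M)"
proof -
  interpret filtered_module R M by fact
  note mod = module_axioms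
  have ext: "f \<in> extensional (carrier M)" "f \<in> carrier M \<rightarrow> carrier M"
    if "f \<in> Hom_filt R M M" for f
    using that by (auto simp: Hom_filt_def linear_maps_def PiE_iff)
  show ?thesis
  proof (rule monoidI, goal_cases)
    case (1 x y)
    then show ?case
      using compose_Hom_filt[OF _ _ fil_subset mod] by (simp add: End_filt_def)
  next
    case 2
    show ?case using fil_subset
      by (auto simp: End_filt_def Hom_filt_def linear_maps_def)
  next
    case (3 x y z)
    then show ?case using compose_assoc[OF ext(2)[of z], of x y] by (simp add: End_filt_def)
  next
    case (4 x)
    then show ?case using Id_compose[OF ext(2) ext(1)] by (simp add: End_filt_def)
  next
    case (5 x)
    then show ?case using compose_Id[OF ext(2) ext(1)] by (simp add: End_filt_def)
  qed
qed

lemma Unit_End_filt_Epi: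
  fixes M :: "('r, 'm) filt_module"
  assumes "filtered_module R M" "\<alpha> \<in> Units (End_filt R M)"
  shows "\<alpha> \<in> Epi_filt R M M"
proof -
  interpret E: Group.monoid "End_filt R M" by (rule monoid_End_filt) fact
  obtain \<beta> where \<beta>: "\<alpha> \<in> Hom_filt R M M" "\<beta> \<in> Hom_filt R M M"
    "compose (carrier M) \<alpha> \<beta> = (\<lambda>x\<in>carrier M. x)"
    using assms(2) by (auto simp: Units_def End_filt_def)
  have "x \<in> \<alpha> ` carrier M" if "x \<in> carrier M" for x
  proof -
    have "\<alpha> (\<beta> x) = x" using fun_cong[OF \<beta>(3), of x] that by (simp add: compose_def)
    moreover have "\<beta> x \<in> carrier M" using \<beta>(2) that by (auto simp: Hom_filt_def linear_maps_def)
    ultimately show ?thesis by (metis imageI)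
  qed
  then show ?thesis using \<beta>(1) by (auto simp: Epi_filt_def Hom_filt_def linear_maps_def)
qed

text \<open>The action sends \<open>\<phi>\<close> to \<open>\<phi> \<circ> \<alpha>\<inverse>\<close>, so a unit \<open>\<alpha>\<close> with \<open>\<psi> \<circ> \<alpha> = \<phi>\<close> carries \<open>\<phi>\<close> to \<open>\<psi>\<close>. Units are
themselves epimorphisms, which is why precomposition preserves the set acted on.\<close>

lemma transitive_precomp_action:
  fixes M :: "('r, 'm) filt_module" and N :: "('r, 'n) filt_module"
  assumes fm: "filtered_module R M"
    and lift: "\<And>\<phi> \<psi>. \<phi> \<in> Epi_filt R M N \<Longrightarrow> \<psi> \<in> Epi_filt R M N \<Longrightarrow>
      \<exists>\<alpha>\<in>Units (End_filt R M). compose (carrier M) \<psi> \<alpha> = \<phi>"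
  shows "transitive_action (Aut_filt R M) (Epi_filt R M N) (precomp_action R M N)"
proof -
  interpret filtered_module R M by fact
  interpret E: Group.monoid "End_filt R M" by (rule monoid_End_filt) fact
  let ?A = "Aut_filt R M" and ?X = "Epi_filt R M N" and ?act = "precomp_action R M N"
  let ?c = "compose (carrier M)"
  interpret A: group ?A unfolding Aut_filt_def by (rule E.units_group)
  have carr: "carrier ?A = Units (End_filt R M)" by (simp add: Aut_filt_def units_of_carrier)
  have mult: "\<alpha> \<otimes>\<^bsub>?A\<^esub> \<beta> = ?c \<alpha> \<beta>" for \<alpha> \<beta>
    by (simp add: Aut_filt_def units_of_mult End_filt_def)
  have one: "\<one>\<^bsub>?A\<^esub> = (\<lambda>x\<in>carrier M. x)"
    by (simp add: Aut_filt_def units_of_one End_filt_def)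
  have Epi: "\<alpha> \<in> Epi_filt R M M" if "\<alpha> \<in> carrier ?A" for \<alpha>
    using Unit_End_filt_Epi[OF fm] that carr by auto
  then have fn: "\<alpha> \<in> carrier M \<rightarrow> carrier M" if "\<alpha> \<in> carrier ?A" for \<alpha>
    using that by (fastforce simp: Epi_filt_def Hom_filt_def linear_maps_def)
  have ext: "\<phi> \<in> extensional (carrier M)" "\<phi> \<in> carrier M \<rightarrow> carrier N" if "\<phi> \<in> ?X" for \<phi>
    using that by (auto simp: Epi_filt_def Hom_filt_def linear_maps_def PiE_iff)
  have act: "?act \<alpha> \<phi> = ?c \<phi> (inv\<^bsub>?A\<^esub> \<alpha>)" if "\<phi> \<in> ?X" for \<alpha> \<phi>
    using that by (simp add: precomp_action_def)
  have closed: "?c \<phi> \<alpha> \<in> ?X" if "\<phi> \<in> ?X" "\<alpha> \<in> carrier ?A" for \<phi> \<alpha>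
    using compose_Epi_filt[OF Epi[OF that(2)] that(1) fil_subset module_axioms] .
  have cc: "?c (?c \<phi> \<alpha>) \<beta> = ?c \<phi> (\<alpha> \<otimes>\<^bsub>?A\<^esub> \<beta>)"
    if "\<phi> \<in> ?X" "\<alpha> \<in> carrier ?A" "\<beta> \<in> carrier ?A" for \<phi> \<alpha> \<beta>
    unfolding mult using compose_assoc[OF fn[OF that(3)], of \<phi> \<alpha>] by simp
  have c1: "?c \<phi> \<one>\<^bsub>?A\<^esub> = \<phi>" if "\<phi> \<in> ?X" for \<phi>
    unfolding one by (rule compose_Id) (use ext[OF that] in auto)
  have act_act: "?act \<alpha> (?act \<beta> \<phi>) = ?act (\<alpha> \<otimes>\<^bsub>?A\<^esub> \<beta>) \<phi>"
    if "\<phi> \<in> ?X" "\<alpha> \<in> carrier ?A" "\<beta> \<in> carrier ?A" for \<phi> \<alpha> \<beta>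
    using that closed by (simp add: act cc A.inv_mult_group)
  have act_one: "?act \<one>\<^bsub>?A\<^esub> \<phi> = \<phi>" if "\<phi> \<in> ?X" for \<phi>
    using that by (simp add: act c1)
  have act_closed: "?act \<alpha> \<phi> \<in> ?X" if "\<phi> \<in> ?X" "\<alpha> \<in> carrier ?A" for \<alpha> \<phi>
    using that closed by (simp add: act)
  have act_ext: "?act \<alpha> \<in> extensional ?X" for \<alpha>
    by (simp add: precomp_action_def)
  have Bij: "?act \<alpha> \<in> Bij ?X" if "\<alpha> \<in> carrier ?A" for \<alpha>
    unfolding Bij_def
  proof (intro IntI CollectI bij_betwI[where g = "?act (inv\<^bsub>?A\<^esub> \<alpha>)"])
    fix \<phi> assume "\<phi> \<in> ?X"
    then show "?act (inv\<^bsub>?A\<^esub> \<alpha>) (?act \<alpha> \<phi>) = \<phi>" "?act \<alpha> (?act (inv\<^bsub>?A\<^esub> \<alpha>) \<phi>) = \<phi>"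
      using that by (simp_all add: act_act act_one)
  qed (use that act_closed act_ext in auto)
  have "?act \<in> hom ?A (BijGroup ?X)"
  proof (rule homI)
    fix \<alpha> \<beta> assume \<alpha>\<beta>: "\<alpha> \<in> carrier ?A" "\<beta> \<in> carrier ?A"
    have "?act (\<alpha> \<otimes>\<^bsub>?A\<^esub> \<beta>) = compose ?X (?act \<alpha>) (?act \<beta>)"
    proof (rule extensionalityI[of _ ?X])
      fix \<phi> assume "\<phi> \<in> ?X"
      then show "?act (\<alpha> \<otimes>\<^bsub>?A\<^esub> \<beta>) \<phi> = compose ?X (?act \<alpha>) (?act \<beta>) \<phi>"
        using \<alpha>\<beta> by (simp add: compose_def act_act)
    qed (auto simp: act_ext compose_def)
    then show "?act (\<alpha> \<otimes>\<^bsub>?A\<^esub> \<beta>) = ?act \<alpha> \<otimes>\<^bsub>BijGroup ?X\<^esub> ?act \<beta>"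
      using Bij \<alpha>\<beta> by (simp add: BijGroup_def)
  qed (auto simp: BijGroup_def Bij)
  then have "group_hom ?A (BijGroup ?X) ?act"
    by (simp add: group_hom_def group_hom_axioms_def A.group_axioms group_BijGroup)
  moreover have "\<exists>\<alpha>\<in>carrier ?A. ?act \<alpha> \<phi> = \<psi>" if X: "\<phi> \<in> ?X" "\<psi> \<in> ?X" for \<phi> \<psi>
  proof -
    obtain \<alpha> where \<alpha>: "\<alpha> \<in> carrier ?A" "?c \<psi> \<alpha> = \<phi>"
      using lift[OF X] carr by auto
    have "?act \<alpha> \<phi> = ?c (?c \<psi> \<alpha>) (inv\<^bsub>?A\<^esub> \<alpha>)"
      using act[OF X(1)] by (simp only: \<alpha>(2))
    also have "\<dots> = \<psi>" using \<alpha>(1) X by (simp add: cc c1)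
    finally show ?thesis using \<alpha> by auto
  qed
  ultimately show ?thesis
    by (auto simp: transitive_action_def transitive_action_axioms_def group_action_def)
qed

text \<open>Here \<open>y (x y)\<inverse>\<close> is a right inverse and \<open>(y x)\<inverse> y\<close> a left inverse of \<open>x\<close>.\<close>

lemma (in monoid) Units_if_products_Units:
  assumes "x \<in> carrier G" "y \<in> carrier G" "x \<otimes> y \<in> Units G" "y \<otimes> x \<in> Units G"
  shows "x \<in> Units G"
proof -
  define u where "u = y \<otimes> inv (x \<otimes> y)"
  define v where "v = inv (y \<otimes> x) \<otimes> y"
  have uv: "u \<in> carrier G" "v \<in> carrier G" using assms by (auto simp: u_def v_def)
  have "x \<otimes> u = \<one>" unfolding u_def using assms by (simp add: m_assoc[symmetric])
  moreover have "v \<otimes> x = \<one>" unfolding v_def using assms by (simp add: m_assoc)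
  ultimately show ?thesis using inv_unique[of v x u] uv assms(1) by (auto simp: Units_def)
qed

section \<open>p-adic integers and their filtrations\<close>

lemma Zp_simps:
  "\<zero>\<^bsub>Zp p\<^esub> = (\<lambda>n. 0)" "\<one>\<^bsub>Zp p\<^esub> = (\<lambda>n. 1 mod int p ^ n)"
  "x \<oplus>\<^bsub>Zp p\<^esub> y = (\<lambda>n. (x n + y n) mod int p ^ n)"
  "x \<otimes>\<^bsub>Zp p\<^esub> y = (\<lambda>n. (x n * y n) mod int p ^ n)"
  by (simp_all add: Zp_def)

lemma Zp_carrier:
  "x \<in> carrier (Zp p) \<longleftrightarrow> (\<forall>n. 0 \<le> x n \<and> x n < int p ^ n \<and> x (Suc n) mod int p ^ n = x n)"
  by (simp add: Zp_def)

lemma Zp_mod_self: "x \<in> carrier (Zp p) \<Longrightarrow> x n mod int p ^ n = x n"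
  by (simp add: Zp_carrier)

lemma Zp_0 [simp]: "x \<in> carrier (Zp p) \<Longrightarrow> x 0 = 0"
  unfolding Zp_carrier by (metis power_0 zless_iff_Suc_zadd linorder_not_less int_one_le_iff_zero_less order_antisym)

lemma Zp_compat:
  assumes "x \<in> carrier (Zp p)" "m \<le> n"
  shows "x n mod int p ^ m = x m"
  using assms(2)
proof (induction rule: dec_induct)
  case base
  then show ?case using Zp_mod_self[OF assms(1)] by simp
next
  case (step n)
  have "x (Suc n) mod int p ^ m = x (Suc n) mod int p ^ n mod int p ^ m"
    using step by (simp add: mod_mod_cancel le_imp_power_dvd)
  then show ?case using step assms(1) by (simp add: Zp_carrier)
qed

lemma Zp_memI:
  assumes "p > 0" "\<And>n. x n = X n mod int p ^ n" "\<And>n. X (Suc n) mod int p ^ n = X n mod int p ^ n"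
  shows "x \<in> carrier (Zp p)"
  unfolding Zp_carrier
proof
  fix n
  have "x (Suc n) mod int p ^ n = X (Suc n) mod int p ^ n"
    unfolding assms(2) by (simp add: mod_mod_cancel le_imp_power_dvd)
  then show "0 \<le> x n \<and> x n < int p ^ n \<and> x (Suc n) mod int p ^ n = x n"
    using assms by simp
qed

context
  fixes p :: nat
  assumes p: "p > 0"
begin

lemma Zp_add_closed: "x \<in> carrier (Zp p) \<Longrightarrow> y \<in> carrier (Zp p) \<Longrightarrow> x \<oplus>\<^bsub>Zp p\<^esub> y \<in> carrier (Zp p)"
  by (rule Zp_memI[OF p, of _ "\<lambda>n. x n + y n"])
     (auto simp: Zp_simps Zp_carrier intro!: mod_add_cong)

lemma Zp_mult_closed: "x \<in> carrier (Zp p) \<Longrightarrow> y \<in> carrier (Zp p) \<Longrightarrow> x \<otimes>\<^bsub>Zp p\<^esub> y \<in> carrier (Zp p)"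
  by (rule Zp_memI[OF p, of _ "\<lambda>n. x n * y n"])
     (auto simp: Zp_simps Zp_carrier intro!: mod_mult_cong)

lemma Zp_of_int_closed: "(\<lambda>n. c mod int p ^ n) \<in> carrier (Zp p)"
  by (rule Zp_memI[OF p, of _ "\<lambda>n. c"]) auto

lemma Zp_uminus_closed: "x \<in> carrier (Zp p) \<Longrightarrow> (\<lambda>n. (- x n) mod int p ^ n) \<in> carrier (Zp p)"
  by (rule Zp_memI[OF p, of _ "\<lambda>n. - x n"])
     (auto simp: Zp_carrier intro!: mod_minus_cong)

lemma Zp_zero_closed: "(\<lambda>n. 0) \<in> carrier (Zp p)"
  using p by (simp add: Zp_carrier)

lemma Zp_abelian_group: "abelian_group (Zp p)"
proof (rule abelian_groupI, goal_cases)
  case (6 x)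
  show ?case
    by (rule bexI[of _ "\<lambda>n. (- x n) mod int p ^ n"])
       (use 6 in \<open>auto simp: Zp_simps mod_simps Zp_uminus_closed\<close>)
next
  case (3 x y z)
  then show ?case by (simp add: Zp_simps mod_simps add.assoc)
next
  case (4 x y)
  then show ?case by (simp add: Zp_simps add.commute)
next
  case (5 x)
  then show ?case by (simp add: Zp_simps Zp_mod_self)
qed (simp_all add: Zp_add_closed Zp_simps(1) Zp_zero_closed)

lemma Zp_cring: "cring (Zp p)"
proof (rule cringI[OF Zp_abelian_group])
  show "comm_monoid (Zp p)"
  proof (rule comm_monoidI, goal_cases)
    case 2
    show ?case using Zp_of_int_closed[of 1] by (simp add: Zp_simps)
  next
    case (3 x y z)
    then show ?case by (simp add: Zp_simps mod_simps mult.assoc)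
  next
    case (4 x)
    then show ?case by (simp add: Zp_simps mod_simps Zp_mod_self)
  next
    case (5 x y)
    then show ?case by (simp add: Zp_simps mult.commute)
  qed (simp_all add: Zp_mult_closed)
qed (simp add: Zp_simps mod_simps algebra_simps)

lemma Zp_add_pow:
  assumes "y \<in> carrier (Zp p)"
  shows "add_pow (Zp p) (m::nat) y = (\<lambda>n. (int m * y n) mod int p ^ n)"
proof -
  interpret cring "Zp p" by (rule Zp_cring)
  show ?thesis
  proof (induction m)
    case 0
    then show ?case by (simp add: Zp_simps)
  next
    case (Suc m)
    then show ?case
      using assms by (simp add: Zp_simps mod_simps algebra_simps)
  qed
qed

text \<open>The quotient is obtained by shifting the sequence of residues by \<open>k\<close> places and dividing.\<close>

lemma Zp_divide_power:
  assumes "x \<in> carrier (Zp p)" "x k = 0"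
  shows "\<exists>y\<in>carrier (Zp p). \<forall>n. x n = (int p ^ k * y n) mod int p ^ n"
proof -
  define y where "y n = x (n + k) div int p ^ k" for n
  have pos: "int p ^ k > 0" using p by simp
  have *: "x (n + k) = int p ^ k * y n" for n
    using Zp_compat[OF assms(1), of k "n + k"] assms(2) by (simp add: y_def mod_eq_0_iff_dvd)
  have "y \<in> carrier (Zp p)" unfolding Zp_carrier
  proof
    fix n
    have a: "0 \<le> x (n + k)" "x (n + k) < int p ^ (n + k)"
      using assms(1) by (auto simp: Zp_carrier)
    have "int p ^ k * (y (Suc n) mod int p ^ n) = (int p ^ k * y (Suc n)) mod (int p ^ k * int p ^ n)"
      by (rule mult_mod_right)
    also have "\<dots> = x (Suc n + k) mod int p ^ (n + k)"
      unfolding *[symmetric] by (simp only: power_add mult.commute)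
    also have "\<dots> = int p ^ k * y n" using assms(1) *[of n] by (simp add: Zp_carrier)
    finally have "y (Suc n) mod int p ^ n = y n" using p by simp
    moreover have "0 \<le> y n" using a(1) pos unfolding *[of n] by (simp add: zero_le_mult_iff)
    moreover have "int p ^ k * y n < int p ^ k * int p ^ n"
      using a(2) unfolding *[of n] by (simp only: power_add mult.commute)
    then have "y n < int p ^ n" using pos by simp
    ultimately show "0 \<le> y n \<and> y n < int p ^ n \<and> y (Suc n) mod int p ^ n = y n" by simp
  qed
  moreover have "x n = (int p ^ k * y n) mod int p ^ n" for n
    using Zp_compat[OF assms(1), of n "n + k"] by (simp add: *)
  ultimately show ?thesis by blast
qed

text \<open>Divisibility by a power of \<open>p\<close> is visible in a single residue. Through this lemma all weight
conditions below become the vanishing of a residue.\<close>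

lemma ord_p_ge_iff:
  assumes x: "x \<in> carrier (Zp p)"
  shows "enat k \<le> ord_p p x \<longleftrightarrow> x k = 0"
proof
  assume "x k = 0"
  then obtain y where y: "y \<in> carrier (Zp p)" "\<And>n. x n = (int p ^ k * y n) mod int p ^ n"
    using Zp_divide_power[OF x] by blast
  then have "x = add_pow (Zp p) (p ^ k) y" by (auto simp: Zp_add_pow)
  then show "enat k \<le> ord_p p x"
    unfolding ord_p_def using y(1) by (intro Sup_upper) auto
next
  assume k: "enat k \<le> ord_p p x"
  show "x k = 0"
  proof (rule ccontr)
    assume nz: "x k \<noteq> 0"
    then have "k > 0" using x by (cases k) auto
    have "ord_p p x \<le> enat (k - 1)"
      unfolding ord_p_def
    proof (rule Sup_least, clarsimp)
      fix l y assume y: "y \<in> carrier (Zp p)" "x = add_pow (Zp p) (p ^ l) y"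
      show "l \<le> k - Suc 0"
      proof (rule ccontr)
        assume "\<not> ?thesis"
        then have "int p ^ k dvd int p ^ l" by (simp add: le_imp_power_dvd)
        then have "x k = 0" using y by (auto simp: Zp_add_pow)
        then show False using nz by simp
      qed
    qed
    then have "enat k \<le> enat (k - 1)" using k order_trans by blast
    then show False using \<open>k > 0\<close> by simp
  qed
qed

end

subsection \<open>Shifts\<close>

lemma shift_gt:
  assumes "shift \<rho>" "i \<ge> 1"
  shows "\<rho> i > i"
  using assms(2)
proof (induction rule: dec_induct)
  case base
  then show ?case using assms(1) by (simp add: shift_def)
next
  case (step i)
  then have "\<rho> i < \<rho> (Suc i)" using assms(1) by (auto simp: shift_def strict_mono_on_def)
  then show ?case using step by simp
qed

lemma shift_mono: "shift \<rho> \<Longrightarrow> 1 \<le> i \<Longrightarrow> i \<le> j \<Longrightarrow> \<rho> i \<le> \<rho> j"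
  by (cases "i = j") (auto simp: shift_def strict_mono_on_def less_imp_le)

lemma funpow_shift_ge:
  assumes "shift \<rho>" "i \<ge> 1"
  shows "(\<rho> ^^ k) i \<ge> i + k"
proof (induction k)
  case (Suc k)
  then show ?case using shift_gt[OF assms(1), of "(\<rho> ^^ k) i"] assms(2) by simp
qed simp

lemma funpow_shift_mono:
  assumes "shift \<rho>" "i \<ge> 1" "k \<le> l"
  shows "(\<rho> ^^ k) i \<le> (\<rho> ^^ l) i"
proof -
  have ge: "(\<rho> ^^ k) i \<ge> 1" using funpow_shift_ge[OF assms(1,2), of k] assms(2) by simp
  have "(\<rho> ^^ l) i = (\<rho> ^^ (l - k)) ((\<rho> ^^ k) i)"
    using assms(3) by (simp add: funpow_add[symmetric, THEN fun_cong, simplified comp_def])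
  then show ?thesis using funpow_shift_ge[OF assms(1) ge, of "l - k"] by simp
qed

text \<open>How often a generator of weight \<open>i\<close> has to be multiplied by \<open>p\<close> until its weight is at least \<open>j\<close>.\<close>

definition steps :: "(nat \<Rightarrow> nat) \<Rightarrow> nat \<Rightarrow> nat \<Rightarrow> nat" where
  "steps \<rho> i j = (LEAST k. j \<le> (\<rho> ^^ k) i)"

lemma steps_le_iff:
  assumes "shift \<rho>" "i \<ge> 1"
  shows "steps \<rho> i j \<le> k \<longleftrightarrow> j \<le> (\<rho> ^^ k) i"
proof
  have "j \<le> (\<rho> ^^ j) i" using funpow_shift_ge[OF assms, of j] by simp
  then have "j \<le> (\<rho> ^^ steps \<rho> i j) i" unfolding steps_def by (rule LeastI)
  then show "steps \<rho> i j \<le> k \<Longrightarrow> j \<le> (\<rho> ^^ k) i"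
    using funpow_shift_mono[OF assms] order_trans by blast
qed (auto simp: steps_def Least_le)

text \<open>Each step of the filtration of \<open>S\<^sub>i\<close> is an ideal \<open>p\<^sup>k \<int>\<^sub>p\<close>.\<close>

lemma fil_S_mod:
  assumes "p > 0" "shift \<rho>" "i \<ge> 1"
  shows "fil (S_mod p \<rho> i) j = {x \<in> carrier (Zp p). x (steps \<rho> i j) = 0}"
proof -
  have "enat j \<le> S_weight p \<rho> i x \<longleftrightarrow> x (steps \<rho> i j) = 0" if x: "x \<in> carrier (Zp p)" for x
    using ord_p_ge_iff[OF assms(1) x, of "steps \<rho> i j"] steps_le_iff[OF assms(2,3)]
    by (auto simp: S_weight_def split: enat.splits)
  then show ?thesis by (auto simp: S_mod_def)
qed

subsection \<open>Filtered modules over the p-adic integers\<close>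

lemma (in Module.module) submoduleI_smult:
  assumes "H \<subseteq> carrier M" "\<zero>\<^bsub>M\<^esub> \<in> H"
    and "\<And>x y. x \<in> H \<Longrightarrow> y \<in> H \<Longrightarrow> x \<oplus>\<^bsub>M\<^esub> y \<in> H"
    and "\<And>a x. a \<in> carrier R \<Longrightarrow> x \<in> H \<Longrightarrow> a \<odot>\<^bsub>M\<^esub> x \<in> H"
  shows "submodule H R M"
proof (rule submoduleI)
  fix x assume x: "x \<in> H"
  have "(\<ominus> \<one>) \<odot>\<^bsub>M\<^esub> x = \<ominus>\<^bsub>M\<^esub> x"
    using x assms(1) smult_l_minus[of \<one> x] by auto
  then show "\<ominus>\<^bsub>M\<^esub> x \<in> H" using assms(4)[OF _ x, of "\<ominus> \<one>"] by simp
qed (use assms in auto)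

lemma filtered_module_S_mod:
  assumes "p > 1" "shift \<rho>" "i \<ge> 1"
  shows "filtered_module (Zp p) (S_mod p \<rho> i)"
proof -
  have p: "p > 0" using assms(1) by simp
  interpret Z: cring "Zp p" by (rule Zp_cring[OF p])
  have "Module.module (Zp p) (S_mod p \<rho> i)"
  proof (rule moduleI[OF Z.is_cring])
    show "abelian_group (S_mod p \<rho> i)"
      by (rule abelian_groupI) (use Z.add.l_inv_ex in \<open>auto simp: S_mod_def Z.a_ac\<close>)
  qed (auto simp: S_mod_def Z.l_distr Z.r_distr Z.m_assoc)
  then interpret Module.module "Zp p" "S_mod p \<rho> i" .
  note fil = fil_S_mod[OF p assms(2,3)]
  have simps: "carrier (S_mod p \<rho> i) = carrier (Zp p)" "\<zero>\<^bsub>S_mod p \<rho> i\<^esub> = (\<lambda>n. 0)"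
    "\<And>x y. x \<oplus>\<^bsub>S_mod p \<rho> i\<^esub> y = x \<oplus>\<^bsub>Zp p\<^esub> y" "\<And>x y. x \<odot>\<^bsub>S_mod p \<rho> i\<^esub> y = x \<otimes>\<^bsub>Zp p\<^esub> y"
    by (auto simp: S_mod_def Zp_simps)
  have zero: "x k = 0" if "x l = 0" "k \<le> l" "x \<in> carrier (Zp p)" for x k l
    using Zp_compat[OF that(3,2)] that by simp
  show ?thesis
  proof (intro filtered_module.intro filtered_module_axioms.intro)
    show "Module.module (Zp p) (S_mod p \<rho> i)" by (rule module_axioms)
    have "steps \<rho> i 1 \<le> 0" using assms by (subst steps_le_iff) auto
    then show "fil (S_mod p \<rho> i) 1 = carrier (S_mod p \<rho> i)"
      unfolding fil simps by auto
    show "submodule (fil (S_mod p \<rho> i) j) (Zp p) (S_mod p \<rho> i)" for j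
      by (rule submoduleI_smult)
         (auto simp: fil simps Zp_add_closed[OF p] Zp_mult_closed[OF p], auto simp: Zp_simps Zp_zero_closed[OF p])
    show "fil (S_mod p \<rho> i) j \<subseteq> fil (S_mod p \<rho> i) k" if "k \<le> j" for j k
    proof -
      have "steps \<rho> i k \<le> steps \<rho> i j"
        using steps_le_iff[OF assms(2,3)] that order_trans by blast
      then show ?thesis unfolding fil using zero by blast
    qed
    show "(\<Inter>j\<in>{1..}. fil (S_mod p \<rho> i) j) = {\<zero>\<^bsub>S_mod p \<rho> i\<^esub>}"
    proof (intro equalityI subsetI)
      fix x assume x: "x \<in> (\<Inter>j\<in>{1..}. fil (S_mod p \<rho> i) j)"
      have xc: "x \<in> carrier (Zp p)" using x unfolding fil by auto
      have "x n = 0" for n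
      proof -
        define j where "j = Suc ((\<rho> ^^ n) i)"
        have "n \<le> steps \<rho> i j"
          using steps_le_iff[OF assms(2,3), of j n] by (simp add: j_def)
        moreover have "j \<in> {1..}" by (simp add: j_def)
        then have "x \<in> fil (S_mod p \<rho> i) j" using x by blast
        then have "x (steps \<rho> i j) = 0" unfolding fil by auto
        ultimately show "x n = 0" using zero xc by blast
      qed
      then show "x \<in> {\<zero>\<^bsub>S_mod p \<rho> i\<^esub>}" by (auto simp: simps)
    qed (auto simp: fil simps Zp_zero_closed[OF p])
  qed
qed

lemma prod_filt_simps:
  "carrier (prod_filt I M) = (\<Pi>\<^sub>E i\<in>I. carrier (M i))"
  "\<zero>\<^bsub>prod_filt I M\<^esub> = (\<lambda>i\<in>I. \<zero>\<^bsub>M i\<^esub>)"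
  "x \<oplus>\<^bsub>prod_filt I M\<^esub> y = (\<lambda>i\<in>I. x i \<oplus>\<^bsub>M i\<^esub> y i)"
  "a \<odot>\<^bsub>prod_filt I M\<^esub> x = (\<lambda>i\<in>I. a \<odot>\<^bsub>M i\<^esub> x i)"
  "fil (prod_filt I M) j = (\<Pi>\<^sub>E i\<in>I. fil (M i) j)"
  by (simp_all add: prod_filt_def)

lemma dsum_filt_simps:
  "carrier (M \<oplus>\<^sub>f N) = carrier M \<times> carrier N"
  "\<zero>\<^bsub>M \<oplus>\<^sub>f N\<^esub> = (\<zero>\<^bsub>M\<^esub>, \<zero>\<^bsub>N\<^esub>)"
  "x \<oplus>\<^bsub>M \<oplus>\<^sub>f N\<^esub> y = (fst x \<oplus>\<^bsub>M\<^esub> fst y, snd x \<oplus>\<^bsub>N\<^esub> snd y)"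
  "a \<odot>\<^bsub>M \<oplus>\<^sub>f N\<^esub> x = (a \<odot>\<^bsub>M\<^esub> fst x, a \<odot>\<^bsub>N\<^esub> snd x)"
  "fil (M \<oplus>\<^sub>f N) j = fil M j \<times> fil N j"
  by (simp_all add: dsum_filt_def case_prod_beta)

lemma filtered_module_prod_filt:
  assumes R: "cring R" and M: "\<And>i. i \<in> I \<Longrightarrow> filtered_module R (M i)"
  shows "filtered_module R (prod_filt I M)"
proof -
  interpret R: cring R by fact
  have mod: "Module.module R (M i)" if "i \<in> I" for i
    using M[OF that] by (simp add: filtered_module_def)
  have ab: "abelian_group (M i)" if "i \<in> I" for i
    using mod[OF that] by (simp add: Module.module_def)
  have am: "abelian_monoid (M i)" if "i \<in> I" for i
    using ab[OF that] by (simp add: abelian_group_def)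
  note simps = prod_filt_simps
  have "abelian_group (prod_filt I M)"
  proof (rule abelian_groupI, goal_cases)
    case (6 x)
    have "(\<lambda>i\<in>I. \<ominus>\<^bsub>M i\<^esub> x i) \<oplus>\<^bsub>prod_filt I M\<^esub> x = \<zero>\<^bsub>prod_filt I M\<^esub>"
      using 6 by (auto simp: simps PiE_iff abelian_group.l_neg ab intro!: restrict_ext)
    moreover have "(\<lambda>i\<in>I. \<ominus>\<^bsub>M i\<^esub> x i) \<in> carrier (prod_filt I M)"
      using 6 by (auto simp: simps PiE_iff abelian_group.a_inv_closed ab)
    ultimately show ?case by blast
  next
    case (5 x)
    then show ?case
      by (intro extensionalityI[of _ I])
         (auto simp: simps PiE_iff abelian_monoid.l_zero am)
  next
    case (3 x y z)
    then show ?case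
      by (intro extensionalityI[of _ I])
         (auto simp: simps PiE_iff intro!: abelian_monoid.a_assoc[OF am])
  next
    case (4 x y)
    then show ?case
      unfolding simps by (intro restrict_ext abelian_monoid.a_comm[OF am]) (auto simp: PiE_iff)
  qed (auto simp: simps PiE_iff abelian_monoid.a_closed abelian_monoid.zero_closed am)
  then have "Module.module R (prod_filt I M)"
  proof (rule moduleI[OF R], goal_cases)
    case (5 x)
    then show ?case
      by (intro extensionalityI[of _ I]) (auto simp: simps PiE_iff Module.module.smult_one mod)
  next
    case (1 a x)
    then show ?case
      by (auto simp: simps PiE_iff intro!: Module.module.smult_closed[OF mod])
  next
    case (2 a b x)
    then show ?case
      by (intro extensionalityI[of _ I])
         (auto simp: simps PiE_iff intro!: Module.module.smult_l_distr[OF mod])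
  next
    case (3 a x y)
    then show ?case
      by (intro extensionalityI[of _ I])
         (auto simp: simps PiE_iff intro!: Module.module.smult_r_distr[OF mod])
  next
    case (4 a b x)
    then show ?case
      by (intro extensionalityI[of _ I])
         (auto simp: simps PiE_iff intro!: Module.module.smult_assoc1[OF mod])
  qed
  then interpret P: Module.module R "prod_filt I M" .
  have sub: "submodule (fil (M i) j) R (M i)" if "i \<in> I" "j \<ge> 1" for i j
    using filtered_module.fil_submodule[OF M[OF that(1)] that(2)] .
  have subset: "fil (M i) j \<subseteq> carrier (M i)" if "i \<in> I" "j \<ge> 1" for i j
    using filtered_module.fil_subset[OF M[OF that(1)] that(2)] .
  have 0: "\<zero>\<^bsub>M i\<^esub> \<in> fil (M i) j" if "i \<in> I" "j \<ge> 1" for i j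
    using subgroup.one_closed[OF submodule.axioms(1)[OF sub[OF that]]] by simp
  show ?thesis
  proof (intro filtered_module.intro filtered_module_axioms.intro)
    show "Module.module R (prod_filt I M)" by (rule P.module_axioms)
    show "fil (prod_filt I M) 1 = carrier (prod_filt I M)"
      using filtered_module.fil_1[OF M] by (auto simp: simps PiE_iff)
    show "submodule (fil (prod_filt I M) j) R (prod_filt I M)" if "j \<ge> 1" for j
    proof (rule P.submoduleI_smult)
      show "fil (prod_filt I M) j \<subseteq> carrier (prod_filt I M)"
        unfolding simps using subset[OF _ that] by (rule PiE_mono)
      show "x \<oplus>\<^bsub>prod_filt I M\<^esub> y \<in> fil (prod_filt I M) j"
        if "x \<in> fil (prod_filt I M) j" "y \<in> fil (prod_filt I M) j" for x y
        using that sub[OF _ \<open>j \<ge> 1\<close>] by (auto simp: simps PiE_iff intro!: Module.module.submoduleE(5)[OF mod])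
      show "a \<odot>\<^bsub>prod_filt I M\<^esub> x \<in> fil (prod_filt I M) j"
        if "a \<in> carrier R" "x \<in> fil (prod_filt I M) j" for a x
        using that sub[OF _ \<open>j \<ge> 1\<close>] by (auto simp: simps PiE_iff intro!: Module.module.submoduleE(4)[OF mod])
    qed (use 0[OF _ that] in \<open>auto simp: simps\<close>)
    show "fil (prod_filt I M) k \<subseteq> fil (prod_filt I M) j" if "1 \<le> j" "j \<le> k" for j k
      unfolding simps using filtered_module.fil_antimono[OF M that] by (intro PiE_mono)
    show "(\<Inter>j\<in>{1..}. fil (prod_filt I M) j) = {\<zero>\<^bsub>prod_filt I M\<^esub>}"
    proof (intro equalityI subsetI)
      fix x assume x: "x \<in> (\<Inter>j\<in>{1..}. fil (prod_filt I M) j)"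
      have "x i = \<zero>\<^bsub>M i\<^esub>" if "i \<in> I" for i
      proof -
        have "x i \<in> (\<Inter>j\<in>{1..}. fil (M i) j)"
          using x that by (auto simp: simps PiE_iff)
        then show ?thesis unfolding filtered_module.fil_Inter[OF M[OF that]] by simp
      qed
      moreover have "x \<in> extensional I" using x by (auto simp: simps PiE_iff)
      ultimately show "x \<in> {\<zero>\<^bsub>prod_filt I M\<^esub>}"
        by (auto simp: simps intro: extensionalityI[of _ I])
    qed (use 0 in \<open>auto simp: simps\<close>)
  qed
qed

lemma filtered_module_dsum_filt:
  assumes M: "filtered_module R M" and N: "filtered_module R N"
  shows "filtered_module R (M \<oplus>\<^sub>f N)"
proof -
  interpret M: filtered_module R M by fact
  interpret N: filtered_module R N by fact
  note simps = dsum_filt_simps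
  have "abelian_group (M \<oplus>\<^sub>f N)"
  proof (rule abelian_groupI, goal_cases)
    case (6 x)
    then show ?case
      by (intro bexI[of _ "(\<ominus>\<^bsub>M\<^esub> fst x, \<ominus>\<^bsub>N\<^esub> snd x)"]) (auto simp: simps M.l_neg N.l_neg)
  next
    case (4 x y)
    then show ?case by (simp add: simps mem_Times_iff M.a_comm[of "fst x"] N.a_comm[of "snd x"])
  qed (auto simp: simps M.a_assoc N.a_assoc)
  then have "Module.module R (M \<oplus>\<^sub>f N)"
    by (rule moduleI[OF M.is_cring])
       (auto simp: simps M.smult_l_distr N.smult_l_distr M.smult_r_distr N.smult_r_distr
         M.smult_assoc1 N.smult_assoc1)
  then interpret P: Module.module R "M \<oplus>\<^sub>f N" .
  have 0: "\<zero>\<^bsub>M\<^esub> \<in> fil M j" "\<zero>\<^bsub>N\<^esub> \<in> fil N j" if "j \<ge> 1" for j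
    using subgroup.one_closed[OF submodule.axioms(1)[OF M.fil_submodule[OF that]]]
      subgroup.one_closed[OF submodule.axioms(1)[OF N.fil_submodule[OF that]]] by simp_all
  show ?thesis
  proof (intro filtered_module.intro filtered_module_axioms.intro)
    show "Module.module R (M \<oplus>\<^sub>f N)" by (rule P.module_axioms)
    show "fil (M \<oplus>\<^sub>f N) 1 = carrier (M \<oplus>\<^sub>f N)"
      by (simp only: simps M.fil_1 N.fil_1)
    show "submodule (fil (M \<oplus>\<^sub>f N) j) R (M \<oplus>\<^sub>f N)" if "j \<ge> 1" for j
      by (rule P.submoduleI_smult)
         (use M.fil_subset[OF that] N.fil_subset[OF that] 0[OF that] M.submoduleE(4,5)[OF M.fil_submodule[OF that]]
            N.submoduleE(4,5)[OF N.fil_submodule[OF that]] in \<open>auto simp: simps\<close>)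
    show "fil (M \<oplus>\<^sub>f N) k \<subseteq> fil (M \<oplus>\<^sub>f N) j" if "1 \<le> j" "j \<le> k" for j k
      using M.fil_antimono[OF that] N.fil_antimono[OF that] by (auto simp: simps)
    have "(\<Inter>j\<in>{1..}. fil (M \<oplus>\<^sub>f N) j) = (\<Inter>j\<in>{1..}. fil M j) \<times> (\<Inter>j\<in>{1..}. fil N j)"
      by (auto simp: simps)
    then show "(\<Inter>j\<in>{1..}. fil (M \<oplus>\<^sub>f N) j) = {\<zero>\<^bsub>M \<oplus>\<^sub>f N\<^esub>}"
      unfolding M.fil_Inter N.fil_Inter simps by simp
  qed
qed

section \<open>Free filtered modules in coordinates\<close>

definition Zp_of_nat :: "nat \<Rightarrow> nat \<Rightarrow> padic" where
  "Zp_of_nat p c = (\<lambda>n. int c mod int p ^ n)"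

lemma Zp_of_nat_closed: "p > 0 \<Longrightarrow> Zp_of_nat p c \<in> carrier (Zp p)"
  unfolding Zp_of_nat_def by (rule Zp_of_int_closed)

lemma funpow_shift_mono_arg:
  assumes "shift \<rho>" "i \<le> i'" "i \<ge> 1"
  shows "(\<rho> ^^ k) i \<le> (\<rho> ^^ k) i'"
proof (induction k)
  case (Suc k)
  have "1 \<le> (\<rho> ^^ k) i" using funpow_shift_ge[OF assms(1,3), of k] assms(3) by simp
  then show ?case using Suc shift_mono[OF assms(1)] by simp
qed (use assms in simp)

text \<open>The module is a finite product of the modules \<open>S\<^bsub>w j\<^esub>\<close>, in the form of an isomorphism \<open>coord\<close> onto
that product: this covers iterated products and direct sums without regard to how they are nested.\<close>

locale free_filtered_module = filtered_module "Zp p" M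
  for p :: nat and M :: "(padic, 'm) filt_module" (structure) +
  fixes \<rho> :: "nat \<Rightarrow> nat" and J :: "'j set" and w :: "'j \<Rightarrow> nat" and coord :: "'m \<Rightarrow> 'j \<Rightarrow> padic"
  assumes p_gt_1: "p > 1" and shift: "shift \<rho>"
    and finite_J: "finite J" and w_pos: "j \<in> J \<Longrightarrow> w j \<ge> 1"
    and coord_bij: "bij_betw coord (carrier M) (J \<rightarrow>\<^sub>E carrier (Zp p))"
    and coord_add: "x \<in> carrier M \<Longrightarrow> y \<in> carrier M \<Longrightarrow> j \<in> J \<Longrightarrow>
      coord (x \<oplus> y) j = coord x j \<oplus>\<^bsub>Zp p\<^esub> coord y j"
    and coord_smult: "a \<in> carrier (Zp p) \<Longrightarrow> x \<in> carrier M \<Longrightarrow> j \<in> J \<Longrightarrow>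
      coord (a \<odot> x) j = a \<otimes>\<^bsub>Zp p\<^esub> coord x j"
    and fil_crd: "i \<ge> 1 \<Longrightarrow> x \<in> carrier M \<Longrightarrow>
      x \<in> fil M i \<longleftrightarrow> (\<forall>j\<in>J. coord x j \<in> fil (S_mod p \<rho> (w j)) i)"
begin

lemma p_pos: "p > 0" using p_gt_1 by simp

lemma coord_closed: "x \<in> carrier M \<Longrightarrow> j \<in> J \<Longrightarrow> coord x j \<in> carrier (Zp p)"
  using bij_betw_imp_funcset[OF coord_bij] by (auto simp: PiE_iff Pi_iff)

lemma coord_add_nth: "x \<in> carrier M \<Longrightarrow> y \<in> carrier M \<Longrightarrow> j \<in> J \<Longrightarrow>
    coord (x \<oplus> y) j n = (coord x j n + coord y j n) mod int p ^ n"
  by (simp add: coord_add Zp_simps)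

lemma coord_smult_nth: "a \<in> carrier (Zp p) \<Longrightarrow> x \<in> carrier M \<Longrightarrow> j \<in> J \<Longrightarrow>
    coord (a \<odot> x) j n = (a n * coord x j n) mod int p ^ n"
  by (simp add: coord_smult Zp_simps)

lemma coord_zero [simp]: "j \<in> J \<Longrightarrow> coord \<zero> j n = 0"
  using coord_smult_nth[of "\<zero>\<^bsub>Zp p\<^esub>" "\<zero>" j n] smult_l_null[of "\<zero>"]
  by (simp add: Zp_simps Zp_zero_closed[OF p_pos])

lemma coord_mod: "x \<in> carrier M \<Longrightarrow> j \<in> J \<Longrightarrow> coord x j n mod int p ^ n = coord x j n"
  using Zp_mod_self coord_closed by blast

lemma coord_compat: "x \<in> carrier M \<Longrightarrow> j \<in> J \<Longrightarrow> m \<le> n \<Longrightarrow> coord x j n mod int p ^ m = coord x j m"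
  using Zp_compat coord_closed by blast

lemma coord_ex:
  assumes "\<And>j. j \<in> J \<Longrightarrow> c j \<in> carrier (Zp p)"
  shows "\<exists>x\<in>carrier M. \<forall>j\<in>J. coord x j = c j"
proof -
  have "restrict c J \<in> J \<rightarrow>\<^sub>E carrier (Zp p)" using assms by auto
  then obtain x where "x \<in> carrier M" "coord x = restrict c J"
    using coord_bij unfolding bij_betw_def by (metis (no_types, lifting) imageE)
  then show ?thesis by (intro bexI[of _ x]) simp_all
qed

lemma coord_eqI:
  assumes "x \<in> carrier M" "y \<in> carrier M" "\<And>j n. j \<in> J \<Longrightarrow> coord x j n = coord y j n"
  shows "x = y"
proof -
  have "coord x \<in> J \<rightarrow>\<^sub>E carrier (Zp p)" "coord y \<in> J \<rightarrow>\<^sub>E carrier (Zp p)"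
    using assms(1,2) coord_bij by (auto simp: bij_betw_def)
  then have "coord x = coord y" using assms(3) by (intro PiE_ext) auto
  then show ?thesis using coord_bij assms(1,2) by (auto simp: bij_betw_def dest: inj_onD)
qed

lemma fil_iff: "i \<ge> 1 \<Longrightarrow> x \<in> carrier M \<Longrightarrow>
    x \<in> fil M i \<longleftrightarrow> (\<forall>j\<in>J. coord x j (steps \<rho> (w j) i) = 0)"
  using fil_crd coord_closed fil_S_mod[OF p_pos shift w_pos] by auto

lemma fil_carrier: "i \<ge> 1 \<Longrightarrow> x \<in> fil M i \<Longrightarrow> x \<in> carrier M"
  using fil_subset by auto

text \<open>Congruence modulo \<open>p\<^sup>k M\<close>; see \<open>cong_at_iff_ex\<close>.\<close>

definition cong_at :: "nat \<Rightarrow> 'm \<Rightarrow> 'm \<Rightarrow> bool" where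
  "cong_at k x y \<longleftrightarrow> (\<forall>j\<in>J. coord x j k = coord y j k)"

lemma cong_at_refl [simp]: "cong_at k x x" by (simp add: cong_at_def)

lemma cong_at_sym: "cong_at k x y \<Longrightarrow> cong_at k y x" by (simp add: cong_at_def)

lemma cong_at_trans: "cong_at k x y \<Longrightarrow> cong_at k y z \<Longrightarrow> cong_at k x z" by (simp add: cong_at_def)

lemma cong_at_all_imp_eq:
  "x \<in> carrier M \<Longrightarrow> y \<in> carrier M \<Longrightarrow> (\<And>k. cong_at k x y) \<Longrightarrow> x = y"
  by (rule coord_eqI) (auto simp: cong_at_def)

lemma cong_at_iff_ex:
  assumes "x \<in> carrier M" "y \<in> carrier M"
  shows "cong_at k x y \<longleftrightarrow> (\<exists>z\<in>carrier M. x = y \<oplus> Zp_of_nat p (p ^ k) \<odot> z)"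
proof
  assume *: "cong_at k x y"
  let ?d = "x \<ominus> y"
  have d: "?d \<in> carrier M" "x = y \<oplus> ?d"
    using assms by (simp_all add: minus_eq) (metis M.a_comm M.a_inv_closed M.r_neg2)
  have "coord ?d j k = 0" if j: "j \<in> J" for j
  proof -
    have "coord x j k = (coord y j k + coord ?d j k) mod int p ^ k"
      using coord_add_nth[OF assms(2) d(1) j] d(2) by metis
    then have "(coord y j k + coord ?d j k) mod int p ^ k = coord y j k mod int p ^ k"
      using * j coord_mod[OF assms(2) j] by (simp add: cong_at_def)
    then have "coord ?d j k mod int p ^ k = 0"
      by (metis add_diff_cancel_left' mod_0_imp_dvd mod_eq_0_iff_dvd mod_eq_dvd_iff)
    then show ?thesis using coord_mod[OF d(1) j] by simp
  qed
  then have "\<exists>c\<in>carrier (Zp p). \<forall>n. coord ?d j n = (int p ^ k * c n) mod int p ^ n" if "j \<in> J" for j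
    using Zp_divide_power[OF p_pos coord_closed[OF d(1)]] that by blast
  then obtain c where c: "\<And>j. j \<in> J \<Longrightarrow> c j \<in> carrier (Zp p)"
    "\<And>j n. j \<in> J \<Longrightarrow> coord ?d j n = (int p ^ k * c j n) mod int p ^ n"
    by metis
  obtain z where z: "z \<in> carrier M" "\<And>j. j \<in> J \<Longrightarrow> coord z j = c j"
    using coord_ex[of c] c by blast
  have "?d = Zp_of_nat p (p ^ k) \<odot> z"
  proof (rule coord_eqI)
    fix j n assume j: "j \<in> J"
    show "coord ?d j n = coord (Zp_of_nat p (p ^ k) \<odot> z) j n"
      using c(2)[OF j, of n] z j
      by (simp add: coord_smult_nth Zp_of_nat_closed p_pos) (simp add: Zp_of_nat_def mod_simps)
  qed (use d z in \<open>auto simp: Zp_of_nat_closed p_pos\<close>)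
  then show "\<exists>z\<in>carrier M. x = y \<oplus> Zp_of_nat p (p ^ k) \<odot> z" using d z by metis
next
  assume "\<exists>z\<in>carrier M. x = y \<oplus> Zp_of_nat p (p ^ k) \<odot> z"
  then obtain z where z: "z \<in> carrier M" "x = y \<oplus> Zp_of_nat p (p ^ k) \<odot> z" by blast
  have "coord x j k = coord y j k" if "j \<in> J" for j
    using z assms that coord_mod[OF assms(2) that]
    by (simp add: coord_smult_nth coord_add_nth Zp_of_nat_closed p_pos) (simp add: Zp_of_nat_def mod_simps)
  then show "cong_at k x y" by (simp add: cong_at_def)
qed

lemma linear_maps_cong_at:
  assumes "\<alpha> \<in> linear_maps (Zp p) M M" "x \<in> carrier M" "y \<in> carrier M" "cong_at k x y"
  shows "cong_at k (\<alpha> x) (\<alpha> y)"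
proof -
  obtain z where z: "z \<in> carrier M" "x = y \<oplus> Zp_of_nat p (p ^ k) \<odot> z"
    using assms cong_at_iff_ex by blast
  have \<alpha>: "\<alpha> v \<in> carrier M" if "v \<in> carrier M" for v
    using assms(1) that by (auto simp: linear_maps_def)
  have "\<alpha> x = \<alpha> y \<oplus> Zp_of_nat p (p ^ k) \<odot> \<alpha> z"
    using assms(1,3) z by (simp add: linear_maps_def Zp_of_nat_closed p_pos)
  then show ?thesis using cong_at_iff_ex[of "\<alpha> x" "\<alpha> y" k] \<alpha> assms z by blast
qed

text \<open>Completeness of \<open>M\<close>. As a p-adic integer is its sequence of residues, the limit is a diagonal
sequence: its \<open>n\<close>-th residue is that of the \<open>n\<close>-th term.\<close>

lemma cauchy_limit_ex:
  assumes X: "\<And>n. X n \<in> carrier M" and cauchy: "\<And>n. cong_at n (X (Suc n)) (X n)"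
  shows "\<exists>x\<in>carrier M. \<forall>n. cong_at n x (X n)"
proof -
  have "(\<lambda>n. coord (X n) j n) \<in> carrier (Zp p)" if j: "j \<in> J" for j
  proof (rule Zp_memI[OF p_pos, of _ "\<lambda>n. coord (X n) j n"])
    fix n
    show "coord (X n) j n = coord (X n) j n mod int p ^ n" using coord_mod[OF X j] by simp
    have "coord (X (Suc n)) j (Suc n) mod int p ^ n = coord (X (Suc n)) j n"
      using coord_compat[OF X j] by simp
    also have "\<dots> = coord (X n) j n" using cauchy j by (simp add: cong_at_def)
    finally show "coord (X (Suc n)) j (Suc n) mod int p ^ n = coord (X n) j n mod int p ^ n"
      using coord_mod[OF X j] by simp
  qed
  then obtain x where "x \<in> carrier M" "\<And>j. j \<in> J \<Longrightarrow> coord x j = (\<lambda>n. coord (X n) j n)"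
    using coord_ex[of "\<lambda>j n. coord (X n) j n"] by blast
  then show ?thesis by (intro bexI[of _ x]) (simp_all add: cong_at_def)
qed

text \<open>Membership in \<open>M\<^sub>i\<close> is a condition on finitely many residues, hence p-adically closed.\<close>

lemma fil_closed:
  assumes "i \<ge> 1" "x \<in> carrier M" "\<And>k. \<exists>y\<in>fil M i. cong_at k x y"
  shows "x \<in> fil M i"
  unfolding fil_iff[OF assms(1,2)]
proof
  fix j assume j: "j \<in> J"
  obtain y where y: "y \<in> fil M i" "cong_at (steps \<rho> (w j) i) x y" using assms(3) by blast
  then show "coord x j (steps \<rho> (w j) i) = 0"
    using fil_iff[OF assms(1) fil_carrier[OF assms(1) y(1)]] j by (simp add: cong_at_def)
qed

lemma fil_add: "i \<ge> 1 \<Longrightarrow> x \<in> fil M i \<Longrightarrow> y \<in> fil M i \<Longrightarrow> x \<oplus> y \<in> fil M i"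
  using submoduleE(5)[OF fil_submodule] .

lemma fil_minus: "i \<ge> 1 \<Longrightarrow> x \<in> fil M i \<Longrightarrow> y \<in> fil M i \<Longrightarrow> x \<ominus> y \<in> fil M i"
  unfolding minus_eq by (rule fil_add) (auto intro: submoduleE(3)[OF fil_submodule])

lemma fil_zero: "i \<ge> 1 \<Longrightarrow> \<zero> \<in> fil M i"
  using subgroup.one_closed[OF submodule.axioms(1)[OF fil_submodule]] by simp

subsection \<open>Morphisms out of a free filtered module\<close>

lemma basis_ex:
  assumes "j \<in> J"
  shows "\<exists>b\<in>fil M (w j). \<forall>j'\<in>J. coord b j' = (if j' = j then \<one>\<^bsub>Zp p\<^esub> else \<zero>\<^bsub>Zp p\<^esub>)"
proof -
  obtain b where b: "b \<in> carrier M" "\<forall>j'\<in>J. coord b j' = (if j' = j then \<one>\<^bsub>Zp p\<^esub> else \<zero>\<^bsub>Zp p\<^esub>)"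
    using coord_ex[of "\<lambda>j'. if j' = j then \<one>\<^bsub>Zp p\<^esub> else \<zero>\<^bsub>Zp p\<^esub>"]
    by (metis R.one_closed R.zero_closed)
  have "steps \<rho> (w j) (w j) \<le> 0"
    by (subst steps_le_iff[OF shift w_pos[OF assms]]) simp
  then have "b \<in> fil M (w j)"
    unfolding fil_iff[OF w_pos[OF assms] b(1)] using b(2) by (simp add: Zp_simps)
  then show ?thesis using b(2) by blast
qed

definition basis :: "'j \<Rightarrow> 'm" where
  "basis j = (SOME b. b \<in> fil M (w j) \<and> (\<forall>j'\<in>J. coord b j' = (if j' = j then \<one>\<^bsub>Zp p\<^esub> else \<zero>\<^bsub>Zp p\<^esub>)))"

lemma basis:
  assumes "j \<in> J"
  shows "basis j \<in> fil M (w j)" "basis j \<in> carrier M"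
    "j' \<in> J \<Longrightarrow> coord (basis j) j' = (if j' = j then \<one>\<^bsub>Zp p\<^esub> else \<zero>\<^bsub>Zp p\<^esub>)"
proof -
  have *: "basis j \<in> fil M (w j) \<and> (\<forall>j'\<in>J. coord (basis j) j' = (if j' = j then \<one>\<^bsub>Zp p\<^esub> else \<zero>\<^bsub>Zp p\<^esub>))"
    unfolding basis_def by (rule someI_ex) (use basis_ex[OF assms] in blast)
  show fil: "basis j \<in> fil M (w j)" using * by simp
  show "coord (basis j) j' = (if j' = j then \<one>\<^bsub>Zp p\<^esub> else \<zero>\<^bsub>Zp p\<^esub>)" if "j' \<in> J"
    by (rule bspec[OF conjunct2[OF *] that])
  show "basis j \<in> carrier M" using fil_carrier[OF w_pos[OF assms] fil] .
qed

text \<open>Induction on the set of coordinates that may be nonzero, splitting off one basis vector at a time.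
The agreement at zero starts the induction.\<close>

lemma linear_maps_eqI:
  assumes h: "h \<in> linear_maps (Zp p) M N" and h': "h' \<in> linear_maps (Zp p) M N"
    and zero: "h \<zero> = h' \<zero>" and agree: "\<And>j. j \<in> J \<Longrightarrow> h (basis j) = h' (basis j)"
  shows "h = h'"
proof -
  have supported: "h x = h' x"
    if "finite S" "x \<in> carrier M" "S \<subseteq> J" "\<And>j n. j \<in> J - S \<Longrightarrow> coord x j n = 0" for S x
    using that
  proof (induction S arbitrary: x rule: finite_induct)
    case empty
    then have "x = \<zero>" by (intro coord_eqI) auto
    then show ?case using zero by simp
  next
    case (insert j S)
    have j: "j \<in> J" using insert.prems by auto
    let ?b = "coord x j \<odot> basis j"
    have b: "?b \<in> carrier M" using coord_closed insert.prems(1) j basis(2)[OF j] by simp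
    obtain y where y: "y \<in> carrier M" and x: "x = ?b \<oplus> y"
    proof
      show "x \<ominus> ?b \<in> carrier M" using b insert.prems(1) by simp
      show "x = ?b \<oplus> (x \<ominus> ?b)"
        using b insert.prems(1) by (simp add: minus_eq) (metis M.a_comm M.a_inv_closed M.r_neg2)
    qed
    have "coord y j' n = 0" if j': "j' \<in> J - S" for j' n
    proof -
      have "coord x j' n = (coord ?b j' n + coord y j' n) mod int p ^ n"
        using coord_add_nth[OF b y, of j' n] j' by (simp flip: x)
      moreover have "coord ?b j' n = coord x j' n"
      proof (cases "j' = j")
        case True
        then show ?thesis
          using coord_smult_nth[OF coord_closed[OF insert.prems(1) j] basis(2)[OF j] j, of n]
            basis(3)[OF j j] coord_mod[OF insert.prems(1) j, of n]
          by (simp add: Zp_simps mod_simps)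
      next
        case False
        then show ?thesis
          using coord_smult_nth[OF coord_closed[OF insert.prems(1) j] basis(2)[OF j], of j' n]
            basis(3)[OF j, of j'] insert.prems(3)[of j'] j'
          by (simp add: Zp_simps)
      qed
      ultimately have "coord y j' n mod int p ^ n = 0"
        using coord_mod[OF insert.prems(1), of j' n] j'
        by (metis DiffD1 add_diff_cancel_left' dvd_imp_mod_0 mod_eq_dvd_iff)
      then show ?thesis using coord_mod[OF y, of j' n] j' by simp
    qed
    then have hy: "h y = h' y" using insert y by auto
    have "h x = h ?b \<oplus>\<^bsub>N\<^esub> h y" using h b y by (subst x) (simp add: linear_maps_def)
    also have "\<dots> = h' ?b \<oplus>\<^bsub>N\<^esub> h' y"
      using h h' hy agree[OF j] coord_closed[OF insert.prems(1) j] basis(2)[OF j]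
      by (simp add: linear_maps_def)
    also have "\<dots> = h' x" using h' b y by (subst (2) x) (simp add: linear_maps_def)
    finally show ?case .
  qed
  show ?thesis
  proof (rule extensionalityI)
    show "h \<in> extensional (carrier M)" "h' \<in> extensional (carrier M)"
      using h h' by (auto simp: linear_maps_def PiE_iff)
  qed (use supported[OF finite_J] in auto)
qed

text \<open>If \<open>k\<close> steps lead from weight \<open>v\<close> to weight \<open>i\<close>, then \<open>a\<close> is divisible by \<open>p\<^sup>k\<close>, and multiplication
by \<open>p\<^sup>k\<close> raises the weight of every element of \<open>M\<^sub>v\<close> to at least \<open>i\<close> because \<open>\<rho>\<close> is monotone.\<close>

lemma fil_smult:
  assumes "a \<in> fil (S_mod p \<rho> v) i" "m \<in> fil M v" "v \<ge> 1" "i \<ge> 1"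
  shows "a \<odot> m \<in> fil M i"
proof -
  have a: "a \<in> carrier (Zp p)" "a (steps \<rho> v i) = 0"
    using assms fil_S_mod[OF p_pos shift] by auto
  have m: "m \<in> carrier M" using fil_carrier assms by blast
  have "coord (a \<odot> m) j (steps \<rho> (w j) i) = 0" if j: "j \<in> J" for j
  proof -
    let ?k = "steps \<rho> v i" and ?l = "steps \<rho> (w j) v"
    have "coord m j ?l = 0" using fil_iff[OF assms(3) m] assms(2) j by blast
    moreover have "coord m j (?k + ?l) mod int p ^ ?l = coord m j ?l" using coord_compat[OF m j] by simp
    moreover have "a (?k + ?l) mod int p ^ ?k = a ?k" using Zp_compat[OF a(1)] by simp
    ultimately have "int p ^ ?k * int p ^ ?l dvd a (?k + ?l) * coord m j (?k + ?l)"
      using a(2) by (intro mult_dvd_mono) auto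
    then have "coord (a \<odot> m) j (?k + ?l) = 0"
      using a m j by (simp add: coord_smult_nth power_add)
    moreover have "steps \<rho> (w j) i \<le> ?k + ?l"
    proof -
      have "v \<le> (\<rho> ^^ ?l) (w j)" using steps_le_iff[OF shift w_pos[OF j]] by blast
      then have "(\<rho> ^^ ?k) v \<le> (\<rho> ^^ ?k) ((\<rho> ^^ ?l) (w j))"
        using assms(3) by (rule funpow_shift_mono_arg[OF shift])
      moreover have "i \<le> (\<rho> ^^ ?k) v" using steps_le_iff[OF shift assms(3)] by blast
      ultimately show ?thesis
        by (subst steps_le_iff[OF shift w_pos[OF j]]) (simp add: funpow_add)
    qed
    ultimately show ?thesis
      using coord_compat[of "a \<odot> m" j "steps \<rho> (w j) i" "?k + ?l"] a m j by simp
  qed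
  then show ?thesis using fil_iff[OF assms(4)] a m by simp
qed

lemma fil_prime_multiple:
  assumes "m \<in> fil M i" "i \<ge> 1" "k \<ge> 1" "k \<le> \<rho> i"
  shows "Zp_of_nat p p \<odot> m \<in> fil M k"
proof (rule fil_smult[OF _ assms(1,2,3)])
  have "steps \<rho> i k \<le> 1" using assms by (subst steps_le_iff[OF shift]) auto
  then have "Zp_of_nat p p (steps \<rho> i k) = 0"
    using Zp_compat[OF Zp_of_nat_closed[OF p_pos], of "steps \<rho> i k" 1 p] by (simp add: Zp_of_nat_def)
  then show "Zp_of_nat p p \<in> fil (S_mod p \<rho> i) k"
    using fil_S_mod[OF p_pos shift assms(2)] Zp_of_nat_closed[OF p_pos] by simp
qed

text \<open>Freeness: a filtered morphism can be prescribed on the basis as long as weights do not drop. It is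
built by letting one more basis vector at a time have a nonzero image.\<close>

lemma Hom_filt_ex:
  assumes m: "\<And>j. j \<in> J \<Longrightarrow> m j \<in> fil M (w j)"
  shows "\<exists>\<alpha>\<in>Hom_filt (Zp p) M M. \<forall>j\<in>J. \<alpha> (basis j) = m j"
proof -
  have mc: "m j \<in> carrier M" if "j \<in> J" for j using m[OF that] fil_carrier[OF w_pos[OF that]] by blast
  have "\<exists>\<alpha>\<in>Hom_filt (Zp p) M M. \<forall>j\<in>J. \<alpha> (basis j) = (if j \<in> S then m j else \<zero>)"
    if "finite S" "S \<subseteq> J" for S
    using that
  proof (induction S rule: finite_induct)
    case empty
    have "(\<lambda>x\<in>carrier M. \<zero>) \<in> Hom_filt (Zp p) M M"
      using fil_zero fil_carrier by (auto simp: Hom_filt_def linear_maps_def)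
    then show ?case using basis(2) by (intro bexI) auto
  next
    case (insert j S)
    then obtain \<alpha> where \<alpha>: "\<alpha> \<in> Hom_filt (Zp p) M M"
      "\<And>j. j \<in> J \<Longrightarrow> \<alpha> (basis j) = (if j \<in> S then m j else \<zero>)" by auto
    have j: "j \<in> J" using insert by auto
    define \<beta> where "\<beta> = (\<lambda>x\<in>carrier M. \<alpha> x \<oplus> coord x j \<odot> m j)"
    have lin: "\<alpha> \<in> linear_maps (Zp p) M M" and fil\<alpha>: "\<And>i x. i \<ge> 1 \<Longrightarrow> x \<in> fil M i \<Longrightarrow> \<alpha> x \<in> fil M i"
      using \<alpha>(1) by (auto simp: Hom_filt_def)
    have \<alpha>c: "\<alpha> x \<in> carrier M" if "x \<in> carrier M" for x using lin that by (auto simp: linear_maps_def)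
    have \<alpha>_add: "\<alpha> (x \<oplus> y) = \<alpha> x \<oplus> \<alpha> y"
      and \<alpha>_smult: "a \<in> carrier (Zp p) \<Longrightarrow> \<alpha> (a \<odot> x) = a \<odot> \<alpha> x"
      if "x \<in> carrier M" "y \<in> carrier M" for a x y
      using lin that by (simp_all add: linear_maps_def)
    note closed = \<alpha>c mc[OF j] coord_closed[OF _ j]
    have "\<beta> (x \<oplus> y) = \<beta> x \<oplus> \<beta> y" if "x \<in> carrier M" "y \<in> carrier M" for x y
      using that closed j by (simp add: \<beta>_def \<alpha>_add coord_add smult_l_distr M.a_ac)
    moreover have "\<beta> (a \<odot> x) = a \<odot> \<beta> x" if "a \<in> carrier (Zp p)" "x \<in> carrier M" for a x
      using that closed j by (simp add: \<beta>_def \<alpha>_smult coord_smult smult_assoc1 smult_r_distr)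
    moreover have "\<beta> \<in> carrier M \<rightarrow>\<^sub>E carrier M" using closed by (auto simp: \<beta>_def)
    ultimately have "\<beta> \<in> linear_maps (Zp p) M M" by (simp add: linear_maps_def)
    moreover have "\<beta> x \<in> fil M i" if "i \<ge> 1" "x \<in> fil M i" for i x
    proof -
      have x: "x \<in> carrier M" using that fil_carrier by blast
      have "coord x j \<odot> m j \<in> fil M i"
        using fil_smult[OF _ m[OF j] w_pos[OF j] that(1)] fil_crd[OF that(1) x] that(2) j by blast
      then show ?thesis using fil\<alpha>[OF that] that x by (simp add: \<beta>_def fil_add)
    qed
    ultimately have "\<beta> \<in> Hom_filt (Zp p) M M" by (auto simp: Hom_filt_def)
    moreover have "\<beta> (basis j') = (if j' \<in> insert j S then m j' else \<zero>)" if j': "j' \<in> J" for j'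
      using \<alpha>(2)[OF j'] basis(2)[OF j'] basis(3)[OF j' j] mc[OF j] mc[OF j'] insert.hyps(2)
      by (auto simp: \<beta>_def smult_l_null)
    ultimately show ?case by blast
  qed
  from this[OF finite_J] show ?thesis by auto
qed

lemma Hom_filt_linear: "\<alpha> \<in> Hom_filt (Zp p) M N \<Longrightarrow> \<alpha> \<in> linear_maps (Zp p) M N"
  by (simp add: Hom_filt_def)

lemma Hom_filt_fil: "\<alpha> \<in> Hom_filt (Zp p) M N \<Longrightarrow> i \<ge> 1 \<Longrightarrow> x \<in> fil M i \<Longrightarrow> \<alpha> x \<in> fil N i"
  by (auto simp: Hom_filt_def)

lemma linear_maps_closed: "\<alpha> \<in> linear_maps (Zp p) M N \<Longrightarrow> x \<in> carrier M \<Longrightarrow> \<alpha> x \<in> carrier N"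
  by (auto simp: linear_maps_def)

lemma linear_maps_add: "\<alpha> \<in> linear_maps (Zp p) M N \<Longrightarrow> x \<in> carrier M \<Longrightarrow> y \<in> carrier M \<Longrightarrow>
    \<alpha> (x \<oplus> y) = \<alpha> x \<oplus>\<^bsub>N\<^esub> \<alpha> y"
  by (simp add: linear_maps_def)

lemma linear_maps_smult: "\<alpha> \<in> linear_maps (Zp p) M N \<Longrightarrow> a \<in> carrier (Zp p) \<Longrightarrow> x \<in> carrier M \<Longrightarrow>
    \<alpha> (a \<odot> x) = a \<odot>\<^bsub>N\<^esub> \<alpha> x"
  by (simp add: linear_maps_def)

lemma add_minus_cancel: "x \<in> carrier M \<Longrightarrow> y \<in> carrier M \<Longrightarrow> y \<oplus> (x \<ominus> y) = x"
  by (simp add: minus_eq) (metis M.a_comm M.a_inv_closed M.r_neg2)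

lemma minus_cong_zero_iff:
  assumes "x \<in> carrier M" "y \<in> carrier M"
  shows "cong_at k (x \<ominus> y) \<zero> \<longleftrightarrow> cong_at k x y"
proof -
  let ?d = "x \<ominus> y"
  have d: "?d \<in> carrier M" using assms by simp
  have "coord ?d j k = 0 \<longleftrightarrow> coord x j k = coord y j k" if j: "j \<in> J" for j
  proof -
    have "coord x j k = (coord y j k + coord ?d j k) mod int p ^ k"
      using coord_add_nth[OF assms(2) d j, of k] by (simp add: add_minus_cancel assms)
    moreover have "(coord y j k + coord ?d j k) mod int p ^ k = coord y j k mod int p ^ k \<longleftrightarrow> coord ?d j k mod int p ^ k = 0"
      by (simp add: mod_eq_dvd_iff mod_eq_0_iff_dvd)
    ultimately show ?thesis using coord_mod[OF assms(2) j, of k] coord_mod[OF d j, of k] by simp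
  qed
  then show ?thesis by (auto simp: cong_at_def)
qed

lemma cong_at_0: "x \<in> carrier M \<Longrightarrow> y \<in> carrier M \<Longrightarrow> cong_at 0 x y"
  using coord_closed by (simp add: cong_at_def Zp_0[where p = p])

lemma cong_at_add:
  assumes "x \<in> carrier M" "y \<in> carrier M" "x' \<in> carrier M" "y' \<in> carrier M"
    "cong_at k x x'" "cong_at k y y'"
  shows "cong_at k (x \<oplus> y) (x' \<oplus> y')"
  using assms by (simp add: cong_at_def coord_add_nth)

text \<open>Divide by \<open>p\<^sup>k\<close>: if \<open>r = p\<^sup>k s\<close>, then \<open>\<gamma> r - r = p\<^sup>k (\<gamma> s - s)\<close>.\<close>

lemma cong_at_Suc_if_cong_id:
  assumes \<gamma>: "\<gamma> \<in> linear_maps (Zp p) M M" and id: "\<And>x. x \<in> carrier M \<Longrightarrow> cong_at 1 (\<gamma> x) x"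
    and r: "r \<in> carrier M" "cong_at k r \<zero>"
  shows "cong_at (Suc k) (\<gamma> r) r"
proof -
  have pk: "Zp_of_nat p (p ^ k) \<in> carrier (Zp p)" by (rule Zp_of_nat_closed[OF p_pos])
  obtain s where s: "s \<in> carrier M" "r = \<zero> \<oplus> Zp_of_nat p (p ^ k) \<odot> s"
    using cong_at_iff_ex[of r "\<zero>" k] r by auto
  have r': "r = Zp_of_nat p (p ^ k) \<odot> s" using s pk by simp
  have \<gamma>s: "\<gamma> s \<in> carrier M" using linear_maps_closed[OF \<gamma> s(1)] .
  have \<gamma>r: "\<gamma> r = Zp_of_nat p (p ^ k) \<odot> \<gamma> s" unfolding r' using linear_maps_smult[OF \<gamma> pk s(1)] .
  have "coord (\<gamma> r) j (Suc k) = coord r j (Suc k)" if j: "j \<in> J" for j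
  proof -
    have "coord (\<gamma> s) j (Suc k) mod int p ^ 1 = coord s j (Suc k) mod int p ^ 1"
      using coord_compat[OF \<gamma>s j, of 1 "Suc k"] coord_compat[OF s(1) j, of 1 "Suc k"] id[OF s(1)] j
      by (simp add: cong_at_def)
    then have "int p ^ k * int p ^ 1 dvd int p ^ k * (coord (\<gamma> s) j (Suc k) - coord s j (Suc k))"
      unfolding mod_eq_dvd_iff by (rule mult_dvd_mono[OF dvd_refl])
    then have "(int p ^ k * coord (\<gamma> s) j (Suc k)) mod int p ^ Suc k = (int p ^ k * coord s j (Suc k)) mod int p ^ Suc k"
      unfolding mod_eq_dvd_iff by (simp add: algebra_simps)
    then show ?thesis
      unfolding \<gamma>r unfolding r' coord_smult_nth[OF pk \<gamma>s j] coord_smult_nth[OF pk s(1) j]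
      by (simp add: Zp_of_nat_def mod_simps)
  qed
  then show ?thesis by (simp add: cong_at_def)
qed

text \<open>Successive approximation. Replacing \<open>x\<close> by \<open>x + (y - \<gamma> x)\<close> gains one power of \<open>p\<close> in the equation
\<open>\<gamma> x = y\<close>, and it does not leave \<open>M\<^sub>i\<close> if \<open>y\<close> lies there. So \<open>\<gamma>\<close> maps each \<open>M\<^sub>i\<close> onto itself,
which is what makes the inverse a filtered morphism.\<close>

lemma Unit_if_cong_id:
  assumes \<gamma>: "\<gamma> \<in> Hom_filt (Zp p) M M" and id: "\<And>x. x \<in> carrier M \<Longrightarrow> cong_at 1 (\<gamma> x) x"
  shows "\<gamma> \<in> Units (End_filt (Zp p) M)"
proof -
  note lin = Hom_filt_linear[OF \<gamma>]
  note closed = linear_maps_closed[OF lin]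
  have step: "cong_at (Suc k) (\<gamma> r) r" if "r \<in> carrier M" "cong_at k r \<zero>" for k r
    by (rule cong_at_Suc_if_cong_id[OF lin _ that]) (rule id)
  have \<gamma>_minus: "\<gamma> x = \<gamma> y \<oplus> \<gamma> (x \<ominus> y)" if "x \<in> carrier M" "y \<in> carrier M" for x y
    using linear_maps_add[OF lin, of y "x \<ominus> y"] that by (simp add: add_minus_cancel)
  have inj: "x = y" if xy: "x \<in> carrier M" "y \<in> carrier M" "\<gamma> x = \<gamma> y" for x y
  proof (rule cong_at_all_imp_eq[OF xy(1,2)])
    let ?d = "x \<ominus> y"
    have d: "?d \<in> carrier M" using xy by simp
    have 0: "\<gamma> ?d = \<zero>"
      using \<gamma>_minus[OF xy(1,2)] xy(3) closed[OF xy(2)] closed[OF d] by (metis M.add.l_cancel_one')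
    show "cong_at k x y" for k
    proof (induction k)
      case 0
      show ?case using xy(1,2) by (rule cong_at_0)
    next
      case (Suc k)
      then have "cong_at (Suc k) (\<gamma> ?d) ?d" using step[OF d] minus_cong_zero_iff xy by blast
      then show ?case using 0 cong_at_sym minus_cong_zero_iff xy by metis
    qed
  qed
  have surj: "\<exists>x\<in>fil M i. \<gamma> x = y" if i: "i \<ge> 1" and y: "y \<in> fil M i" for y i
  proof -
    have yc: "y \<in> carrier M" using fil_carrier[OF i y] .
    \<comment> \<open>The approximations to a preimage of \<open>y\<close>, starting from zero.\<close>
    define X where "X = rec_nat \<zero> (\<lambda>_ x. x \<oplus> (y \<ominus> \<gamma> x))"
    have X: "X 0 = \<zero>" "X (Suc n) = X n \<oplus> (y \<ominus> \<gamma> (X n))" for n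
      by (simp_all add: X_def)
    have Xf: "X n \<in> fil M i" for n
      by (induction n) (auto simp: X fil_zero[OF i] intro!: fil_add[OF i] fil_minus[OF i] y Hom_filt_fil[OF \<gamma> i])
    have Xc: "X n \<in> carrier M" for n using fil_carrier[OF i Xf] .
    have r: "y \<ominus> \<gamma> (X n) \<in> carrier M" for n using yc closed[OF Xc] by simp
    have err: "cong_at n y (\<gamma> (X n))" for n
    proof (induction n)
      case 0
      show ?case using yc closed[OF Xc] by (rule cong_at_0)
    next
      case (Suc n)
      let ?r = "y \<ominus> \<gamma> (X n)"
      have "cong_at n ?r \<zero>" using Suc minus_cong_zero_iff yc closed[OF Xc] by blast
      then have *: "cong_at (Suc n) (\<gamma> ?r) ?r" using step r by blast
      have "\<gamma> (X (Suc n)) = \<gamma> (X n) \<oplus> \<gamma> ?r"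
        unfolding X(2) by (rule linear_maps_add[OF lin Xc r])
      moreover have "cong_at (Suc n) (\<gamma> (X n) \<oplus> \<gamma> ?r) (\<gamma> (X n) \<oplus> ?r)"
        by (rule cong_at_add) (use * closed Xc r in auto)
      ultimately show ?case
        using add_minus_cancel[OF yc closed[OF Xc]] cong_at_sym by metis
    qed
    have "cong_at n (X (Suc n)) (X n)" for n
    proof -
      have "cong_at n (y \<ominus> \<gamma> (X n)) \<zero>" using err minus_cong_zero_iff yc closed[OF Xc] by blast
      then have "cong_at n (X n \<oplus> (y \<ominus> \<gamma> (X n))) (X n \<oplus> \<zero>)"
        by (intro cong_at_add) (use Xc r in auto)
      then show ?thesis using Xc by (simp add: X)
    qed
    then obtain x where x: "x \<in> carrier M" "\<And>n. cong_at n x (X n)"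
      using cauchy_limit_ex[of X] Xc by blast
    have "x \<in> fil M i" using fil_closed[OF i x(1)] x(2) Xf by blast
    moreover have "\<gamma> x = y"
    proof (rule cong_at_all_imp_eq[OF closed[OF x(1)] yc])
      fix n
      have "cong_at n (\<gamma> x) (\<gamma> (X n))" by (rule linear_maps_cong_at[OF lin x(1) Xc x(2)])
      then show "cong_at n (\<gamma> x) y" using err cong_at_sym cong_at_trans by blast
    qed
    ultimately show ?thesis by blast
  qed
  define \<delta> where "\<delta> = (\<lambda>y\<in>carrier M. inv_into (carrier M) \<gamma> y)"
  have im: "y \<in> \<gamma> ` carrier M" if "y \<in> carrier M" for y
    using surj[of 1 y] that fil_1 by auto
  have \<delta>: "\<delta> y \<in> carrier M" "\<gamma> (\<delta> y) = y" if "y \<in> carrier M" for y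
    using that im inv_into_into[of y \<gamma> "carrier M"] f_inv_into_f[of y \<gamma> "carrier M"]
    by (auto simp: \<delta>_def)
  have \<delta>\<gamma>: "\<delta> (\<gamma> x) = x" if "x \<in> carrier M" for x
    using inj[OF \<delta>(1)[OF closed[OF that]] that] \<delta>(2)[OF closed[OF that]] by simp
  have "\<delta> \<in> linear_maps (Zp p) M M"
    unfolding linear_maps_def
  proof (intro CollectI conjI ballI)
    show "\<delta> \<in> carrier M \<rightarrow>\<^sub>E carrier M" using \<delta>(1) by (auto simp: \<delta>_def)
    fix x y assume xy: "x \<in> carrier M" "y \<in> carrier M"
    show "\<delta> (x \<oplus> y) = \<delta> x \<oplus> \<delta> y"
      by (rule inj) (use xy \<delta> linear_maps_add[OF lin] in auto)
  next
    fix a x assume ax: "a \<in> carrier (Zp p)" "x \<in> carrier M"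
    show "\<delta> (a \<odot> x) = a \<odot> \<delta> x"
      by (rule inj) (use ax \<delta> linear_maps_smult[OF lin] in auto)
  qed
  moreover have "\<delta> y \<in> fil M i" if "i \<ge> 1" "y \<in> fil M i" for i y
    using surj[OF that] \<delta>\<gamma> fil_carrier[OF that(1)] by metis
  ultimately have "\<delta> \<in> Hom_filt (Zp p) M M" by (auto simp: Hom_filt_def)
  moreover have "compose (carrier M) \<gamma> \<delta> = (\<lambda>x\<in>carrier M. x)" "compose (carrier M) \<delta> \<gamma> = (\<lambda>x\<in>carrier M. x)"
    using \<delta> \<delta>\<gamma> by (auto simp: compose_def intro!: restrict_ext)
  ultimately show ?thesis using \<gamma> by (auto simp: Units_def End_filt_def)
qed

text \<open>Strictness of \<open>\<psi>\<close> provides preimages of the \<open>\<phi> (basis j)\<close> without loss of weight, and freeness turns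
these preimages into a morphism.\<close>

lemma lift_along_strict:
  assumes \<psi>: "\<psi> \<in> Hom_filt (Zp p) M N" and strict: "\<And>i. i \<ge> 1 \<Longrightarrow> fil N i \<subseteq> \<psi> ` fil M i"
    and \<phi>: "\<phi> \<in> Hom_filt (Zp p) M N" and zero: "\<psi> \<zero> = \<phi> \<zero>"
  shows "\<exists>\<alpha>\<in>Hom_filt (Zp p) M M. compose (carrier M) \<psi> \<alpha> = \<phi>"
proof -
  have "\<exists>m\<in>fil M (w j). \<psi> m = \<phi> (basis j)" if "j \<in> J" for j
    using strict[OF w_pos[OF that]] Hom_filt_fil[OF \<phi> w_pos[OF that] basis(1)[OF that]] by fastforce
  then obtain m where m: "\<And>j. j \<in> J \<Longrightarrow> m j \<in> fil M (w j)" "\<And>j. j \<in> J \<Longrightarrow> \<psi> (m j) = \<phi> (basis j)"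
    by metis
  obtain \<alpha> where \<alpha>: "\<alpha> \<in> Hom_filt (Zp p) M M" "\<And>j. j \<in> J \<Longrightarrow> \<alpha> (basis j) = m j"
    using Hom_filt_ex[of m] m(1) by blast
  have "compose (carrier M) \<psi> \<alpha> \<in> Hom_filt (Zp p) M N"
    using compose_Hom_filt[OF \<alpha>(1) \<psi> fil_subset module_axioms] .
  then have "compose (carrier M) \<psi> \<alpha> = \<phi>"
  proof (intro linear_maps_eqI[of _ N] Hom_filt_linear \<phi>)
    have "\<alpha> \<zero> = \<zero>"
      using linear_maps_smult[OF Hom_filt_linear[OF \<alpha>(1)], of "\<zero>\<^bsub>Zp p\<^esub>" "\<zero>"]
        linear_maps_closed[OF Hom_filt_linear[OF \<alpha>(1)], of "\<zero>"]
      by (simp add: smult_l_null)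
    then show "compose (carrier M) \<psi> \<alpha> \<zero> = \<phi> \<zero>" using zero by (simp add: compose_def)
    show "compose (carrier M) \<psi> \<alpha> (basis j) = \<phi> (basis j)" if "j \<in> J" for j
      using \<alpha>(2)[OF that] m(2)[OF that] basis(2)[OF that] by (simp add: compose_def)
  qed
  then show ?thesis using \<alpha>(1) by blast
qed

text \<open>Lift \<open>\<phi>\<close> and \<open>\<psi>\<close> through each other. The two composites of the lifts differ from the identity by
elements of a kernel, hence by multiples of \<open>p\<close>, so both are units.\<close>

lemma Unit_ex_if_strict:
  assumes strict: "\<And>\<phi> i. \<phi> \<in> Epi_filt (Zp p) M N \<Longrightarrow> i \<ge> 1 \<Longrightarrow> fil N i \<subseteq> \<phi> ` fil M i"
    and ker: "\<And>\<phi> x. \<phi> \<in> Epi_filt (Zp p) M N \<Longrightarrow> x \<in> carrier M \<Longrightarrow> \<phi> x = \<phi> \<zero> \<Longrightarrow> cong_at 1 x \<zero>"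
    and zero: "\<And>\<phi> \<psi>. \<phi> \<in> Epi_filt (Zp p) M N \<Longrightarrow> \<psi> \<in> Epi_filt (Zp p) M N \<Longrightarrow> \<phi> \<zero> = \<psi> \<zero>"
    and \<phi>: "\<phi> \<in> Epi_filt (Zp p) M N" and \<psi>: "\<psi> \<in> Epi_filt (Zp p) M N"
  shows "\<exists>\<alpha>\<in>Units (End_filt (Zp p) M). compose (carrier M) \<psi> \<alpha> = \<phi>"
proof -
  interpret E: Group.monoid "End_filt (Zp p) M"
    by (rule monoid_End_filt) (rule filtered_module_axioms)
  have Hom: "\<phi> \<in> Hom_filt (Zp p) M N" "\<psi> \<in> Hom_filt (Zp p) M N"
    using \<phi> \<psi> by (auto simp: Epi_filt_def)
  obtain \<alpha> where \<alpha>: "\<alpha> \<in> Hom_filt (Zp p) M M" "compose (carrier M) \<psi> \<alpha> = \<phi>"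
    using lift_along_strict[OF Hom(2) strict[OF \<psi>] Hom(1) zero[OF \<psi> \<phi>]] by blast
  obtain \<beta> where \<beta>: "\<beta> \<in> Hom_filt (Zp p) M M" "compose (carrier M) \<phi> \<beta> = \<psi>"
    using lift_along_strict[OF Hom(1) strict[OF \<phi>] Hom(2) zero[OF \<phi> \<psi>]] by blast
  \<comment> \<open>Stated for arbitrary names because both composites are needed.\<close>
  have unit: "compose (carrier M) \<alpha> \<beta> \<in> Units (End_filt (Zp p) M)"
    if "\<alpha> \<in> Hom_filt (Zp p) M M" "\<beta> \<in> Hom_filt (Zp p) M M" "\<psi> \<in> Epi_filt (Zp p) M N"
      "compose (carrier M) \<psi> \<alpha> = \<phi>" "compose (carrier M) \<phi> \<beta> = \<psi>" for \<alpha> \<beta> \<phi> \<psi>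
  proof -
    let ?\<gamma> = "compose (carrier M) \<alpha> \<beta>"
    have \<gamma>: "?\<gamma> \<in> Hom_filt (Zp p) M M"
      using compose_Hom_filt[OF that(2,1) fil_subset module_axioms] .
    have lin\<psi>: "\<psi> \<in> linear_maps (Zp p) M N"
      using that(3) by (auto simp: Epi_filt_def Hom_filt_def)
    have "cong_at 1 (?\<gamma> x) x" if x: "x \<in> carrier M" for x
    proof -
      have \<beta>x: "\<beta> x \<in> carrier M"
        using linear_maps_closed[OF Hom_filt_linear[OF \<open>\<beta> \<in> _\<close>] x] .
      have "\<psi> (\<alpha> (\<beta> x)) = \<phi> (\<beta> x)"
        using fun_cong[OF \<open>compose (carrier M) \<psi> \<alpha> = \<phi>\<close>, of "\<beta> x"] \<beta>x by (simp add: compose_def)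
      also have "\<dots> = \<psi> x"
        using fun_cong[OF \<open>compose (carrier M) \<phi> \<beta> = \<psi>\<close>, of x] x by (simp add: compose_def)
      finally have eq: "\<psi> (?\<gamma> x) = \<psi> x" using x by (simp add: compose_def)
      have \<gamma>x: "?\<gamma> x \<in> carrier M" using linear_maps_closed[OF Hom_filt_linear[OF \<gamma>] x] .
      have "\<psi> (?\<gamma> x \<ominus> x) = \<psi> x \<oplus>\<^bsub>N\<^esub> \<psi> (\<ominus> x)"
        unfolding minus_eq using linear_maps_add[OF lin\<psi> \<gamma>x, of "\<ominus> x"] x eq by simp
      also have "\<dots> = \<psi> (x \<oplus> \<ominus> x)"
        using linear_maps_add[OF lin\<psi> x, of "\<ominus> x"] x by simp
      also have "\<dots> = \<psi> \<zero>" using x by (simp add: M.r_neg)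
      finally have "cong_at 1 (?\<gamma> x \<ominus> x) \<zero>"
        using ker[OF \<open>\<psi> \<in> Epi_filt (Zp p) M N\<close>, of "?\<gamma> x \<ominus> x"] \<gamma>x x by simp
      then show ?thesis using minus_cong_zero_iff[OF \<gamma>x x] by simp
    qed
    then show ?thesis using Unit_if_cong_id[OF \<gamma>] by blast
  qed
  have "\<alpha> \<in> Units (End_filt (Zp p) M)"
    using E.Units_if_products_Units[of \<alpha> \<beta>] unit[OF \<alpha>(1) \<beta>(1) \<psi> \<alpha>(2) \<beta>(2)] unit[OF \<beta>(1) \<alpha>(1) \<phi> \<beta>(2) \<alpha>(2)] \<alpha>(1) \<beta>(1)
    by (simp add: End_filt_def)
  then show ?thesis using \<alpha>(2) by blast
qed

end

section \<open>Indices of multiplicative groups in a field\<close>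

definition mult_subgroup :: "'a::field set \<Rightarrow> bool" where
  "mult_subgroup A \<longleftrightarrow> 1 \<in> A \<and> 0 \<notin> A \<and> (\<forall>x\<in>A. \<forall>y\<in>A. x / y \<in> A)"

text \<open>The classes modulo \<open>B\<close> of the elements of \<open>A\<close>. When \<open>B\<close> sticks out of \<open>A\<close>, this is
the image of \<open>A\<close> in the quotient of a larger group by \<open>B\<close>.\<close>

definition cosets :: "'a::field set \<Rightarrow> 'a set \<Rightarrow> 'a set set" where
  "cosets A B = (\<lambda>a. (*) a ` B) ` A"

lemma mult_subgroup_div: "mult_subgroup A \<Longrightarrow> x \<in> A \<Longrightarrow> y \<in> A \<Longrightarrow> x / y \<in> A"
  by (simp add: mult_subgroup_def)

lemma mult_subgroup_inverse: "mult_subgroup A \<Longrightarrow> x \<in> A \<Longrightarrow> inverse x \<in> A"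
  using mult_subgroup_div[of A 1 x] by (simp add: mult_subgroup_def inverse_eq_divide)

lemma mult_subgroup_mult: "mult_subgroup A \<Longrightarrow> x \<in> A \<Longrightarrow> y \<in> A \<Longrightarrow> x * y \<in> A"
  using mult_subgroup_div[of A x "inverse y"] mult_subgroup_inverse[of A y] by (simp add: field_simps)

lemma mult_subgroup_nonzero: "mult_subgroup A \<Longrightarrow> x \<in> A \<Longrightarrow> x \<noteq> 0"
  by (auto simp: mult_subgroup_def)

lemma mult_subgroup_one: "mult_subgroup A \<Longrightarrow> 1 \<in> A"
  by (simp add: mult_subgroup_def)

lemma mult_subgroup_Int: "mult_subgroup A \<Longrightarrow> mult_subgroup B \<Longrightarrow> mult_subgroup (A \<inter> B)"
  by (auto simp: mult_subgroup_def)

lemma mult_subgroup_power_image: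
  assumes "mult_subgroup A"
  shows "mult_subgroup ((\<lambda>v. v ^ n) ` A)"
  unfolding mult_subgroup_def
proof (intro conjI ballI)
  show "1 \<in> (\<lambda>v. v ^ n) ` A" using mult_subgroup_one[OF assms] by (rule rev_image_eqI) simp
  show "0 \<notin> (\<lambda>v. v ^ n) ` A" using mult_subgroup_nonzero[OF assms] by auto
  fix x y assume "x \<in> (\<lambda>v. v ^ n) ` A" "y \<in> (\<lambda>v. v ^ n) ` A"
  then obtain u v where "u \<in> A" "v \<in> A" "x = u ^ n" "y = v ^ n" by auto
  then show "x / y \<in> (\<lambda>v. v ^ n) ` A"
    using mult_subgroup_div[OF assms] by (intro image_eqI[of _ _ "u / v"]) (simp_all add: power_divide)
qed

lemma mult_subgroup_power_vimage:
  "mult_subgroup A \<Longrightarrow> mult_subgroup B \<Longrightarrow> mult_subgroup {v \<in> A. v ^ n \<in> B}"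
  unfolding mult_subgroup_def by (auto simp: power_divide)

lemma coset_eq_iff:
  assumes "mult_subgroup B" "a \<noteq> 0" "a' \<noteq> 0"
  shows "(*) a ` B = (*) a' ` B \<longleftrightarrow> a / a' \<in> B"
proof
  assume "(*) a ` B = (*) a' ` B"
  then have "a * 1 \<in> (*) a' ` B" using mult_subgroup_one[OF assms(1)] by blast
  then show "a / a' \<in> B" using assms(3) by auto
next
  assume b: "a / a' \<in> B"
  show "(*) a ` B = (*) a' ` B"
  proof (intro equalityI subsetI)
    fix x assume "x \<in> (*) a ` B"
    then obtain c where "c \<in> B" "x = a' * ((a / a') * c)" using assms(3) by auto
    then show "x \<in> (*) a' ` B" using b mult_subgroup_mult[OF assms(1)] by blast
  next
    fix x assume "x \<in> (*) a' ` B"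
    then obtain c where "c \<in> B" "x = a * (c / (a / a'))" using assms(2,3) by auto
    then show "x \<in> (*) a ` B" using b mult_subgroup_div[OF assms(1)] by blast
  qed
qed

lemma card_image_eq_if_same_fibres:
  assumes "\<And>x y. x \<in> X \<Longrightarrow> y \<in> X \<Longrightarrow> f x = f y \<longleftrightarrow> g x = g y"
  shows "card (f ` X) = card (g ` X)"
proof -
  define h where "h v = g (inv_into X f v)" for v
  have h: "h (f x) = g x" if "x \<in> X" for x
    using assms[of "inv_into X f (f x)" x] that inv_into_into[of "f x" f X] f_inv_into_f[of "f x" f X]
    by (simp add: h_def)
  have "inj_on h (f ` X)" using h assms by (auto simp: inj_on_def)
  moreover have "h ` f ` X = g ` X" using h by (auto simp: image_image)
  ultimately show ?thesis by (metis card_image)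
qed

lemma card_cosets_Int:
  assumes "mult_subgroup A" "mult_subgroup B"
  shows "card (cosets A B) = card (cosets A (A \<inter> B))"
  unfolding cosets_def
  by (rule card_image_eq_if_same_fibres)
     (use assms in \<open>simp add: coset_eq_iff mult_subgroup_Int mult_subgroup_nonzero mult_subgroup_div\<close>)

lemma card_cosets_power:
  assumes "mult_subgroup A" "mult_subgroup B"
  shows "card (cosets ((\<lambda>v. v ^ n) ` A) B) = card (cosets A {v \<in> A. v ^ n \<in> B})"
  unfolding cosets_def image_image
  by (rule card_image_eq_if_same_fibres)
     (use assms in \<open>simp add: coset_eq_iff mult_subgroup_power_vimage mult_subgroup_nonzero
        mult_subgroup_div power_divide\<close>)

text \<open>With a chosen representative \<open>s X\<close> of each coset \<open>X\<close> of \<open>B\<close>, every coset of \<open>C\<close> in \<open>A\<close> is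
\<open>s X\<close> times a coset of \<open>C\<close> in \<open>B\<close>, for exactly one pair.\<close>

lemma card_cosets_tower:
  assumes A: "mult_subgroup A" and B: "mult_subgroup B" and C: "mult_subgroup C"
    and "C \<subseteq> B" "B \<subseteq> A"
  shows "card (cosets A C) = card (cosets A B) * card (cosets B C)"
proof -
  define s where "s X = (SOME a. a \<in> A \<and> X = (*) a ` B)" for X
  have s: "s X \<in> A" "X = (*) (s X) ` B" if "X \<in> cosets A B" for X
  proof -
    have "\<exists>a. a \<in> A \<and> X = (*) a ` B" using that by (auto simp: cosets_def)
    then have "s X \<in> A \<and> X = (*) (s X) ` B" unfolding s_def by (rule someI_ex)
    then show "s X \<in> A" "X = (*) (s X) ` B" by auto
  qed
  define F where "F = (\<lambda>(X, Y). (*) (s X) ` Y)"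
  have F: "F (X, (*) b ` C) = (*) (s X * b) ` C" for X b
    by (simp add: F_def image_image mult.assoc)
  have nz: "a \<noteq> 0" if "a \<in> A" for a using mult_subgroup_nonzero[OF A that] .
  have "bij_betw F (cosets A B \<times> cosets B C) (cosets A C)"
    unfolding bij_betw_def
  proof
    show "inj_on F (cosets A B \<times> cosets B C)"
    proof (rule inj_onI, clarify)
      fix X Y X' Y'
      assume X: "X \<in> cosets A B" "X' \<in> cosets A B" and Y: "Y \<in> cosets B C" "Y' \<in> cosets B C"
        and eq: "F (X, Y) = F (X', Y')"
      obtain b b' where b: "b \<in> B" "b' \<in> B" "Y = (*) b ` C" "Y' = (*) b' ` C"
        using Y by (auto simp: cosets_def)
      have nz': "s X \<noteq> 0" "s X' \<noteq> 0" "b \<noteq> 0" "b' \<noteq> 0"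
        using nz s(1) X b(1,2) assms(5) by auto
      have c: "(s X * b) / (s X' * b') \<in> C"
        using eq nz' by (simp add: F b coset_eq_iff[OF C])
      then have "((s X * b) / (s X' * b')) * b' / b \<in> B"
        using assms(4) b mult_subgroup_mult[OF B] mult_subgroup_div[OF B] by blast
      then have "s X / s X' \<in> B" using nz' by (simp add: field_simps)
      then have "(*) (s X) ` B = (*) (s X') ` B" using nz' by (simp add: coset_eq_iff[OF B])
      then have XX: "X = X'" using s(2) X by metis
      then have "b / b' \<in> C" using c nz' by simp
      then have "Y = Y'" using nz' by (simp add: b coset_eq_iff[OF C])
      then show "X = X' \<and> Y = Y'" using XX by simp
    qed
    show "F ` (cosets A B \<times> cosets B C) = cosets A C"
    proof (intro equalityI subsetI)
      fix Z assume "Z \<in> F ` (cosets A B \<times> cosets B C)"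
      then obtain X Y where XY: "X \<in> cosets A B" "Y \<in> cosets B C" "Z = F (X, Y)" by auto
      then obtain b where b: "b \<in> B" "Y = (*) b ` C" by (auto simp: cosets_def)
      have "s X * b \<in> A" using mult_subgroup_mult[OF A s(1)[OF XY(1)]] b(1) assms(5) by blast
      then show "Z \<in> cosets A C" using XY(3) by (auto simp: b F cosets_def)
    next
      fix Z assume "Z \<in> cosets A C"
      then obtain a where a: "a \<in> A" "Z = (*) a ` C" by (auto simp: cosets_def)
      let ?X = "(*) a ` B"
      have X: "?X \<in> cosets A B" using a by (auto simp: cosets_def)
      have nz': "a \<noteq> 0" "s ?X \<noteq> 0" using nz a s(1)[OF X] by auto
      obtain b where b: "b \<in> B" "a = s ?X * b"
        using s(2)[OF X] coset_eq_iff[OF B nz'] nz' by (intro that[of "a / s ?X"]) simp_all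
      have "Z = F (?X, (*) b ` C)" unfolding F b(2)[symmetric] by (rule a(2))
      moreover have "(*) b ` C \<in> cosets B C" using b(1) unfolding cosets_def by blast
      ultimately show "Z \<in> F ` (cosets A B \<times> cosets B C)" using X by blast
    qed
  qed
  then have "card (cosets A B \<times> cosets B C) = card (cosets A C)" by (rule bij_betw_same_card)
  then show ?thesis by (simp add: card_cartesian_product)
qed

section \<open>Strictness of epimorphisms onto principal units\<close>

context free_filtered_module
begin

text \<open>Coordinates of representatives of the image of \<open>M\<^sub>i\<close> in \<open>M/pM\<close>: the generators of weight
less than \<open>i\<close> contribute only their multiples by \<open>p\<close> to \<open>M\<^sub>i\<close>.\<close>

definition digit_vectors :: "nat \<Rightarrow> ('j \<Rightarrow> nat) set" where
  "digit_vectors i = (\<Pi>\<^sub>E j\<in>J. if i \<le> w j then {..<p} else {0})"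

definition digit_rep :: "('j \<Rightarrow> nat) \<Rightarrow> 'm" where
  "digit_rep d = (SOME x. x \<in> carrier M \<and> (\<forall>j\<in>J. coord x j = Zp_of_nat p (d j)))"

lemma digit_rep:
  "digit_rep d \<in> carrier M" "j \<in> J \<Longrightarrow> coord (digit_rep d) j = Zp_of_nat p (d j)"
proof -
  have "\<exists>x. x \<in> carrier M \<and> (\<forall>j\<in>J. coord x j = Zp_of_nat p (d j))"
    using coord_ex[of "\<lambda>j. Zp_of_nat p (d j)"] Zp_of_nat_closed[OF p_pos] by blast
  then have *: "digit_rep d \<in> carrier M \<and> (\<forall>j\<in>J. coord (digit_rep d) j = Zp_of_nat p (d j))"
    unfolding digit_rep_def by (rule someI_ex)
  then show "digit_rep d \<in> carrier M" by (rule conjunct1)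
  show "j \<in> J \<Longrightarrow> coord (digit_rep d) j = Zp_of_nat p (d j)" by (rule bspec[OF conjunct2[OF *]])
qed

lemma card_digit_vectors: "card (digit_vectors i) = p ^ card {j \<in> J. i \<le> w j}"
proof -
  have "card (digit_vectors i) = (\<Prod>j\<in>J. if i \<le> w j then p else 1)"
    unfolding digit_vectors_def card_PiE[OF finite_J] by (rule prod.cong) auto
  also have "\<dots> = (\<Prod>j\<in>{j \<in> J. i \<le> w j}. p)"
    by (rule prod.inter_filter[OF finite_J, symmetric])
  finally show ?thesis by simp
qed

lemma finite_digit_vectors: "finite (digit_vectors i)"
  unfolding digit_vectors_def by (intro finite_PiE finite_J) auto

lemma digit_vectors_subset: "i \<ge> 1 \<Longrightarrow> digit_vectors i \<subseteq> digit_vectors 1"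
  unfolding digit_vectors_def using w_pos p_pos by (intro PiE_mono) auto

lemma digit_rep_fil:
  assumes "d \<in> digit_vectors i" "i \<ge> 1"
  shows "digit_rep d \<in> fil M i"
  unfolding fil_iff[OF assms(2) digit_rep(1)]
proof
  fix j assume j: "j \<in> J"
  show "coord (digit_rep d) j (steps \<rho> (w j) i) = 0"
  proof (cases "i \<le> w j")
    case True
    then have "steps \<rho> (w j) i \<le> 0" by (subst steps_le_iff[OF shift w_pos[OF j]]) simp
    then show ?thesis by (simp add: digit_rep(2)[OF j] Zp_of_nat_def)
  next
    case False
    then have "d j = 0" using assms(1) j by (auto simp: digit_vectors_def PiE_iff split: if_splits)
    then show ?thesis by (simp add: digit_rep(2)[OF j] Zp_of_nat_def)
  qed
qed

lemma digit_rep_cong: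
  assumes "x \<in> carrier M"
  shows "\<exists>d\<in>digit_vectors 1. cong_at 1 (digit_rep d) x"
proof
  let ?d = "\<lambda>j\<in>J. nat (coord x j 1)"
  have range: "0 \<le> coord x j 1" "coord x j 1 < int p" if "j \<in> J" for j
    using coord_closed[OF assms that] unfolding Zp_carrier by (metis power_one_right)+
  show "?d \<in> digit_vectors 1"
    using w_pos range by (auto simp: digit_vectors_def nat_less_iff)
  show "cong_at 1 (digit_rep ?d) x"
    using range by (auto simp: cong_at_def digit_rep(2) Zp_of_nat_def)
qed

text \<open>The assumptions on the groups \<open>U absv i\<close> are all that the comparison with \<open>M\<close> uses of the
arithmetic of the field: \<open>index\<close> says that \<open>U\<^sub>i\<close> has as many classes modulo \<open>p\<close>-th powers as
there are digit vectors, and \<open>power_lift\<close> that \<open>p\<close>-th roots exist with the weight that \<open>\<rho>\<close> predicts.\<close>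

context
  fixes absv :: "'a::field \<Rightarrow> real" and \<phi> :: "'m \<Rightarrow> 'a"
  assumes U_subgroup: "\<And>i. i \<ge> 1 \<Longrightarrow> mult_subgroup (U absv i)"
    and U_1: "\<And>i. i \<ge> 1 \<Longrightarrow> U absv i \<subseteq> U absv 1"
    and index: "\<And>i. i \<ge> 1 \<Longrightarrow>
      card (cosets (U absv i) ((\<lambda>v. v ^ p) ` U absv 1)) = p ^ card {j \<in> J. i \<le> w j}"
    and power_lift: "\<And>v i. v \<in> U absv 1 \<Longrightarrow> i > 1 \<Longrightarrow> v ^ p \<in> U absv i \<Longrightarrow>
      \<exists>k v'. 1 \<le> k \<and> k < i \<and> i \<le> \<rho> k \<and> v' \<in> U absv k \<and> v' ^ p = v ^ p"
    and Epi: "\<phi> \<in> Epi_filt (Zp p) M (U_filt absv)"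
begin

private lemma U_filt_simps:
  "carrier (U_filt absv) = U absv 1" "x \<oplus>\<^bsub>U_filt absv\<^esub> y = x * y" "fil (U_filt absv) = U absv"
  by (simp_all add: U_filt_def)

private lemma Hom: "\<phi> \<in> Hom_filt (Zp p) M (U_filt absv)"
  using Epi by (simp add: Epi_filt_def)

private lemma closed: "x \<in> carrier M \<Longrightarrow> \<phi> x \<in> U absv 1"
  using linear_maps_closed[OF Hom_filt_linear[OF Hom]] by (simp add: U_filt_simps)

private lemma nonzero: "x \<in> carrier M \<Longrightarrow> \<phi> x \<noteq> 0"
  using closed mult_subgroup_nonzero[OF U_subgroup[of 1]] by auto

private lemma map_add: "x \<in> carrier M \<Longrightarrow> y \<in> carrier M \<Longrightarrow> \<phi> (x \<oplus> y) = \<phi> x * \<phi> y"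
  using linear_maps_add[OF Hom_filt_linear[OF Hom]] by (simp add: U_filt_simps)

lemma map_zero: "\<phi> \<zero> = 1"
  using map_add[of "\<zero>" "\<zero>"] nonzero[of "\<zero>"] by simp

private lemma map_multiple:
  assumes x: "x \<in> carrier M"
  shows "\<phi> (Zp_of_nat p c \<odot> x) = \<phi> x ^ c"
proof (induction c)
  case 0
  have "Zp_of_nat p 0 = \<zero>\<^bsub>Zp p\<^esub>" by (simp add: Zp_of_nat_def Zp_simps)
  then show ?case using x by (simp add: map_zero smult_l_null)
next
  case (Suc c)
  have "Zp_of_nat p (Suc c) = \<one>\<^bsub>Zp p\<^esub> \<oplus>\<^bsub>Zp p\<^esub> Zp_of_nat p c"
    by (simp add: Zp_of_nat_def Zp_simps mod_simps)
  then show ?case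
    using x Suc by (simp add: smult_l_distr Zp_of_nat_closed[OF p_pos] map_add)
qed

private abbreviation "powers \<equiv> (\<lambda>v. v ^ p) ` U absv 1"

private abbreviation "class x \<equiv> (*) (\<phi> x) ` powers"

private lemma powers: "mult_subgroup powers"
  by (rule mult_subgroup_power_image) (rule U_subgroup, simp)

private lemma class_cong:
  assumes "x \<in> carrier M" "y \<in> carrier M" "cong_at 1 x y"
  shows "class x = class y"
proof -
  obtain z where z: "z \<in> carrier M" "x = y \<oplus> Zp_of_nat p (p ^ 1) \<odot> z"
    using assms cong_at_iff_ex by blast
  have "\<phi> x = \<phi> y * \<phi> z ^ p"
    using z assms(2) by (simp add: map_add map_multiple Zp_of_nat_closed[OF p_pos])
  then have "\<phi> x / \<phi> y \<in> powers" using nonzero[OF assms(2)] closed[OF z(1)] by simp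
  then show ?thesis using coset_eq_iff[OF powers nonzero nonzero] assms by blast
qed

text \<open>The digit vectors represent all of \<open>M/pM\<close> and \<open>\<phi>\<close> is onto, so the classes of their images exhaust
\<open>U\<^sub>1/U\<^sub>1\<^sup>p\<close>. Both sets have the same finite size.\<close>

private lemma inj_class: "inj_on (\<lambda>d. class (digit_rep d)) (digit_vectors 1)"
proof (rule eq_card_imp_inj_on[OF finite_digit_vectors])
  have "(\<lambda>d. class (digit_rep d)) ` digit_vectors 1 = cosets (U absv 1) powers"
  proof (intro equalityI subsetI)
    fix Z assume "Z \<in> cosets (U absv 1) powers"
    then obtain u where u: "u \<in> U absv 1" "Z = (*) u ` powers" by (auto simp: cosets_def)
    obtain x where x: "x \<in> carrier M" "u = \<phi> x"
      using Epi u(1) by (auto simp: Epi_filt_def U_filt_simps)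
    obtain d where d: "d \<in> digit_vectors 1" "cong_at 1 (digit_rep d) x"
      using digit_rep_cong[OF x(1)] by blast
    show "Z \<in> (\<lambda>d. class (digit_rep d)) ` digit_vectors 1"
      using class_cong[OF digit_rep(1) x(1) d(2)] d(1) by (intro image_eqI[of _ _ d]) (simp_all only: u(2) x(2))
  next
    fix Z assume "Z \<in> (\<lambda>d. class (digit_rep d)) ` digit_vectors 1"
    then obtain d where "Z = class (digit_rep d)" by (rule imageE)
    then show "Z \<in> cosets (U absv 1) powers"
      unfolding cosets_def using closed[OF digit_rep(1)] by (rule image_eqI)
  qed
  then show "card ((\<lambda>d. class (digit_rep d)) ` digit_vectors 1) = card (digit_vectors 1)"
    using index[of 1] card_digit_vectors[of 1] by simp
qed

text \<open>By \<open>inj_class\<close> an element of the kernel has the same digit vector as zero.\<close>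

lemma kernel_divisible:
  assumes x: "x \<in> carrier M" and ker: "\<phi> x = \<phi> \<zero>"
  shows "cong_at 1 x \<zero>"
proof -
  obtain d where d: "d \<in> digit_vectors 1" "cong_at 1 (digit_rep d) x" using digit_rep_cong[OF x] by blast
  obtain d' where d': "d' \<in> digit_vectors 1" "cong_at 1 (digit_rep d') \<zero>"
    using digit_rep_cong[of "\<zero>"] by auto
  have "class (digit_rep d) = class (digit_rep d')"
    using class_cong[OF digit_rep(1) x d(2)] class_cong[OF digit_rep(1) _ d'(2)] ker by simp
  then have "d = d'" by (rule inj_onD[OF inj_class _ d(1) d'(1)])
  then show ?thesis using d(2) d'(2) cong_at_sym cong_at_trans by blast
qed

text \<open>The digit vectors of weight at least \<open>i\<close> map injectively into the classes of \<open>U\<^sub>i\<close>, and there are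
equally many of both.\<close>

lemma fil_subset_image_times_powers:
  assumes i: "i \<ge> 1" and u: "u \<in> U absv i"
  shows "\<exists>m\<in>fil M i. \<exists>v\<in>U absv 1. u = \<phi> m * v ^ p"
proof -
  let ?cl = "\<lambda>d. class (digit_rep d)"
  have sub: "?cl ` digit_vectors i \<subseteq> cosets (U absv i) powers"
    using Hom_filt_fil[OF Hom i digit_rep_fil[OF _ i]] by (auto simp: cosets_def U_filt_simps)
  have card: "card (?cl ` digit_vectors i) = card (cosets (U absv i) powers)"
    unfolding card_image[OF inj_on_subset[OF inj_class digit_vectors_subset[OF i]]]
      index[OF i] card_digit_vectors ..
  have "card (cosets (U absv i) powers) > 0" using index[OF i] p_pos by simp
  then have "finite (cosets (U absv i) powers)" by (rule card_ge_0_finite)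
  then have "?cl ` digit_vectors i = cosets (U absv i) powers"
    using card_subset_eq sub card by blast
  then obtain d where d: "d \<in> digit_vectors i" "class (digit_rep d) = (*) u ` powers"
    using u unfolding cosets_def by (metis (no_types, lifting) imageE image_eqI)
  have nz: "u \<noteq> 0" using mult_subgroup_nonzero[OF U_subgroup[OF i] u] .
  have "u / \<phi> (digit_rep d) \<in> powers"
    using coset_eq_iff[OF powers nz nonzero[OF digit_rep(1)], of d] d(2) by simp
  then obtain v where v: "v \<in> U absv 1" "u / \<phi> (digit_rep d) = v ^ p" by auto
  then have "u = \<phi> (digit_rep d) * v ^ p" using nonzero[OF digit_rep(1)] by (simp add: field_simps)
  then show ?thesis using digit_rep_fil[OF d(1) i] v(1) by blast
qed

text \<open>Write \<open>u = \<phi> r v\<^sup>p\<close> with \<open>r\<close> in \<open>M\<^sub>i\<close>. Then \<open>v\<^sup>p\<close> lies in \<open>U\<^sub>i\<close>, so \<open>v\<close> may be taken in some \<open>U\<^sub>k\<close> with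
\<open>k < i \<le> \<rho> k\<close>, where the induction hypothesis gives \<open>v = \<phi> m\<close> with \<open>m\<close> in \<open>M\<^sub>k\<close>. Now \<open>r + p m\<close> is
a preimage of \<open>u\<close> in \<open>M\<^sub>i\<close>.\<close>

lemma Epi_strict: "i \<ge> 1 \<Longrightarrow> U absv i \<subseteq> \<phi> ` fil M i"
proof (induction i rule: less_induct)
  case (less i)
  show ?case
  proof (cases "i = 1")
    case True
    then show ?thesis using Epi fil_1 by (auto simp: Epi_filt_def U_filt_simps)
  next
    case False
    then have i: "i > 1" using less by simp
    show ?thesis
    proof
      fix u assume u: "u \<in> U absv i"
      then obtain r v where r: "r \<in> fil M i" and v: "v \<in> U absv 1" and eq: "u = \<phi> r * v ^ p"
        using fil_subset_image_times_powers[OF less.prems] by blast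
      have rc: "r \<in> carrier M" using fil_carrier[OF less.prems r] .
      have "\<phi> r \<in> U absv i" using Hom_filt_fil[OF Hom less.prems r] by (simp add: U_filt_simps)
      then have "u / \<phi> r \<in> U absv i" by (rule mult_subgroup_div[OF U_subgroup[OF less.prems] u])
      then have "v ^ p \<in> U absv i" using eq nonzero[OF rc] by simp
      then obtain k v' where k: "1 \<le> k" "k < i" "i \<le> \<rho> k" "v' \<in> U absv k" "v' ^ p = v ^ p"
        using power_lift[OF v i] by blast
      obtain m where m: "m \<in> fil M k" "v' = \<phi> m" using less.IH[OF k(2,1)] k(4) by blast
      have pm: "Zp_of_nat p p \<odot> m \<in> fil M i" using fil_prime_multiple[OF m(1) k(1) less.prems k(3)] .
      have mc: "m \<in> carrier M" using fil_carrier[OF k(1) m(1)] .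
      have "u = \<phi> (r \<oplus> Zp_of_nat p p \<odot> m)"
        using eq k(5) m(2) mc rc by (simp add: map_add map_multiple Zp_of_nat_closed[OF p_pos])
      then show "u \<in> \<phi> ` fil M i" using fil_add[OF less.prems r pm] by blast
    qed
  qed
qed

end

lemma transitive_onto_U_filt:
  fixes absv :: "'a::field \<Rightarrow> real"
  assumes "\<And>i. i \<ge> 1 \<Longrightarrow> mult_subgroup (U absv i)"
    and "\<And>i. i \<ge> 1 \<Longrightarrow> U absv i \<subseteq> U absv 1"
    and "\<And>i. i \<ge> 1 \<Longrightarrow>
      card (cosets (U absv i) ((\<lambda>v. v ^ p) ` U absv 1)) = p ^ card {j \<in> J. i \<le> w j}"
    and "\<And>v i. v \<in> U absv 1 \<Longrightarrow> i > 1 \<Longrightarrow> v ^ p \<in> U absv i \<Longrightarrow>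
      \<exists>k v'. 1 \<le> k \<and> k < i \<and> i \<le> \<rho> k \<and> v' \<in> U absv k \<and> v' ^ p = v ^ p"
  shows "transitive_action (Aut_filt (Zp p) M) (Epi_filt (Zp p) M (U_filt absv))
           (precomp_action (Zp p) M (U_filt absv))"
proof (rule transitive_precomp_action[OF filtered_module_axioms])
  fix \<phi> \<psi> assume "\<phi> \<in> Epi_filt (Zp p) M (U_filt absv)" "\<psi> \<in> Epi_filt (Zp p) M (U_filt absv)"
  then show "\<exists>\<alpha>\<in>Units (End_filt (Zp p) M). compose (carrier M) \<psi> \<alpha> = \<phi>"
  proof (rule Unit_ex_if_strict[rotated 3])
    fix \<phi> :: "'m \<Rightarrow> 'a" and i :: nat
    assume "\<phi> \<in> Epi_filt (Zp p) M (U_filt absv)" "1 \<le> i"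
    then show "fil (U_filt absv) i \<subseteq> \<phi> ` fil M i"
      using Epi_strict[OF assms] by (simp add: U_filt_def)
  next
    fix \<phi> x assume "\<phi> \<in> Epi_filt (Zp p) M (U_filt absv)" "x \<in> carrier M" "\<phi> x = \<phi> \<zero>"
    then show "cong_at 1 x \<zero>" using kernel_divisible[OF assms] by blast
  next
    fix \<phi> \<psi> assume "\<phi> \<in> Epi_filt (Zp p) M (U_filt absv)" "\<psi> \<in> Epi_filt (Zp p) M (U_filt absv)"
    then show "\<phi> \<zero> = \<psi> \<zero>" using map_zero[OF assms] by metis
  qed
qed

end

section \<open>Absolute values and local compactness\<close>

context local_field
begin

lemma absv_zero [simp]: "absv 0 = 0" by (simp add: absv_eq_0_iff)

lemma absv_pos: "x \<noteq> 0 \<Longrightarrow> absv x > 0"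
  using absv_nonneg[of x] absv_eq_0_iff[of x] by linarith

lemma absv_one [simp]: "absv 1 = 1"
  using absv_mult[of 1 1] absv_eq_0_iff[of 1] by simp

lemma absv_power: "absv (x ^ n) = absv x ^ n"
  by (induction n) (auto simp: absv_mult)

lemma absv_minus [simp]: "absv (- x) = absv x"
proof -
  have "absv (- 1) * absv (- 1) = 1" using absv_mult[of "-1" "-1"] by simp
  then have "absv (- 1) = 1"
    using absv_nonneg[of "-1"] by (metis abs_of_nonneg abs_square_eq_1 power2_eq_square)
  then show ?thesis using absv_mult[of "-1" x] by simp
qed

lemma absv_minus_commute: "absv (x - y) = absv (y - x)"
  using absv_minus[of "x - y"] by simp

lemma absv_diff: "absv (x - y) \<le> max (absv x) (absv y)"
  using absv_ultrametric[of x "- y"] by simp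

lemma absv_diff_trans: "absv (x - z) \<le> max (absv (x - y)) (absv (y - z))"
  using absv_ultrametric[of "x - y" "y - z"] by simp

lemma absv_divide: "absv (x / y) = absv x / absv y"
proof (cases "y = 0")
  case False
  then have "absv (x / y) * absv y = absv x" by (simp flip: absv_mult)
  then show ?thesis using absv_pos[OF False] by (simp add: field_simps)
qed simp

lemma absv_eq_if_close:
  assumes "absv (x - y) < absv y"
  shows "absv x = absv y"
proof -
  have "absv x \<le> max (absv (x - y)) (absv y)" using absv_ultrametric[of "x - y" y] by simp
  moreover have "absv y \<le> max (absv (x - y)) (absv x)"
    using absv_ultrametric[of "y - x" x] absv_minus_commute[of x y] by simp
  ultimately show ?thesis using assms by linarith
qed

lemma absv_of_nat_le: "absv (of_nat n) \<le> 1"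
proof (induction n)
  case (Suc n)
  then show ?case using absv_ultrametric[of 1 "of_nat n"] by simp
qed simp

lemma absv_sum_le:
  assumes "\<And>i. i \<in> A \<Longrightarrow> absv (g i) \<le> c" "c \<ge> 0"
  shows "absv (sum g A) \<le> c"
  using assms(1)
proof (induction A rule: infinite_finite_induct)
  case (insert a A)
  then have "absv (g a + sum g A) \<le> max (absv (g a)) (absv (sum g A))" by (intro absv_ultrametric)
  moreover have "absv (g a) \<le> c" "absv (sum g A) \<le> c" using insert by auto
  ultimately show ?case using insert(1,2) by simp
qed (use assms(2) in auto)

sublocale Metric: Metric_space UNIV "\<lambda>x y. absv (x - y)"
proof
  fix x y z
  show "absv (x - z) \<le> absv (x - y) + absv (y - z)"
    using absv_diff_trans[of x z y] absv_nonneg[of "x - y"] absv_nonneg[of "y - z"] by linarith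
qed (auto simp: absv_nonneg absv_eq_0_iff absv_minus_commute)

text \<open>Otherwise balls of radius \<open>\<epsilon>\<close> are points, and the topology is discrete.\<close>

lemma ex_small:
  assumes "\<epsilon> > 0"
  shows "\<exists>c. c \<noteq> 0 \<and> absv c < \<epsilon>"
proof (rule ccontr)
  assume none: "\<not> ?thesis"
  have "Metric.mtopology = discrete_topology UNIV"
    unfolding topology_eq
  proof (intro allI)
    fix S
    have "Metric.mball x \<epsilon> \<subseteq> S" if "x \<in> S" for x
    proof
      fix y assume "y \<in> Metric.mball x \<epsilon>"
      then have "x - y = 0" using none by (metis Metric.in_mball)
      then show "y \<in> S" using that by simp
    qed
    then show "openin Metric.mtopology S \<longleftrightarrow> openin (discrete_topology UNIV) S"
      unfolding Metric.openin_mtopology using assms by auto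
  qed
  then show False using non_discrete by simp
qed

text \<open>Some neighbourhood of zero lies in a compact set, and multiplication by a small \<open>c\<close> moves the ring of
integers into it.\<close>

lemma compactin_int_ring: "compactin Metric.mtopology {x. absv x \<le> 1}"
proof -
  obtain V K where VK: "openin Metric.mtopology V" "compactin Metric.mtopology K" "0 \<in> V" "V \<subseteq> K"
    using locally_compact unfolding locally_compact_space_def
    by (metis Metric.topspace_mtopology UNIV_I)
  obtain \<epsilon> where \<epsilon>: "\<epsilon> > 0" "Metric.mball 0 \<epsilon> \<subseteq> V"
    using VK(1,3) unfolding Metric.openin_mtopology by blast
  obtain c where c: "c \<noteq> 0" "absv c < \<epsilon>" using ex_small[OF \<epsilon>(1)] by blast
  have cpos: "absv c > 0" using absv_pos[OF c(1)] .
  show ?thesis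
    unfolding Metric.compactin_sequentially
  proof (intro conjI allI impI)
    fix \<sigma> :: "nat \<Rightarrow> 'a" assume \<sigma>: "range \<sigma> \<subseteq> {x. absv x \<le> 1}"
    have "c * \<sigma> n \<in> K" for n
    proof -
      have "absv (c * \<sigma> n) \<le> absv c * 1"
        unfolding absv_mult using \<sigma> cpos by (intro mult_left_mono) auto
      then have "c * \<sigma> n \<in> Metric.mball 0 \<epsilon>" using c(2) by simp
      then show ?thesis using \<epsilon>(2) VK(4) by blast
    qed
    then obtain l r where lr: "strict_mono r"
      "limitin Metric.mtopology ((\<lambda>n. c * \<sigma> n) \<circ> r) l sequentially"
      using VK(2)[unfolded Metric.compactin_sequentially] by (metis (no_types, lifting) image_subsetI)
    have lim: "limitin Metric.mtopology (\<sigma> \<circ> r) (l / c) sequentially"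
      unfolding Metric.limit_metric_sequentially
    proof (intro conjI allI impI)
      fix \<delta> :: real assume "\<delta> > 0"
      then have "\<delta> * absv c > 0" using cpos by simp
      then obtain N where N: "\<And>n. n \<ge> N \<Longrightarrow> absv (c * \<sigma> (r n) - l) < \<delta> * absv c"
        using lr(2) unfolding Metric.limit_metric_sequentially by (auto simp: comp_def)
      have "absv (\<sigma> (r n) - l / c) < \<delta>" if "n \<ge> N" for n
      proof -
        have "c * (\<sigma> (r n) - l / c) = c * \<sigma> (r n) - l" using c(1) by (simp add: algebra_simps)
        then have "absv c * absv (\<sigma> (r n) - l / c) < \<delta> * absv c"
          using N[OF that] by (simp flip: absv_mult)
        then show ?thesis using cpos by (simp add: mult.commute)
      qed
      then show "\<exists>N. \<forall>n\<ge>N. (\<sigma> \<circ> r) n \<in> UNIV \<and> absv ((\<sigma> \<circ> r) n - l / c) < \<delta>" by auto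
    qed simp
    obtain n where "absv (\<sigma> (r n) - l / c) < 1"
      using lim unfolding Metric.limit_metric_sequentially by (metis comp_apply order_refl zero_less_one)
    moreover have "absv (\<sigma> (r n)) \<le> 1" using \<sigma> by auto
    ultimately have "absv (l / c) \<le> 1"
      using absv_diff[of "\<sigma> (r n)" "\<sigma> (r n) - l / c"] by simp
    then show "\<exists>l r. l \<in> {x. absv x \<le> 1} \<and> strict_mono r \<and> limitin Metric.mtopology (\<sigma> \<circ> r) l sequentially"
      using lr(1) lim by blast
  qed simp
qed

lemma convergent_subsequence:
  fixes \<sigma> :: "nat \<Rightarrow> 'a"
  assumes "\<And>n. absv (\<sigma> n) \<le> 1"
  shows "\<exists>l (r :: nat \<Rightarrow> nat). strict_mono r \<and> absv l \<le> 1 \<and> (\<forall>\<epsilon>>0. \<exists>N. \<forall>n\<ge>N. absv (\<sigma> (r n) - l) < \<epsilon>)"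
proof -
  have "range \<sigma> \<subseteq> {x. absv x \<le> 1}" using assms by auto
  then obtain l r where "absv l \<le> 1" "strict_mono r" "limitin Metric.mtopology (\<sigma> \<circ> r) l sequentially"
    using compactin_int_ring[unfolded Metric.compactin_sequentially] by blast
  then show ?thesis unfolding Metric.limit_metric_sequentially
    unfolding comp_def by blast
qed

lemma int_ring_finite_cover:
  assumes "\<epsilon> > 0"
  shows "\<exists>K. finite K \<and> (\<forall>x. absv x \<le> 1 \<longrightarrow> (\<exists>k\<in>K. absv (x - k) < \<epsilon>))"
proof -
  have "Metric.mtotally_bounded {x. absv x \<le> 1}"
    by (rule Metric.compactin_imp_mtotally_bounded[OF compactin_int_ring])
  then obtain K where K: "finite K" "{x. absv x \<le> 1} \<subseteq> (\<Union>x\<in>K. Metric.mball x \<epsilon>)"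
    using assms unfolding Metric.mtotally_bounded_def by metis
  have "\<exists>k\<in>K. absv (x - k) < \<epsilon>" if x: "absv x \<le> 1" for x
  proof -
    have "x \<in> (\<Union>x\<in>K. Metric.mball x \<epsilon>)" by (rule subsetD[OF K(2)]) (simp add: x)
    then obtain k where k: "k \<in> K" "x \<in> Metric.mball k \<epsilon>" by (rule UN_E)
    then have "absv (x - k) < \<epsilon>" using absv_minus_commute[of x k] by simp
    then show ?thesis using k(1) by (rule rev_bexI[rotated])
  qed
  with K(1) show ?thesis by (intro exI[of _ K] conjI allI impI)
qed

text \<open>Elements that are closer to each other than their size have equal absolute value, so by total
boundedness only finitely many values occur between \<open>absv c\<close> and 1.\<close>

lemma uniformizer_ex: "\<exists>\<pi>. uniformizer absv \<pi>"
proof -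
  \<comment> \<open>A lower bound for the absolute value of a uniformizer.\<close>
  obtain c where c: "c \<noteq> 0" "absv c < 1" using ex_small[of 1] by auto
  obtain K where K: "finite K" "\<And>x. absv x \<le> 1 \<Longrightarrow> \<exists>k\<in>K. absv (x - k) < absv c"
    using int_ring_finite_cover[OF absv_pos[OF c(1)]] by blast
  define V where "V = absv ` {x. absv c \<le> absv x \<and> absv x < 1}"
  have "V \<subseteq> absv ` K"
  proof
    fix v assume "v \<in> V"
    then obtain x where x: "absv c \<le> absv x" "absv x < 1" "v = absv x" by (auto simp: V_def)
    then obtain k where k: "k \<in> K" "absv (x - k) < absv c" using K(2)[of x] by auto
    then have "absv k = absv x"
      using absv_eq_if_close[of k x] x(1) by (simp add: absv_minus_commute)
    then show "v \<in> absv ` K" using k(1) x(3) by (intro image_eqI[of _ _ k]) simp_all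
  qed
  then have fin: "finite V" using K(1) finite_surj by blast
  have cV: "absv c \<in> V" unfolding V_def using c by blast
  then have "V \<noteq> {}" by blast
  then have MaxV: "Max V \<in> V" by (rule Max_in[OF fin])
  then obtain \<pi> where \<pi>: "absv \<pi> = Max V" "absv \<pi> < 1" unfolding V_def by force
  have c\<pi>: "absv c \<le> absv \<pi>" unfolding \<pi>(1) by (rule Max_ge[OF fin cV])
  have "absv y \<le> absv \<pi>" if "absv y < 1" for y
  proof (cases "absv c \<le> absv y")
    case True
    then have "absv y \<in> V" using that unfolding V_def by blast
    then show ?thesis unfolding \<pi>(1) by (rule Max_ge[OF fin])
  qed (use c\<pi> in simp)
  moreover have "\<pi> \<noteq> 0" using c\<pi> absv_pos[OF c(1)] by auto
  ultimately have "uniformizer absv \<pi>" using \<pi>(2) by (simp add: uniformizer_def max_ideal_def)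
  then show ?thesis by blast
qed

lemma absv_uniformizer_unique:
  "uniformizer absv \<pi> \<Longrightarrow> uniformizer absv \<pi>' \<Longrightarrow> absv \<pi> = absv \<pi>'"
  by (auto simp: uniformizer_def intro: antisym)

text \<open>The common absolute value of all uniformizers.\<close>

definition \<theta> :: real where "\<theta> = absv (SOME \<pi>. uniformizer absv \<pi>)"

lemma \<theta>_eq: "uniformizer absv \<pi> \<Longrightarrow> absv \<pi> = \<theta>"
  unfolding \<theta>_def by (rule absv_uniformizer_unique[OF _ someI_ex[OF uniformizer_ex]])

lemma \<theta>_pos: "0 < \<theta>" and \<theta>_less_1: "\<theta> < 1" and less_1_imp_le_\<theta>: "absv x < 1 \<Longrightarrow> absv x \<le> \<theta>"
proof -
  obtain \<pi> where \<pi>: "uniformizer absv \<pi>" using uniformizer_ex by blast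
  then show "0 < \<theta>" "\<theta> < 1" "absv x < 1 \<Longrightarrow> absv x \<le> \<theta>"
    using \<theta>_eq[OF \<pi>] absv_pos[of \<pi>] by (auto simp: uniformizer_def max_ideal_def)
qed

lemma ex_absv_\<theta>: "\<exists>\<pi>. \<pi> \<noteq> 0 \<and> absv \<pi> = \<theta>"
  using uniformizer_ex \<theta>_eq unfolding uniformizer_def by blast

lemma \<theta>_power_le_iff: "\<theta> ^ m \<le> \<theta> ^ n \<longleftrightarrow> n \<le> m"
  using \<theta>_pos \<theta>_less_1 by (simp add: power_decreasing_iff)

lemma \<theta>_power_eq_iff: "\<theta> ^ m = \<theta> ^ n \<longleftrightarrow> m = n"
  unfolding order_eq_iff[of "\<theta> ^ m"] \<theta>_power_le_iff by auto

lemma \<theta>_power_less_iff: "\<theta> ^ m < \<theta> ^ n \<longleftrightarrow> n < m"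
  using \<theta>_pos \<theta>_less_1 by (simp add: power_strict_decreasing_iff)

lemma \<theta>_power_tendsto_0: "\<epsilon> > 0 \<Longrightarrow> \<exists>n. \<theta> ^ n < \<epsilon>"
  by (rule real_arch_pow_inv[OF _ \<theta>_less_1])

lemma absv_eq_\<theta>_power:
  assumes "x \<noteq> 0" "absv x \<le> 1"
  shows "\<exists>n. absv x = \<theta> ^ n"
proof -
  obtain \<pi> where \<pi>: "\<pi> \<noteq> 0" "absv \<pi> = \<theta>" using ex_absv_\<theta> by blast
  define n where "n = (LEAST n. \<theta> ^ Suc n < absv x)"
  obtain m where "\<theta> ^ m < absv x" using \<theta>_power_tendsto_0 absv_pos[OF assms(1)] by blast
  then have "\<theta> ^ Suc m < absv x"
    using \<theta>_power_le_iff[of "Suc m" m] by simp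
  then have n: "\<theta> ^ Suc n < absv x" unfolding n_def by (rule LeastI)
  have le: "absv x \<le> \<theta> ^ n"
  proof (cases n)
    case 0
    then show ?thesis using assms by simp
  next
    case (Suc k)
    then have "\<not> \<theta> ^ Suc k < absv x" using not_less_Least[of k "\<lambda>n. \<theta> ^ Suc n < absv x"] by (simp add: n_def)
    then show ?thesis using Suc by simp
  qed
  have "absv (x / \<pi> ^ n) > \<theta>" using n \<theta>_pos by (simp add: absv_divide absv_power \<pi> field_simps)
  then have "\<not> absv (x / \<pi> ^ n) < 1" using less_1_imp_le_\<theta>[of "x / \<pi> ^ n"] by linarith
  then have "\<theta> ^ n \<le> absv x" using \<theta>_pos by (simp add: absv_divide absv_power \<pi> field_simps)
  then show ?thesis using le by (intro exI[of _ n]) simp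
qed

lemma norm_val_eq:
  assumes "absv x = \<theta> powi n"
  shows "norm_val absv x = n"
  unfolding norm_val_def
proof (rule the_equality)
  obtain \<pi> where \<pi>: "uniformizer absv \<pi>" using uniformizer_ex by blast
  then show "\<exists>\<pi>. uniformizer absv \<pi> \<and> absv x = absv \<pi> powi n"
    using assms \<theta>_eq[OF \<pi>] by (intro exI[of _ \<pi>]) simp
next
  fix m assume "\<exists>\<pi>. uniformizer absv \<pi> \<and> absv x = absv \<pi> powi m"
  then obtain \<pi> where "uniformizer absv \<pi>" "absv x = absv \<pi> powi m" by blast
  then have "\<theta> powi m = \<theta> powi n" using assms \<theta>_eq by simp
  moreover have "\<theta> powi l < \<theta> powi k" if "k < l" for k l
    using that \<theta>_pos \<theta>_less_1 by (rule power_int_strict_decreasing)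
  ultimately show "m = n" by (metis less_irrefl linorder_neqE)
qed

end

text \<open>If another prime \<open>l\<close> divided the order, there would be a subgroup of order \<open>l\<close> by Sylow, and in it a
nontrivial element whose order divides both \<open>l\<close> and \<open>p\<close>.\<close>

lemma exponent_prime_imp_order_prime_power:
  fixes G (structure) and p :: nat
  assumes "group G" "finite (carrier G)" "prime p"
    and exp: "\<And>x. x \<in> carrier G \<Longrightarrow> x [^] p = \<one>"
  shows "\<exists>n. Coset.order G = p ^ n"
proof -
  interpret group G by fact
  have pos: "Coset.order G > 0" using assms(2) order_gt_0_iff_finite by blast
  have "l = p" if l: "prime l" "l dvd Coset.order G" for l
  proof (rule ccontr)
    assume "l \<noteq> p"
    then have cop: "coprime l p" using l(1) assms(3) by (simp add: primes_coprime)
    obtain m where "Coset.order G = l ^ 1 * m" using l(2) by (auto elim: dvdE)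
    then obtain H where H: "subgroup H G" "card H = l"
      using sylow_thm[OF l(1) assms(1) _ assms(2), of 1 m] by auto
    have "card H > 1" using H(2) prime_gt_1_nat[OF l(1)] by simp
    have "\<exists>x\<in>H. x \<noteq> \<one>"
    proof (rule ccontr)
      assume "\<not> (\<exists>x\<in>H. x \<noteq> \<one>)"
      then have "card H \<le> card {\<one>}" by (intro card_mono) auto
      then show False using \<open>card H > 1\<close> by simp
    qed
    then obtain x where x: "x \<in> H" "x \<noteq> \<one>" by blast
    have xG: "x \<in> carrier G" using x(1) subgroup.mem_carrier[OF H(1)] by blast
    interpret H: group "G\<lparr>carrier := H\<rparr>" by (rule subgroup.subgroup_is_group[OF H(1) assms(1)])
    have "x [^]\<^bsub>G\<lparr>carrier := H\<rparr>\<^esub> Coset.order (G\<lparr>carrier := H\<rparr>) = \<one>"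
      using H.pow_order_eq_1[of x] x(1) by simp
    then have "x [^] l = \<one>" using H(2) by (simp add: Coset.order_def nat_pow_consistent[symmetric])
    then have "ord x dvd l" "ord x dvd p" using exp[OF xG] pow_eq_id[OF xG] by auto
    then have "ord x = 1" using cop by (metis coprime_common_divisor_nat)
    then show False using x(2) ord_eq_1[OF xG] by blast
  qed
  then have "prime_factorization (Coset.order G) = replicate_mset (count (prime_factorization (Coset.order G)) p) p"
    by (intro multiset_eqI) (auto simp: count_eq_zero_iff in_prime_factors_iff)
  then have "Coset.order G = prod_mset (replicate_mset (count (prime_factorization (Coset.order G)) p) p)"
    using prod_mset_prime_factorization_nat[of "Coset.order G"] pos by metis
  then show ?thesis by auto
qed

context local_field
begin

lemma int_ring_simps:
  "carrier (int_ring absv) = {x. absv x \<le> 1}" "x \<otimes>\<^bsub>int_ring absv\<^esub> y = x * y"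
  "x \<oplus>\<^bsub>int_ring absv\<^esub> y = x + y" "\<one>\<^bsub>int_ring absv\<^esub> = 1" "\<zero>\<^bsub>int_ring absv\<^esub> = 0"
  by (simp_all add: int_ring_def)

lemma absv_mult_le_1: "absv x \<le> 1 \<Longrightarrow> absv y \<le> 1 \<Longrightarrow> absv (x * y) \<le> 1"
  unfolding absv_mult using absv_nonneg mult_le_one by blast

lemma absv_add_le: "absv x \<le> c \<Longrightarrow> absv y \<le> c \<Longrightarrow> absv (x + y) \<le> c"
  using absv_ultrametric[of x y] by linarith

lemma absv_add_less: "absv x < c \<Longrightarrow> absv y < c \<Longrightarrow> absv (x + y) < c"
  using absv_ultrametric[of x y] by linarith

lemma cring_int_ring: "cring (int_ring absv)"
proof (rule cringI)
  show "abelian_group (int_ring absv)"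
  proof (rule abelian_groupI)
    fix x assume "x \<in> carrier (int_ring absv)"
    then show "\<exists>y\<in>carrier (int_ring absv). y \<oplus>\<^bsub>int_ring absv\<^esub> x = \<zero>\<^bsub>int_ring absv\<^esub>"
      by (intro bexI[of _ "- x"]) (simp_all add: int_ring_simps)
  qed (simp_all add: int_ring_simps absv_add_le add_ac)
  show "comm_monoid (int_ring absv)"
    by (rule comm_monoidI) (simp_all add: int_ring_simps absv_mult_le_1 mult_ac)
qed (simp add: int_ring_simps algebra_simps)

lemma ideal_max_ideal: "ideal (max_ideal absv) (int_ring absv)"
proof (rule idealI)
  interpret cring "int_ring absv" by (rule cring_int_ring)
  show "ring (int_ring absv)" by (rule ring_axioms)
  have minus: "\<ominus>\<^bsub>int_ring absv\<^esub> x = - x" if "absv x \<le> 1" for x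
    by (rule minus_equality) (use that in \<open>simp_all add: int_ring_simps\<close>)
  show "subgroup (max_ideal absv) (add_monoid (int_ring absv))"
  proof
    fix x assume "x \<in> max_ideal absv"
    then have x: "absv x < 1" by (simp add: max_ideal_def)
    then show "inv\<^bsub>add_monoid (int_ring absv)\<^esub> x \<in> max_ideal absv"
      using minus[of x] by (simp add: a_inv_def max_ideal_def)
  qed (auto simp: max_ideal_def int_ring_simps absv_add_less)
  fix a x assume "a \<in> max_ideal absv" "x \<in> carrier (int_ring absv)"
  then have ax: "absv a < 1" "absv x \<le> 1" by (simp_all add: max_ideal_def int_ring_simps)
  have "absv x * absv a < 1"
    using ax absv_nonneg[of x] absv_nonneg[of a] mult_left_le_one_le[of "absv a" "absv x"] by linarith
  then show "x \<otimes>\<^bsub>int_ring absv\<^esub> a \<in> max_ideal absv" "a \<otimes>\<^bsub>int_ring absv\<^esub> x \<in> max_ideal absv"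
    by (simp_all add: max_ideal_def int_ring_simps absv_mult mult.commute)
qed

lemma max_ideal_eq: "max_ideal absv = {x. absv x \<le> \<theta>}"
  unfolding max_ideal_def using less_1_imp_le_\<theta> \<theta>_less_1 by fastforce

lemma ideal_pow_eq: "ideal_pow (int_ring absv) (max_ideal absv) n = {x. absv x \<le> \<theta> ^ n}"
proof (induction n)
  case 0
  then show ?case by (simp add: int_ring_simps)
next
  case (Suc n)
  obtain \<pi> where \<pi>: "\<pi> \<noteq> 0" "absv \<pi> = \<theta>" using ex_absv_\<theta> by blast
  have "absv x \<le> \<theta> ^ Suc n" if "x \<in> ideal_prod (int_ring absv) {x. absv x \<le> \<theta> ^ n} (max_ideal absv)" for x
    using that
  proof (induction rule: ideal_prod.induct)
    case (prod i j)
    have "absv i * absv j \<le> \<theta> ^ n * \<theta>"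
      using prod \<theta>_pos absv_nonneg by (intro mult_mono) (simp_all add: max_ideal_eq)
    then show ?case by (simp add: int_ring_simps absv_mult mult.commute)
  next
    case (sum s1 s2)
    then show ?case by (simp add: int_ring_simps absv_add_le)
  qed
  moreover have "x \<in> ideal_prod (int_ring absv) {x. absv x \<le> \<theta> ^ n} (max_ideal absv)"
    if "absv x \<le> \<theta> ^ Suc n" for x
  proof -
    have "absv (x / \<pi>) \<le> \<theta> ^ n" using that \<theta>_pos by (simp add: absv_divide \<pi> field_simps)
    then have "(x / \<pi>) \<otimes>\<^bsub>int_ring absv\<^esub> \<pi> \<in> ideal_prod (int_ring absv) {x. absv x \<le> \<theta> ^ n} (max_ideal absv)"
      by (intro ideal_prod.prod) (simp_all add: max_ideal_eq \<pi>)
    then show ?thesis using \<pi>(1) by (simp add: int_ring_simps)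
  qed
  ultimately show ?case using Suc by auto
qed

lemma U_iff: "x \<in> U absv i \<longleftrightarrow> absv (x - 1) \<le> \<theta> ^ i"
proof -
  have "x \<in> U absv i \<longleftrightarrow> (\<exists>y. x = 1 + y \<and> absv y \<le> \<theta> ^ i)"
    by (simp add: U_def ideal_pow_eq)
  also have "\<dots> \<longleftrightarrow> absv (x - 1) \<le> \<theta> ^ i" by (metis add_diff_cancel_left' diff_add_cancel add.commute)
  finally show ?thesis .
qed

lemma U_antimono: "i \<le> j \<Longrightarrow> U absv j \<subseteq> U absv i"
  unfolding subset_iff U_iff using \<theta>_power_le_iff order_trans by blast

lemma absv_U:
  assumes "x \<in> U absv i" "i \<ge> 1"
  shows "absv x = 1"
proof -
  have "\<theta> ^ i < \<theta> ^ 0" unfolding \<theta>_power_less_iff using assms(2) by simp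
  then have "absv (x - 1) < absv 1" using assms(1) unfolding U_iff by simp
  then show ?thesis using absv_eq_if_close[of x 1] by simp
qed

lemma mult_subgroup_U:
  assumes "i \<ge> 1"
  shows "mult_subgroup (U absv i)"
  unfolding mult_subgroup_def
proof (intro conjI ballI)
  show "1 \<in> U absv i" using \<theta>_pos by (simp add: U_iff)
  show "0 \<notin> U absv i" using absv_U[OF _ assms, of 0] by auto
  fix x y assume xy: "x \<in> U absv i" "y \<in> U absv i"
  have y: "absv y = 1" using absv_U[OF xy(2) assms] .
  then have "y \<noteq> 0" by auto
  then have "absv (x / y - 1) = absv (x - y)"
    using y absv_divide[of "x - y" y] by (simp add: diff_divide_distrib)
  also have "\<dots> \<le> \<theta> ^ i"
    using absv_diff_trans[of x y 1] absv_minus_commute[of y 1] xy unfolding U_iff by simp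
  finally show "x / y \<in> U absv i" unfolding U_iff .
qed

lemma U_div_iff:
  assumes "absv x = 1" "absv y = 1"
  shows "x / y \<in> U absv i \<longleftrightarrow> absv (x - y) \<le> \<theta> ^ i"
proof -
  have "y \<noteq> 0" using assms by auto
  then have "absv (x / y - 1) = absv (x - y)"
    using assms absv_divide[of "x - y" y] by (simp add: diff_divide_distrib)
  then show ?thesis by (simp add: U_iff)
qed

subsection \<open>The residue field\<close>

definition residue :: "'a \<Rightarrow> 'a set" where
  "residue t = {x. absv (x - t) < 1}"

lemma residue_eq_iff: "residue s = residue t \<longleftrightarrow> absv (s - t) < 1"
proof
  assume "residue s = residue t"
  moreover have "s \<in> residue s" by (simp add: residue_def)
  ultimately show "absv (s - t) < 1" by (simp add: residue_def)
next
  assume st: "absv (s - t) < 1"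
  have "absv (x - s) < 1 \<longleftrightarrow> absv (x - t) < 1" for x
    using absv_diff_trans[of x t s] absv_diff_trans[of x s t] st absv_minus_commute[of s t] by linarith
  then show "residue s = residue t" by (simp add: residue_def)
qed

lemma max_ideal_coset: "max_ideal absv +>\<^bsub>int_ring absv\<^esub> t = residue t"
proof -
  have "x = h + t \<longleftrightarrow> h = x - t" for x h :: 'a by (auto simp: algebra_simps)
  then show ?thesis
    by (auto simp: a_r_coset_def' residue_def int_ring_simps max_ideal_def)
qed

lemma residue_field_simps:
  "carrier (residue_field absv) = residue ` {t. absv t \<le> 1}"
  "\<one>\<^bsub>residue_field absv\<^esub> = residue 1" "\<zero>\<^bsub>residue_field absv\<^esub> = residue 0"
proof -
  show "carrier (residue_field absv) = residue ` {t. absv t \<le> 1}"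
    by (auto simp: residue_field_def FactRing_def A_RCOSETS_def' max_ideal_coset int_ring_simps)
  show "\<one>\<^bsub>residue_field absv\<^esub> = residue 1"
    by (simp add: residue_field_def FactRing_def max_ideal_coset int_ring_simps)
  show "\<zero>\<^bsub>residue_field absv\<^esub> = residue 0"
    by (simp add: residue_field_def FactRing_def residue_def max_ideal_def)
qed

lemma residue_field_add:
  assumes "absv s \<le> 1" "absv t \<le> 1"
  shows "residue s \<oplus>\<^bsub>residue_field absv\<^esub> residue t = residue (s + t)"
proof -
  interpret ideal "max_ideal absv" "int_ring absv" by (rule ideal_max_ideal)
  show ?thesis
    using a_rcos_sum[of s t] assms
    by (simp add: residue_field_def FactRing_def max_ideal_coset int_ring_simps)
qed

lemma residue_field_add_pow:
  assumes "absv t \<le> 1"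
  shows "add_pow (residue_field absv) n (residue t) = residue (of_nat n * t)"
proof (induction n)
  case 0
  then show ?case by (simp add: add_pow_def nat_pow_def residue_field_simps)
next
  case (Suc n)
  have "absv (of_nat n * t) \<le> 1" using absv_mult_le_1[OF absv_of_nat_le assms] .
  then have "residue (of_nat n * t) \<oplus>\<^bsub>residue_field absv\<^esub> residue t = residue (of_nat (Suc n) * t)"
    using residue_field_add assms by (simp add: algebra_simps)
  moreover have "add_pow (residue_field absv) (Suc n) (residue t) =
      add_pow (residue_field absv) n (residue t) \<oplus>\<^bsub>residue_field absv\<^esub> residue t"
    by (simp add: add_pow_def nat_pow_def)
  ultimately show ?case using Suc by simp
qed

lemma finite_residue_field: "finite (carrier (residue_field absv))"
proof -
  obtain K where K: "finite K" "\<And>x. absv x \<le> 1 \<Longrightarrow> \<exists>k\<in>K. absv (x - k) < 1"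
    using int_ring_finite_cover[of 1] by auto
  have "carrier (residue_field absv) \<subseteq> residue ` K"
  proof
    fix X assume "X \<in> carrier (residue_field absv)"
    then obtain t where t: "absv t \<le> 1" "X = residue t" unfolding residue_field_simps by auto
    then obtain k where "k \<in> K" "absv (t - k) < 1" using K(2) by blast
    then show "X \<in> residue ` K" using t(2) residue_eq_iff by blast
  qed
  then show ?thesis using K(1) finite_surj by blast
qed

lemma residue_char_iff:
  "add_pow (residue_field absv) n \<one>\<^bsub>residue_field absv\<^esub> = \<zero>\<^bsub>residue_field absv\<^esub> \<longleftrightarrow> absv (of_nat n) < 1"
  unfolding residue_field_simps using residue_field_add_pow[of 1 n] residue_eq_iff[of "of_nat n" 0] by simp

text \<open>The least positive \<open>n\<close> with \<open>absv (of_nat n) < 1\<close> is prime since the absolute value is multiplicative.\<close>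

lemma residue_char:
  shows "absv (of_nat (residue_char absv)) < 1" "prime (residue_char absv)"
proof -
  let ?P = "\<lambda>n. n > 0 \<and> absv (of_nat n) < 1"
  have def: "residue_char absv = (LEAST n. ?P n)" by (simp add: residue_char_def residue_char_iff)
  have "\<exists>n. ?P n"
  proof -
    have "range (\<lambda>n. residue (of_nat n)) \<subseteq> carrier (residue_field absv)"
      unfolding residue_field_simps using absv_of_nat_le by blast
    then have "\<not> inj (\<lambda>n::nat. residue (of_nat n))"
      using finite_residue_field finite_subset finite_imageD infinite_UNIV_nat by blast
    then obtain m n :: nat where mn: "m < n" "residue (of_nat m) = residue (of_nat n)"
      unfolding inj_def by (metis linorder_neqE_nat)
    have "absv (of_nat (n - m)) < 1"
      using mn residue_eq_iff absv_minus_commute by (simp add: of_nat_diff)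
    then show ?thesis using mn(1) by (intro exI[of _ "n - m"]) simp
  qed
  then have P: "?P (residue_char absv)" unfolding def by (rule LeastI_ex)
  then show "absv (of_nat (residue_char absv)) < 1" by blast
  have least: "\<not> ?P n" if "n < residue_char absv" for n
    using that not_less_Least unfolding def by blast
  have "residue_char absv \<noteq> 1" using P by auto
  then obtain l where l: "prime l" "l dvd residue_char absv" using prime_factor_nat by blast
  then obtain k where k: "residue_char absv = l * k" by (auto elim: dvdE)
  have "k > 0" using P k by (cases k) auto
  have "k < residue_char absv" using \<open>k > 0\<close> prime_gt_1_nat[OF l(1)] by (simp add: k)
  then have "\<not> absv (of_nat k) < 1" using least \<open>k > 0\<close> by blast
  moreover have "absv (of_nat l) * absv (of_nat k) < 1" using P by (simp add: k absv_mult)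
  ultimately have "absv (of_nat l) < 1"
    using absv_of_nat_le[of k] by (metis antisym linorder_not_less mult.right_neutral)
  then have "residue_char absv \<le> l"
    using least[of l] prime_gt_0_nat[OF l(1)] not_less by blast
  then have "residue_char absv = l" using \<open>k > 0\<close> prime_gt_0_nat[OF l(1)] by (simp add: k)
  then show "prime (residue_char absv)" using l(1) by simp
qed

lemma card_residue_field: "card (carrier (residue_field absv)) = residue_char absv ^ residue_degree absv"
proof -
  let ?k = "residue_field absv" and ?p = "residue_char absv"
  interpret k: ring ?k
    unfolding residue_field_def by (rule ideal.quotient_is_ring[OF ideal_max_ideal])
  have "\<exists>n. Coset.order (add_monoid ?k) = ?p ^ n"
  proof (rule exponent_prime_imp_order_prime_power[OF _ _ residue_char(2)])
    show "group (add_monoid ?k)" by (rule k.add.is_group)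
    show "finite (carrier (add_monoid ?k))" using finite_residue_field by simp
    fix X assume "X \<in> carrier (add_monoid ?k)"
    then obtain t where t: "absv t \<le> 1" "X = residue t" by (auto simp: residue_field_simps)
    have "absv (of_nat ?p * t) < 1"
      using residue_char(1) t(1) absv_nonneg[of t] absv_nonneg[of "of_nat ?p"]
        mult_left_le[of "absv t" "absv (of_nat ?p)"] unfolding absv_mult by linarith
    then have "add_pow ?k ?p X = residue 0"
      using residue_field_add_pow[OF t(1)] t(2) residue_eq_iff[of "of_nat ?p * t" 0] by simp
    then show "X [^]\<^bsub>add_monoid ?k\<^esub> ?p = \<one>\<^bsub>add_monoid ?k\<^esub>"
      by (simp add: add_pow_def residue_field_simps)
  qed
  then obtain n where n: "card (carrier ?k) = ?p ^ n" by (auto simp: Coset.order_def)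
  have "residue_degree absv = n"
    unfolding residue_degree_def n
    by (rule the_equality) (use prime_gt_1_nat[OF residue_char(2)] in simp_all)
  then show ?thesis using n by simp
qed

lemma residue_degree_pos: "residue_degree absv > 0"
proof (rule ccontr)
  assume "\<not> ?thesis"
  then have c: "card (carrier (residue_field absv)) = 1" using card_residue_field by simp
  have "residue 0 \<in> carrier (residue_field absv)" "residue 1 \<in> carrier (residue_field absv)"
    by (simp_all add: residue_field_simps)
  then have "residue 0 = residue 1" using c by (auto simp: card_1_singleton_iff)
  then show False by (simp add: residue_eq_iff)
qed

subsection \<open>Indices between groups of principal units\<close>

abbreviation q :: nat where "q \<equiv> card (carrier (residue_field absv))"

text \<open>The map \<open>t \<mapsto> 1 + \<pi>\<^sup>i t\<close> induces a bijection from the residue field to the classes.\<close>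

lemma card_cosets_U_Suc:
  assumes "i \<ge> 1"
  shows "card (cosets (U absv i) (U absv (Suc i))) = q"
proof -
  obtain \<pi> where \<pi>: "\<pi> \<noteq> 0" "absv \<pi> = \<theta>" using ex_absv_\<theta> by blast
  let ?u = "\<lambda>t. 1 + \<pi> ^ i * t"
  have u: "absv (?u t - 1) = \<theta> ^ i * absv t" for t by (simp add: absv_mult absv_power \<pi>)
  have \<theta>i: "\<theta> ^ i > 0" using \<theta>_pos by simp
  have U: "U absv i = ?u ` {t. absv t \<le> 1}"
  proof (intro equalityI subsetI)
    fix x assume "x \<in> U absv i"
    then have "absv ((x - 1) / \<pi> ^ i) \<le> 1" using \<theta>i by (simp add: U_iff absv_divide absv_power \<pi>)
    moreover have "x = ?u ((x - 1) / \<pi> ^ i)" using \<pi>(1) by simp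
    ultimately show "x \<in> ?u ` {t. absv t \<le> 1}" by blast
  next
    fix x assume "x \<in> ?u ` {t. absv t \<le> 1}"
    then obtain t where t: "absv t \<le> 1" "x = ?u t" by blast
    show "x \<in> U absv i" unfolding U_iff t(2) u using t(1) \<theta>i by (simp add: mult_left_le)
  qed
  have "card (residue ` {t. absv t \<le> 1}) = card ((\<lambda>t. (*) (?u t) ` U absv (Suc i)) ` {t. absv t \<le> 1})"
  proof (rule card_image_eq_if_same_fibres)
    fix s t assume st: "s \<in> {t. absv t \<le> 1}" "t \<in> {t. absv t \<le> 1}"
    have abs1: "absv (?u s) = 1" "absv (?u t) = 1"
      using absv_U[OF _ assms] U st by blast+
    then have nz: "?u s \<noteq> 0" "?u t \<noteq> 0" by (metis absv_zero zero_neq_one)+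
    have "(*) (?u s) ` U absv (Suc i) = (*) (?u t) ` U absv (Suc i) \<longleftrightarrow> absv (?u s - ?u t) \<le> \<theta> ^ Suc i"
      using coset_eq_iff[OF mult_subgroup_U nz, of "Suc i"] U_div_iff[OF abs1] by simp
    also have "?u s - ?u t = \<pi> ^ i * (s - t)" by (simp add: algebra_simps)
    also have "absv (\<pi> ^ i * (s - t)) \<le> \<theta> ^ Suc i \<longleftrightarrow> absv (s - t) \<le> \<theta>"
      using \<theta>i by (simp add: absv_mult absv_power \<pi> mult.commute)
    also have "\<dots> \<longleftrightarrow> absv (s - t) < 1" using less_1_imp_le_\<theta>[of "s - t"] \<theta>_less_1 by linarith
    finally show "residue s = residue t \<longleftrightarrow> (*) (?u s) ` U absv (Suc i) = (*) (?u t) ` U absv (Suc i)"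
      by (simp add: residue_eq_iff)
  qed
  then show ?thesis unfolding residue_field_simps cosets_def U image_image by simp
qed

lemma cosets_self: "mult_subgroup A \<Longrightarrow> card (cosets A A) = 1"
proof -
  assume A: "mult_subgroup A"
  have "cosets A A = {A}"
  proof -
    have "(*) a ` A = A" if "a \<in> A" for a
      using coset_eq_iff[OF A, of a 1] that mult_subgroup_nonzero[OF A that] by simp
    then show ?thesis using mult_subgroup_one[OF A] unfolding cosets_def by blast
  qed
  then show ?thesis by simp
qed

lemma card_cosets_U:
  assumes "1 \<le> i" "i \<le> n"
  shows "card (cosets (U absv i) (U absv n)) = q ^ (n - i)"
  using assms(2)
proof (induction n rule: dec_induct)
  case base
  then show ?case using cosets_self[OF mult_subgroup_U[OF assms(1)]] by simp
next
  case (step n)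
  have "card (cosets (U absv i) (U absv (Suc n))) =
      card (cosets (U absv i) (U absv n)) * card (cosets (U absv n) (U absv (Suc n)))"
    by (intro card_cosets_tower mult_subgroup_U U_antimono) (use step assms in auto)
  then show ?case using step assms by (simp add: card_cosets_U_Suc Suc_diff_le)
qed

end

section \<open>Roots of unity of order p and the p-th power map\<close>

locale local_field_mu = local_field absv for absv :: "'a::field \<Rightarrow> real" +
  fixes p :: nat
  assumes p_def: "p = residue_char absv"
    and mu_nontrivial: "(mu p :: 'a set) \<noteq> {1}"
begin

lemma prime_p: "prime p" and absv_p_less_1: "absv (of_nat p) < 1"
  using residue_char p_def by auto

lemma p_ge_2: "p \<ge> 2" using prime_ge_2_nat[OF prime_p] .

abbreviation \<mu> :: "'a set" where "\<mu> \<equiv> mu p"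

lemma mu_iff: "z \<in> \<mu> \<longleftrightarrow> z ^ p = 1" by (simp add: mu_def)

lemma one_in_mu: "1 \<in> \<mu>" by (simp add: mu_iff)

lemma absv_mu: "z \<in> \<mu> \<Longrightarrow> absv z = 1"
  unfolding mu_iff using absv_power[of z p] p_ge_2 absv_nonneg[of z]
  by (metis absv_one not_numeral_le_zero power_eq_1_iff abs_of_nonneg real_norm_def)

lemma mu_nonzero: "z \<in> \<mu> \<Longrightarrow> z \<noteq> 0"
  using absv_mu by fastforce

lemma mu_divide: "z \<in> \<mu> \<Longrightarrow> z' \<in> \<mu> \<Longrightarrow> z / z' \<in> \<mu>"
  by (simp add: mu_iff power_divide)

text \<open>A nontrivial root has \<open>p\<close> distinct powers because \<open>p\<close> is prime, and \<open>X\<^sup>p - 1\<close> has no more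
roots than that.\<close>

lemma mu_eq_powers:
  assumes z: "z \<in> \<mu>" "z \<noteq> 1"
  shows "\<mu> = (\<lambda>k. z ^ k) ` {..<p}" "card \<mu> = p"
proof -
  let ?P = "Polynomial.monom 1 p - 1 :: 'a poly"
  have deg: "degree ?P \<le> p" by (rule degree_diff_le) (simp_all add: degree_monom_le)
  have "Polynomial.coeff ?P p = 1" using p_ge_2 by simp
  then have "?P \<noteq> 0" by (metis coeff_0 zero_neq_one)
  moreover have roots: "{x. poly ?P x = 0} = \<mu>" by (auto simp: poly_monom mu_iff)
  ultimately have fin: "finite \<mu>" and card: "card \<mu> \<le> p"
    using poly_roots_finite[of ?P] card_poly_roots_bound[of ?P] deg by auto
  have sub: "(\<lambda>k. z ^ k) ` {..<p} \<subseteq> \<mu>"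
  proof
    fix x assume "x \<in> (\<lambda>k. z ^ k) ` {..<p}"
    then obtain k where "x = z ^ k" by blast
    then have "x ^ p = (z ^ p) ^ k" by (simp add: power_mult[symmetric] mult.commute)
    then show "x \<in> \<mu>" using z(1) by (simp add: mu_iff)
  qed
  \<comment> \<open>An equality of powers would make a power of \<open>z\<close> with exponent prime to \<open>p\<close> trivial.\<close>
  have less: "z ^ i \<noteq> z ^ j" if "i < j" "j < p" for i j
  proof
    assume "z ^ i = z ^ j"
    moreover have "z ^ j = z ^ i * z ^ (j - i)" using that by (simp flip: power_add)
    ultimately have 1: "z ^ (j - i) = 1" using mu_nonzero[OF z(1)] by simp
    have "j - i > 0" "j - i < p" using that by auto
    then have "\<not> p dvd j - i" using nat_dvd_not_less by blast
    then have "coprime p (j - i)" using prime_p prime_imp_coprime by blast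
    then have "gcd (j - i) p = 1" by (simp add: gcd.commute coprime_imp_gcd_eq_1)
    then obtain a b where ab: "(j - i) * a = p * b + 1"
      using bezout_nat[of "j - i" p] \<open>j - i > 0\<close> by auto
    have "z = z ^ (p * b + 1)" using z(1) by (simp add: power_mult mu_iff)
    also have "\<dots> = 1" unfolding ab[symmetric] using 1 by (simp add: power_mult)
    finally show False using z(2) by simp
  qed
  have "inj_on (\<lambda>k. z ^ k) {..<p}"
    by (rule linorder_inj_onI) (use less in auto)
  then have c: "card ((\<lambda>k. z ^ k) ` {..<p}) = p" by (simp add: card_image)
  then show "\<mu> = (\<lambda>k. z ^ k) ` {..<p}"
    using card_seteq[OF fin sub] card by simp
  then show "card \<mu> = p" using c by simp
qed

lemma mu_nontrivial_ex: "\<exists>z\<in>\<mu>. z \<noteq> 1"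
  using mu_nontrivial one_in_mu by blast

lemma card_mu: "card \<mu> = p"
  using mu_eq_powers(2) mu_nontrivial_ex by blast

lemma finite_mu: "finite \<mu>"
  by (rule card_ge_0_finite) (use card_mu p_ge_2 in simp)

lemma poly_mu: "Polynomial.monom 1 p - 1 = (\<Prod>z\<in>\<mu>. [:- z, 1:])"
proof (rule poly_eqI_degree_lead_coeff[where n = p and A = \<mu>])
  show "Polynomial.coeff (Polynomial.monom 1 p - 1) p = Polynomial.coeff (\<Prod>z\<in>\<mu>. [:- z, 1:]) p"
  proof -
    have "degree (\<Prod>z\<in>\<mu>. [:- z, 1:]) = p"
      using card_mu by (subst degree_prod_sum_eq) auto
    then have "Polynomial.coeff (\<Prod>z\<in>\<mu>. [:- z, 1:]) p = lead_coeff (\<Prod>z\<in>\<mu>. [:- z, 1:])" by simp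
    also have "\<dots> = 1" by (simp add: lead_coeff_prod)
    finally show ?thesis using p_ge_2 by simp
  qed
  show "degree (\<Prod>z\<in>\<mu>. [:- z, 1:]) \<le> p"
    using card_mu by (subst degree_prod_sum_eq) auto
  show "degree (Polynomial.monom 1 p - 1 :: 'a poly) \<le> p"
    by (rule degree_diff_le) (simp_all add: degree_monom_le)
  show "card \<mu> \<ge> p" using card_mu by simp
  fix z assume z: "z \<in> \<mu>"
  then have "poly (\<Prod>z\<in>\<mu>. [:- z, 1:]) z = 0" using finite_mu by (auto simp: poly_prod)
  then show "poly (Polynomial.monom 1 p - 1) z = poly (\<Prod>z\<in>\<mu>. [:- z, 1:]) z"
    using z by (simp add: poly_monom mu_iff)
qed

lemma power_minus_1_eq_prod: "v ^ p - 1 = (\<Prod>z\<in>\<mu>. v - z)"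
  using arg_cong[OF poly_mu, of "\<lambda>q. poly q v"] by (simp add: poly_monom poly_prod)

text \<open>Evaluate the derivative of \<open>X\<^sup>p - 1\<close> at 1, using the factorization.\<close>

lemma prod_one_minus_mu: "(\<Prod>z\<in>\<mu> - {1}. 1 - z) = of_nat p"
proof -
  let ?R = "\<Prod>z\<in>\<mu> - {1}. [:- z, 1:]"
  have "Polynomial.monom 1 p - 1 = [:-1, 1:] * ?R"
    unfolding poly_mu using finite_mu one_in_mu by (subst prod.remove[of _ 1]) auto
  then have "pderiv (Polynomial.monom 1 p - 1) = pderiv ([:-1, 1:] * ?R)" by simp
  then have "poly (pderiv (Polynomial.monom 1 p - 1)) 1 = poly ?R 1"
    by (simp add: pderiv_mult pderiv_pCons del: mult_pCons_left)
  moreover have "poly (pderiv (Polynomial.monom 1 p - 1)) 1 = (of_nat p :: 'a)"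
    by (simp add: pderiv_diff pderiv_monom poly_monom)
  ultimately show ?thesis by (simp add: poly_prod)
qed

text \<open>The root \<open>z'\<close> is a power of \<open>z\<close>, and \<open>1 - z\<close> divides \<open>1 - z\<^sup>k\<close>. By symmetry all nontrivial roots
are equally far from 1.\<close>

lemma absv_one_minus_mu_le:
  assumes "z \<in> \<mu>" "z \<noteq> 1" "z' \<in> \<mu>"
  shows "absv (1 - z') \<le> absv (1 - z)"
proof -
  obtain k where k: "z' = z ^ k" using mu_eq_powers(1)[OF assms(1,2)] assms(3) by auto
  have "absv (\<Sum>i<k. z ^ i) \<le> 1"
    by (rule absv_sum_le) (simp_all add: absv_power absv_mu[OF assms(1)])
  then have "absv (1 - z) * absv (\<Sum>i<k. z ^ i) \<le> absv (1 - z) * 1"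
    using absv_nonneg by (rule mult_left_mono)
  then show ?thesis unfolding k one_diff_power_eq absv_mult by simp
qed

lemma absv_p_eq:
  assumes "z \<in> \<mu>" "z \<noteq> 1"
  shows "absv (of_nat p) = absv (1 - z) ^ (p - 1)"
proof -
  have "absv (1 - z') = absv (1 - z)" if "z' \<in> \<mu> - {1}" for z'
    using absv_one_minus_mu_le[of z z'] absv_one_minus_mu_le[of z' z] assms that by (auto intro: antisym)
  moreover have "absv (\<Prod>z\<in>A. 1 - z) = (\<Prod>z\<in>A. absv (1 - z))" for A
    by (induction A rule: infinite_finite_induct) (simp_all add: absv_mult)
  ultimately have "absv (of_nat p) = (\<Prod>z'\<in>\<mu> - {1}. absv (1 - z))"
    unfolding prod_one_minus_mu[symmetric] by simp
  then show ?thesis using finite_mu one_in_mu card_mu by simp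
qed

text \<open>The common valuation of \<open>z - 1\<close> for the nontrivial roots of unity \<open>z\<close>, see \<open>absv_mu_minus_1\<close>.\<close>

definition mu_val :: nat where
  "mu_val = (THE n. \<forall>z\<in>\<mu> - {1}. absv (z - 1) = \<theta> ^ n)"

lemma absv_mu_minus_1:
  assumes "z \<in> \<mu>" "z \<noteq> 1"
  shows "absv (z - 1) = \<theta> ^ mu_val"
proof -
  have "absv (1 - z) \<le> 1" using absv_diff[of 1 z] absv_mu[OF assms(1)] by simp
  then obtain n where n: "absv (1 - z) = \<theta> ^ n"
    using absv_eq_\<theta>_power[of "1 - z"] assms(2) by auto
  have all: "\<forall>z'\<in>\<mu> - {1}. absv (z' - 1) = \<theta> ^ n"
  proof
    fix z' assume "z' \<in> \<mu> - {1}"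
    then have "absv (1 - z') = absv (1 - z)"
      using absv_one_minus_mu_le[of z z'] absv_one_minus_mu_le[of z' z] assms by (auto intro: antisym)
    then show "absv (z' - 1) = \<theta> ^ n" using n absv_minus_commute[of z' 1] by simp
  qed
  have "mu_val = n" unfolding mu_val_def
  proof (rule the_equality)
    show "\<forall>z'\<in>\<mu> - {1}. absv (z' - 1) = \<theta> ^ n" by (rule all)
    fix m assume "\<forall>z'\<in>\<mu> - {1}. absv (z' - 1) = \<theta> ^ m"
    then have "\<theta> ^ m = \<theta> ^ n" using all assms by auto
    then show "m = n" by (simp add: \<theta>_power_eq_iff)
  qed
  then show ?thesis using all assms by simp
qed

text \<open>The ramification index (\<open>e_eq_norm_val\<close>), in a form that shows its divisibility by \<open>p - 1\<close>.\<close>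

definition e :: nat where "e = (p - 1) * mu_val"

lemma absv_p: "absv (of_nat p) = \<theta> ^ e"
proof -
  obtain z where z: "z \<in> \<mu>" "z \<noteq> 1" using mu_nontrivial_ex by blast
  show ?thesis
    using absv_p_eq[OF z] absv_mu_minus_1[OF z] absv_minus_commute[of 1 z]
    by (simp add: e_def power_mult[symmetric] mult.commute)
qed

lemma e_eq_norm_val: "norm_val absv (of_nat p) = int e"
  by (rule norm_val_eq) (simp add: absv_p)

lemma e_pos: "e \<ge> 1" and mu_val_pos: "mu_val \<ge> 1"
proof -
  have "\<theta> ^ e < \<theta> ^ 0" using absv_p_less_1 absv_p by simp
  then show "e \<ge> 1" unfolding \<theta>_power_less_iff by simp
  then show "mu_val \<ge> 1" by (cases mu_val) (simp_all add: e_def)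
qed

abbreviation \<rho> :: "nat \<Rightarrow> nat" where "\<rho> \<equiv> rho e p"

lemma shift_\<rho>: "shift \<rho>"
  by (rule shift_rho[OF e_pos p_ge_2])

lemma p_mu_val: "p * mu_val = mu_val + e"
  using p_ge_2 by (simp add: e_def mult_eq_if[of p])

lemma rho_eq: "a + (p - 1) * min a mu_val = \<rho> a"
proof (cases "a \<le> mu_val")
  case True
  have "p * a = a + (p - 1) * a" using p_ge_2 by (simp add: mult_eq_if[of p])
  moreover have "(p - 1) * a \<le> e" unfolding e_def using True by (rule mult_le_mono2)
  ultimately show ?thesis using True by (simp add: rho_def)
next
  case False
  have "p * a = a + (p - 1) * a" using p_ge_2 by (simp add: mult_eq_if[of p])
  moreover have "e \<le> (p - 1) * a" unfolding e_def using False by (intro mult_le_mono2) simp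
  ultimately show ?thesis using False by (simp add: rho_def e_def)
qed

text \<open>Let \<open>z\<close> be the root of unity closest to \<open>v\<close>, at distance \<open>r\<close>, and \<open>v' = v / z\<close>. Any other root is
at distance \<open>\<theta> ^ mu_val\<close> from \<open>z\<close>, hence by the ultrametric inequality at distance
\<open>max r (\<theta> ^ mu_val)\<close> from \<open>v\<close>. The product of all these distances is \<open>absv (v ^ p - 1)\<close>, and
\<open>rho_eq\<close> rewrites its exponent as \<open>\<rho> a\<close>. For an arbitrary \<open>v\<close> the formula would fail when \<open>v\<close> is
close to a nontrivial root; passing to \<open>v'\<close> removes this exception.\<close>

lemma normalize_by_mu:
  assumes v: "v \<in> U absv 1"
  shows "\<exists>z\<in>\<mu>. \<exists>v'. v = z * v' \<and> v' ^ p = v ^ p \<and> absv (v' - 1) \<le> absv (v - 1) \<and>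
    (v' = 1 \<or> (\<exists>a\<ge>1. absv (v' - 1) = \<theta> ^ a \<and> absv (v ^ p - 1) = \<theta> ^ \<rho> a))"
proof -
  define z0 where "z0 = arg_min_on (\<lambda>z. absv (v - z)) \<mu>"
  have ne: "\<mu> \<noteq> {}" using one_in_mu by blast
  have z0: "z0 \<in> \<mu>" unfolding z0_def by (rule arg_min_if_finite(1)[OF finite_mu ne])
  have min: "absv (v - z0) \<le> absv (v - z)" if "z \<in> \<mu>" for z
    using arg_min_if_finite(2)[OF finite_mu ne, of "\<lambda>z. absv (v - z)"] that
    unfolding z0_def by (meson linorder_not_less)
  define r where "r = absv (v - z0)"
  define v' where "v' = v / z0"
  have z0nz: "z0 \<noteq> 0" and z0abs: "absv z0 = 1" using mu_nonzero[OF z0] absv_mu[OF z0] by auto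
  have v': "v = z0 * v'" "v' ^ p = v ^ p"
    using z0nz z0 by (simp_all add: v'_def power_divide mu_iff)
  have "v' - 1 = (v - z0) / z0" using z0nz by (simp add: v'_def diff_divide_distrib)
  then have r: "absv (v' - 1) = r" by (simp add: absv_divide z0abs r_def)
  have r_le: "r \<le> absv (v - 1)" unfolding r_def by (rule min[OF one_in_mu])
  have dist: "absv (v - z) = max r (\<theta> ^ mu_val)" if z: "z \<in> \<mu> - {z0}" for z
  proof -
    have "z / z0 \<in> \<mu>" "z / z0 \<noteq> 1" using mu_divide[of z z0] z z0 z0nz by auto
    then have "absv (z / z0 - 1) = \<theta> ^ mu_val" by (rule absv_mu_minus_1)
    moreover have "z / z0 - 1 = (z - z0) / z0" using z0nz by (simp add: diff_divide_distrib)
    ultimately have c: "absv (z - z0) = \<theta> ^ mu_val" by (simp add: absv_divide z0abs)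
    have "absv (v - z) \<le> max r (\<theta> ^ mu_val)"
      using absv_diff_trans[of v z z0] c absv_minus_commute[of z0 z] by (simp add: r_def)
    moreover have "r \<le> absv (v - z)" using min z by (simp add: r_def)
    moreover have "\<theta> ^ mu_val \<le> max (absv (v - z)) r"
      using absv_diff_trans[of z z0 v] c absv_minus_commute[of z v] by (simp add: r_def)
    ultimately show ?thesis by linarith
  qed
  have "absv (\<Prod>z\<in>A. v - z) = (\<Prod>z\<in>A. absv (v - z))" for A
    by (induction A rule: infinite_finite_induct) (simp_all add: absv_mult)
  then have "absv (v ^ p - 1) = (\<Prod>z\<in>\<mu>. absv (v - z))" by (simp add: power_minus_1_eq_prod)
  also have "\<dots> = r * (\<Prod>z\<in>\<mu> - {z0}. absv (v - z))"
    unfolding r_def by (rule prod.remove[OF finite_mu z0])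
  also have "(\<Prod>z\<in>\<mu> - {z0}. absv (v - z)) = max r (\<theta> ^ mu_val) ^ (p - 1)"
    using dist z0 finite_mu card_mu by simp
  finally have val: "absv (v ^ p - 1) = r * max r (\<theta> ^ mu_val) ^ (p - 1)" .
  have "\<exists>a\<ge>1. absv (v' - 1) = \<theta> ^ a \<and> absv (v ^ p - 1) = \<theta> ^ \<rho> a" if "v' \<noteq> 1"
  proof -
    have r\<theta>: "r \<le> \<theta> ^ 1" using r_le v unfolding U_iff by linarith
    then have "absv (v' - 1) \<le> 1" using r \<theta>_less_1 by simp
    then obtain a where a: "absv (v' - 1) = \<theta> ^ a" using absv_eq_\<theta>_power[of "v' - 1"] \<open>v' \<noteq> 1\<close> by auto
    then have "a \<ge> 1" using r r\<theta> \<theta>_power_le_iff[of a 1] by simp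
    have "max (\<theta> ^ a) (\<theta> ^ mu_val) = \<theta> ^ min a mu_val"
      using \<theta>_power_le_iff[of a mu_val] \<theta>_power_le_iff[of mu_val a] by (cases "a \<le> mu_val") auto
    then have "absv (v ^ p - 1) = \<theta> ^ (a + (p - 1) * min a mu_val)"
      using val a r by (simp add: power_add power_mult[symmetric] mult.commute)
    then show ?thesis using a \<open>a \<ge> 1\<close> unfolding rho_eq by blast
  qed
  then show ?thesis using z0 v' r r_le by blast
qed

lemma rho_le: "\<rho> a \<le> a + e" by (simp add: rho_def)

lemma rho_eq_add: "a \<ge> mu_val \<Longrightarrow> \<rho> a = a + e"
  using rho_eq[of a] by (simp add: min_def e_def split: if_splits)

lemma rho_mu_val: "\<rho> mu_val = p * mu_val"
  using rho_eq_add[of mu_val] p_mu_val by simp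

lemma power_U:
  assumes v: "v \<in> U absv k" and "k \<ge> 1"
  shows "v ^ p \<in> U absv (\<rho> k)"
proof -
  have v1: "v \<in> U absv 1" using v U_antimono[OF assms(2)] by blast
  obtain v' where v': "v' ^ p = v ^ p" "absv (v' - 1) \<le> absv (v - 1)"
    "v' = 1 \<or> (\<exists>a\<ge>1. absv (v' - 1) = \<theta> ^ a \<and> absv (v ^ p - 1) = \<theta> ^ \<rho> a)"
    using normalize_by_mu[OF v1] by blast
  show ?thesis
  proof (cases "v' = 1")
    case True
    then have "v ^ p = 1" using v'(1) by simp
    then show ?thesis using \<theta>_pos by (simp add: U_iff)
  next
    case False
    then obtain a where a: "absv (v' - 1) = \<theta> ^ a" "absv (v ^ p - 1) = \<theta> ^ \<rho> a" using v'(3) by blast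
    have "\<theta> ^ a \<le> \<theta> ^ k" using a(1) v'(2) v unfolding U_iff by linarith
    then have "k \<le> a" by (simp add: \<theta>_power_le_iff)
    then have "\<rho> k \<le> \<rho> a" by (rule shift_mono[OF shift_\<rho> assms(2)])
    then show ?thesis unfolding U_iff a(2) by (simp add: \<theta>_power_le_iff)
  qed
qed

lemma power_lift_mu:
  assumes v: "v \<in> U absv 1" and vi: "v ^ p \<in> U absv i"
  shows "\<exists>z\<in>\<mu>. \<exists>v'. v = z * v' \<and> v' ^ p = v ^ p \<and> (v' = 1 \<or> (\<exists>a\<ge>1. v' \<in> U absv a \<and> i \<le> \<rho> a))"
proof -
  obtain z v' where zv: "z \<in> \<mu>" "v = z * v'" "v' ^ p = v ^ p"
    "v' = 1 \<or> (\<exists>a\<ge>1. absv (v' - 1) = \<theta> ^ a \<and> absv (v ^ p - 1) = \<theta> ^ \<rho> a)"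
    using normalize_by_mu[OF v] by blast
  have "\<exists>a\<ge>1. v' \<in> U absv a \<and> i \<le> \<rho> a" if "v' \<noteq> 1"
  proof -
    obtain a where a: "a \<ge> 1" "absv (v' - 1) = \<theta> ^ a" "absv (v ^ p - 1) = \<theta> ^ \<rho> a" using zv(4) \<open>v' \<noteq> 1\<close> by blast
    have "i \<le> \<rho> a" using vi a(3) unfolding U_iff by (simp add: \<theta>_power_le_iff)
    moreover have "v' \<in> U absv a" using a(2) unfolding U_iff by simp
    ultimately show ?thesis using a(1) by blast
  qed
  then show ?thesis using zv(1,2,3) by blast
qed

text \<open>The \<open>p\<close>-th powers that lie in \<open>U\<^sub>i\<close> are those of the units of level \<open>least_rho_ge i\<close>, see
\<open>U_Int_powers\<close>.\<close>

definition least_rho_ge :: "nat \<Rightarrow> nat" where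
  "least_rho_ge i = (LEAST k. k \<ge> 1 \<and> i \<le> \<rho> k)"

lemma least_rho_ge: "least_rho_ge i \<ge> 1" "i \<le> \<rho> (least_rho_ge i)"
proof -
  have "max i 1 \<ge> 1 \<and> i \<le> \<rho> (max i 1)"
    using shift_gt[OF shift_\<rho>, of "max i 1"] by linarith
  then have "least_rho_ge i \<ge> 1 \<and> i \<le> \<rho> (least_rho_ge i)" unfolding least_rho_ge_def by (rule LeastI)
  then show "least_rho_ge i \<ge> 1" "i \<le> \<rho> (least_rho_ge i)" by blast+
qed

lemma least_rho_ge_le: "k \<ge> 1 \<Longrightarrow> i \<le> \<rho> k \<Longrightarrow> least_rho_ge i \<le> k"
  unfolding least_rho_ge_def by (rule Least_le) simp

lemma least_rho_ge_le_iff: "k \<ge> 1 \<Longrightarrow> least_rho_ge i \<le> k \<longleftrightarrow> i \<le> \<rho> k"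
  using least_rho_ge_le least_rho_ge shift_mono[OF shift_\<rho>, of "least_rho_ge i" k] order_trans by blast

lemma least_rho_ge_less: "i > 1 \<Longrightarrow> least_rho_ge i < i"
  using least_rho_ge_le[of "i - 1" i] shift_gt[OF shift_\<rho>, of "i - 1"] by force

lemma power_lift:
  assumes v: "v \<in> U absv 1" and vi: "v ^ p \<in> U absv i"
  shows "\<exists>v'\<in>U absv (least_rho_ge i). v' ^ p = v ^ p"
proof -
  obtain z v' where zv: "z \<in> \<mu>" "v = z * v'" "v' ^ p = v ^ p" "v' = 1 \<or> (\<exists>a\<ge>1. v' \<in> U absv a \<and> i \<le> \<rho> a)"
    using power_lift_mu[OF v vi] by blast
  have "v' \<in> U absv (least_rho_ge i)"
  proof (cases "v' = 1")
    case True
    then show ?thesis using \<theta>_pos by (simp add: U_iff)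
  next
    case False
    then obtain a where "a \<ge> 1" "v' \<in> U absv a" "i \<le> \<rho> a" using zv(4) by blast
    then show ?thesis using least_rho_ge_le U_antimono by blast
  qed
  then show ?thesis using zv(3) by blast
qed

abbreviation power_p :: "'a \<Rightarrow> 'a" where "power_p \<equiv> \<lambda>v. v ^ p"

lemma U_Int_powers: "U absv i \<inter> power_p ` U absv 1 = power_p ` U absv (least_rho_ge i)"
proof (intro equalityI subsetI)
  fix x assume "x \<in> U absv i \<inter> power_p ` U absv 1"
  then obtain v where "v \<in> U absv 1" "x = v ^ p" "v ^ p \<in> U absv i" by blast
  then show "x \<in> power_p ` U absv (least_rho_ge i)" using power_lift by (metis image_eqI)
next
  fix x assume "x \<in> power_p ` U absv (least_rho_ge i)"
  then obtain v where v: "v \<in> U absv (least_rho_ge i)" "x = v ^ p" by blast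
  have "x \<in> U absv i" using power_U[OF v(1) least_rho_ge(1)] U_antimono[OF least_rho_ge(2)] v(2) by blast
  moreover have "v \<in> U absv 1" using v(1) U_antimono[OF least_rho_ge(1)] by blast
  ultimately show "x \<in> U absv i \<inter> power_p ` U absv 1" using v(2) by blast
qed

lemma card_mu_Int_U:
  assumes "j \<ge> 1"
  shows "card (\<mu> \<inter> U absv j) = (if j \<le> mu_val then p else 1)"
proof -
  have in_U: "z \<in> U absv j \<longleftrightarrow> j \<le> mu_val" if "z \<in> \<mu>" "z \<noteq> 1" for z
    unfolding U_iff absv_mu_minus_1[OF that] by (rule \<theta>_power_le_iff)
  have 1: "1 \<in> U absv j" using \<theta>_pos by (simp add: U_iff)
  show ?thesis
  proof (cases "j \<le> mu_val")
    case True
    then have "\<mu> \<inter> U absv j = \<mu>" using in_U 1 by blast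
    then show ?thesis using True card_mu by simp
  next
    case False
    then have "\<mu> \<inter> U absv j = {1}" using in_U 1 one_in_mu by blast
    then show ?thesis using False by simp
  qed
qed

text \<open>For large \<open>n\<close>, \<open>v\<^sup>p\<close> lies in \<open>U\<^bsub>n+e\<^esub>\<close> exactly if \<open>v\<close> is a root of unity times an element of
\<open>U\<^sub>n\<close>, and distinct roots of unity are distinct modulo \<open>U\<^sub>n\<close>.\<close>

lemma card_cosets_power_vimage:
  assumes "1 \<le> j" "j \<le> n" "mu_val < n"
  shows "card (cosets {v \<in> U absv j. v ^ p \<in> U absv (n + e)} (U absv n)) = card (\<mu> \<inter> U absv j)"
proof -
  let ?D = "{v \<in> U absv j. v ^ p \<in> U absv (n + e)}" and ?c = "\<lambda>z. (*) z ` U absv n"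
  have n: "n \<ge> 1" using assms by simp
  note Un = mult_subgroup_U[OF n] and Uj = mult_subgroup_U[OF assms(1)]
  have D: "?D = {v. \<exists>z\<in>\<mu> \<inter> U absv j. v / z \<in> U absv n}"
  proof (intro equalityI subsetI)
    fix v assume "v \<in> ?D"
    then have v: "v \<in> U absv j" "v ^ p \<in> U absv (n + e)" by auto
    have "v \<in> U absv 1" using v(1) U_antimono[OF assms(1)] by blast
    then obtain z v' where zv: "z \<in> \<mu>" "v = z * v'" "v' ^ p = v ^ p"
      "v' = 1 \<or> (\<exists>a\<ge>1. v' \<in> U absv a \<and> n + e \<le> \<rho> a)"
      using power_lift_mu v(2) by blast
    have v'n: "v' \<in> U absv n"
    proof (cases "v' = 1")
      case True
      then show ?thesis using mult_subgroup_one[OF Un] by simp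
    next
      case False
      then obtain a where a: "v' \<in> U absv a" "n + e \<le> \<rho> a" using zv(4) by blast
      then have "n \<le> a" using rho_le[of a] by linarith
      then show ?thesis using a(1) U_antimono by blast
    qed
    have nz: "z \<noteq> 0" "v' \<noteq> 0" using mu_nonzero[OF zv(1)] mult_subgroup_nonzero[OF Un v'n] by auto
    have "v' \<in> U absv j" using v'n U_antimono[OF assms(2)] by blast
    then have "v / v' \<in> U absv j" by (rule mult_subgroup_div[OF Uj v(1)])
    then have "z \<in> \<mu> \<inter> U absv j" using zv(1,2) nz by simp
    moreover have "v / z \<in> U absv n" using v'n zv(2) nz by simp
    ultimately show "v \<in> {v. \<exists>z\<in>\<mu> \<inter> U absv j. v / z \<in> U absv n}" by blast
  next
    fix v assume "v \<in> {v. \<exists>z\<in>\<mu> \<inter> U absv j. v / z \<in> U absv n}"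
    then obtain z where z: "z \<in> \<mu>" "z \<in> U absv j" "v / z \<in> U absv n" by blast
    have nz: "z \<noteq> 0" using mu_nonzero[OF z(1)] .
    have "(v / z) ^ p \<in> U absv (\<rho> n)" using power_U[OF z(3) n] .
    moreover have "(v / z) ^ p = v ^ p" using z(1) by (simp add: power_divide mu_iff)
    moreover have "\<rho> n = n + e" using rho_eq_add assms(3) by simp
    ultimately have "v ^ p \<in> U absv (n + e)" by simp
    moreover have "v / z \<in> U absv j" using z(3) U_antimono[OF assms(2)] by blast
    then have "v / z * z \<in> U absv j" using z(2) by (rule mult_subgroup_mult[OF Uj])
    ultimately show "v \<in> ?D" using nz by simp
  qed
  have "cosets ?D (U absv n) = ?c ` (\<mu> \<inter> U absv j)"
  proof (intro equalityI subsetI)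
    fix X assume "X \<in> cosets ?D (U absv n)"
    then obtain v where v: "v \<in> ?D" "X = ?c v" unfolding cosets_def by blast
    then obtain z where z: "z \<in> \<mu> \<inter> U absv j" "v / z \<in> U absv n" unfolding D by blast
    have "v \<noteq> 0" using v(1) mult_subgroup_nonzero[OF Uj] by blast
    then have "?c v = ?c z" using coset_eq_iff[OF Un] z mu_nonzero by blast
    then show "X \<in> ?c ` (\<mu> \<inter> U absv j)" using v(2) z(1) by blast
  next
    fix X assume "X \<in> ?c ` (\<mu> \<inter> U absv j)"
    then obtain z where z: "z \<in> \<mu> \<inter> U absv j" "X = ?c z" by blast
    have "z / z \<in> U absv n" using mult_subgroup_one[OF Un] mu_nonzero z(1) by simp
    then have "z \<in> ?D" unfolding D using z(1) by blast
    then show "X \<in> cosets ?D (U absv n)" unfolding cosets_def using z(2) by blast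
  qed
  moreover have "inj_on ?c (\<mu> \<inter> U absv j)"
  proof (rule inj_onI)
    fix y z assume yz: "y \<in> \<mu> \<inter> U absv j" "z \<in> \<mu> \<inter> U absv j" "?c y = ?c z"
    have "y / z \<in> U absv n" using coset_eq_iff[OF Un] yz mu_nonzero by blast
    have "y / z = 1"
    proof (rule ccontr)
      assume "y / z \<noteq> 1"
      then have "absv (y / z - 1) = \<theta> ^ mu_val" using absv_mu_minus_1 mu_divide yz by blast
      then show False using \<open>y / z \<in> U absv n\<close> assms(3) by (simp add: U_iff \<theta>_power_le_iff)
    qed
    then show "y = z" using mu_nonzero yz by (auto simp: divide_eq_1_iff)
  qed
  ultimately show ?thesis by (simp add: card_image)
qed

text \<open>Taking \<open>p\<close>-th powers identifies the cosets counted on the left with those in \<open>U\<^sub>j\<close> of the preimage of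
\<open>U\<^bsub>n+e\<^esub>\<close>, which lies between \<open>U\<^sub>n\<close> and \<open>U\<^sub>j\<close>.\<close>

lemma card_cosets_powers:
  assumes "1 \<le> j" "j \<le> n" "mu_val < n"
  shows "card (cosets (power_p ` U absv j) (U absv (n + e))) * card (\<mu> \<inter> U absv j)
    = q ^ (n - j)"
proof -
  let ?D = "{v \<in> U absv j. v ^ p \<in> U absv (n + e)}"
  have n: "1 \<le> n" "1 \<le> n + e" using assms by auto
  have "U absv n \<subseteq> ?D"
    using U_antimono[OF assms(2)] power_U[OF _ n(1)] rho_eq_add[of n] assms(3) by auto
  then have "card (cosets (U absv j) (U absv n)) = card (cosets (U absv j) ?D) * card (cosets ?D (U absv n))"
    using assms n by (intro card_cosets_tower mult_subgroup_power_vimage mult_subgroup_U) auto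
  then show ?thesis
    using card_cosets_power[OF mult_subgroup_U[OF assms(1)] mult_subgroup_U[OF n(2)], of p]
      card_cosets_power_vimage[OF assms] card_cosets_U[OF assms(1,2)] by simp
qed

lemma absv_power_diff_le:
  assumes "absv x \<le> 1" "absv y \<le> 1"
  shows "absv (x ^ n - y ^ n) \<le> absv (x - y)"
proof -
  have "absv (\<Sum>i<n. y ^ (n - Suc i) * x ^ i) \<le> 1"
    by (rule absv_sum_le)
       (use assms absv_nonneg in \<open>auto simp: absv_mult absv_power intro!: mult_le_one power_le_one\<close>)
  then have "absv (x - y) * absv (\<Sum>i<n. y ^ (n - Suc i) * x ^ i) \<le> absv (x - y) * 1"
    using absv_nonneg by (rule mult_left_mono)
  then show ?thesis unfolding power_diff_sumr2[of x n y] absv_mult by simp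
qed

text \<open>A counting argument: modulo \<open>U\<^bsub>l+e\<^esub>\<close> there are as many \<open>p\<close>-th powers of elements of \<open>U\<^sub>n\<close> as there are
elements of \<open>U\<^bsub>n+e\<^esub>\<close>.\<close>

lemma U_subset_approx_powers:
  assumes "mu_val < n" "n \<le> l" and u: "u \<in> U absv (n + e)"
  shows "\<exists>v\<in>U absv n. absv (u - v ^ p) \<le> \<theta> ^ (l + e)"
proof -
  have n: "1 \<le> n" "1 \<le> n + e" "1 \<le> l + e" using assms by auto
    let ?A = "cosets (power_p ` U absv n) (U absv (l + e))" and ?B = "cosets (U absv (n + e)) (U absv (l + e))"
  have "power_p ` U absv n \<subseteq> U absv (n + e)"
    using power_U[OF _ n(1)] rho_eq_add[of n] assms(1) by auto
  then have sub: "?A \<subseteq> ?B" unfolding cosets_def by (rule image_mono)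
  have "card ?A * 1 = q ^ (l - n)"
    using card_cosets_powers[of n l] card_mu_Int_U[OF n(1)] assms n by simp
  moreover have B: "card ?B = q ^ (l - n)"
    using card_cosets_U[of "n + e" "l + e"] assms(2) n by simp
  moreover have "card ?B > 0"
    unfolding B card_residue_field using prime_gt_0_nat[OF residue_char(2)] by simp
  ultimately have "?A = ?B" using sub card_subset_eq card_ge_0_finite by (metis mult.right_neutral)
  then have "(*) u ` U absv (l + e) \<in> ?A" using u unfolding cosets_def by blast
  then obtain v where v: "v \<in> U absv n" "(*) u ` U absv (l + e) = (*) (v ^ p) ` U absv (l + e)"
    unfolding cosets_def by blast
  have abs1: "absv u = 1" "absv (v ^ p) = 1"
    using absv_U[OF u n(2)] absv_U[OF v(1) n(1)] by (simp_all add: absv_power)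
  then have "u / v ^ p \<in> U absv (l + e)"
    using coset_eq_iff[OF mult_subgroup_U[OF n(3)], of u "v ^ p"] v(2) by (metis absv_zero zero_neq_one)
  then show ?thesis using U_div_iff[OF abs1] v(1) by blast
qed

text \<open>By compactness the approximate \<open>p\<close>-th roots of \<open>u\<close> accumulate at an exact one.\<close>

lemma U_eq_powers:
  assumes "mu_val < n"
  shows "U absv (n + e) = power_p ` U absv n"
proof (intro equalityI subsetI)
  have n: "1 \<le> n" using assms by simp
  fix u assume "u \<in> power_p ` U absv n"
  then show "u \<in> U absv (n + e)" using power_U[OF _ n] rho_eq_add[of n] assms by auto
next
  have n: "1 \<le> n" using assms by simp
  fix u assume u: "u \<in> U absv (n + e)"
  have "\<exists>v\<in>U absv n. absv (u - v ^ p) \<le> \<theta> ^ (n + k + e)" for k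
    by (rule U_subset_approx_powers[OF assms _ u]) simp
  then obtain v where v: "\<And>k. v k \<in> U absv n" "\<And>k. absv (u - v k ^ p) \<le> \<theta> ^ (n + k + e)" by metis
  have v1: "absv (v k) \<le> 1" for k using absv_U[OF v(1) n] by simp
  obtain l r where lr: "strict_mono (r :: nat \<Rightarrow> nat)" "absv l \<le> 1"
    "\<And>\<epsilon>. \<epsilon> > 0 \<Longrightarrow> \<exists>N. \<forall>m\<ge>N. absv (v (r m) - l) < \<epsilon>"
    using convergent_subsequence[of v, OF v1] by blast
  have close: "\<exists>m. absv (v (r m) - l) < \<epsilon> \<and> \<theta> ^ (n + r m + e) < \<epsilon>" if \<epsilon>: "\<epsilon> > 0" for \<epsilon>
  proof -
    obtain N where N: "\<And>m. m \<ge> N \<Longrightarrow> absv (v (r m) - l) < \<epsilon>" using lr(3)[OF \<epsilon>] by blast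
    obtain K where K: "\<theta> ^ K < \<epsilon>" using \<theta>_power_tendsto_0[OF \<epsilon>] by blast
    let ?m = "max N K"
    have "K \<le> n + r ?m + e" using strict_mono_imp_increasing[OF lr(1), of ?m] by linarith
    then have "\<theta> ^ (n + r ?m + e) < \<epsilon>" using K \<theta>_power_le_iff[of "n + r ?m + e" K] by linarith
    then show ?thesis using N[of ?m] by (intro exI[of _ ?m]) simp
  qed
  have "l \<in> U absv n"
  proof -
    obtain m where "absv (v (r m) - l) < \<theta> ^ n" using close[of "\<theta> ^ n"] \<theta>_pos by auto
    then show ?thesis
      using absv_diff_trans[of l 1 "v (r m)"] absv_minus_commute[of l "v (r m)"] v(1)[of "r m"]
      unfolding U_iff by linarith
  qed
  moreover have "u = l ^ p"
  proof (rule ccontr)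
    assume "u \<noteq> l ^ p"
    then have pos: "absv (u - l ^ p) > 0" using absv_pos by simp
    obtain m where m: "absv (v (r m) - l) < absv (u - l ^ p)" "\<theta> ^ (n + r m + e) < absv (u - l ^ p)"
      using close[OF pos] by blast
    have "absv (v (r m) ^ p - l ^ p) < absv (u - l ^ p)"
      using absv_power_diff_le[OF v1 lr(2), of "r m" p] m(1) by linarith
    moreover have "absv (u - v (r m) ^ p) < absv (u - l ^ p)" using v(2)[of "r m"] m(2) by linarith
    ultimately show False using absv_diff_trans[of u "l ^ p" "v (r m) ^ p"] by linarith
  qed
  ultimately show "u \<in> power_p ` U absv n" by blast
qed

text \<open>The group \<open>U\<^bsub>n+e\<^esub>\<close> consists of \<open>p\<close>-th powers for large \<open>n\<close>, so the index can be computed in the tower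
of \<open>U\<^bsub>n+e\<^esub>\<close>, the \<open>p\<close>-th powers in \<open>U\<^sub>i\<close>, and \<open>U\<^sub>i\<close>. The factor \<open>p\<close> appears when the
roots of unity belong to the group whose \<open>p\<close>-th powers are taken.\<close>

lemma card_U_mod_powers:
  assumes i: "i \<ge> 1"
  shows "card (cosets (U absv i) (power_p ` U absv 1)) =
    q ^ (least_rho_ge i + e - i) * (if least_rho_ge i \<le> mu_val then p else 1)"
proof -
    define j where "j = least_rho_ge i"
  \<comment> \<open>Any \<open>n\<close> that satisfies the five inequalities below would do.\<close>
  define n where "n = Suc (max j (max mu_val i))"
  have j: "1 \<le> j" "i \<le> j + e" using least_rho_ge[of i] rho_le[of "least_rho_ge i"] by (simp_all add: j_def)
  have n: "j \<le> n" "mu_val < n" "i \<le> n + e" "1 \<le> n" "1 \<le> n + e" by (auto simp: n_def)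
  have U1: "mult_subgroup (U absv 1)" by (rule mult_subgroup_U) simp
  have idx: "card (cosets (U absv i) (power_p ` U absv 1)) = card (cosets (U absv i) (power_p ` U absv j))"
    using card_cosets_Int[OF mult_subgroup_U[OF i] mult_subgroup_power_image[OF U1, of p]]
    by (simp only: U_Int_powers j_def)
  have "card (cosets (U absv i) (U absv (n + e))) =
      card (cosets (U absv i) (power_p ` U absv j)) * card (cosets (power_p ` U absv j) (U absv (n + e)))"
  proof (rule card_cosets_tower)
    show "U absv (n + e) \<subseteq> power_p ` U absv j"
      unfolding U_eq_powers[OF n(2)] by (intro image_mono U_antimono n(1))
    show "power_p ` U absv j \<subseteq> U absv i" using U_Int_powers[of i] by (auto simp: j_def)
  qed (intro mult_subgroup_power_image mult_subgroup_U i j n)+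
  then have "q ^ (n + e - i) =
      card (cosets (U absv i) (power_p ` U absv j)) * card (cosets (power_p ` U absv j) (U absv (n + e)))"
    using card_cosets_U[OF i n(3)] by simp
  then have "q ^ (n + e - i) * card (\<mu> \<inter> U absv j) =
      card (cosets (U absv i) (power_p ` U absv j)) * q ^ (n - j)"
    using card_cosets_powers[OF j(1) n(1,2)] by (simp only: mult.assoc)
  moreover have "n + e - i = (j + e - i) + (n - j)" using n j by simp
  ultimately have "q ^ (j + e - i) * card (\<mu> \<inter> U absv j) * q ^ (n - j) =
      card (cosets (U absv i) (power_p ` U absv j)) * q ^ (n - j)"
    by (simp add: power_add mult_ac)
  moreover have "q ^ (n - j) \<noteq> 0"
    unfolding card_residue_field using prime_gt_0_nat[OF residue_char(2)] by simp
  ultimately have "q ^ (j + e - i) * card (\<mu> \<inter> U absv j) = card (cosets (U absv i) (power_p ` U absv j))"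
    by (simp only: mult_cancel2) blast
  then show ?thesis unfolding idx card_mu_Int_U[OF j(1)] unfolding j_def by simp
qed

end

section \<open>Counting generators\<close>

context local_field_mu
begin

lemma T_set_less:
  assumes "t \<in> T_set \<rho>" "mu_val \<le> n" "n \<ge> 1"
  shows "t < n + e"
proof (rule ccontr)
  assume t: "\<not> t < n + e"
  then have "\<rho> (t - e) = t" using assms(2) rho_eq_add[of "t - e"] by simp
  moreover have "t - e \<in> {1..}" using t assms(3) by simp
  ultimately show False using assms(1) unfolding T_set_def by (metis DiffE image_eqI)
qed

text \<open>Up to a large bound \<open>\<rho> n = n + e\<close>, the integers from \<open>i\<close> on are the elements of \<open>T_set \<rho>\<close> together
with the values of \<open>\<rho>\<close> at the arguments from \<open>least_rho_ge i\<close> to \<open>n - 1\<close>.\<close>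

lemma card_T_set_ge:
  assumes i: "i \<ge> 1"
  shows "card {t \<in> T_set \<rho>. i \<le> t} = least_rho_ge i + e - i"
proof -
  \<comment> \<open>Large enough for \<open>\<rho>\<close> to be the shift by \<open>e\<close> from \<open>n\<close> on.\<close>
  define n where "n = Suc (max (least_rho_ge i) (max mu_val i))"
  have n: "least_rho_ge i \<le> n" "mu_val \<le> n" "i \<le> n" "n \<ge> 1" by (simp_all add: n_def)
  let ?T = "{t \<in> T_set \<rho>. i \<le> t}" and ?R = "\<rho> ` {least_rho_ge i..<n}"
  have mono: "\<rho> a < \<rho> b" if "1 \<le> a" "a < b" for a b
    using shift_\<rho> that by (auto simp: shift_def strict_mono_on_def)
  have \<rho>n: "\<rho> n = n + e" by (rule rho_eq_add[OF n(2)])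
  have union: "?T \<union> ?R = {i..<n + e}"
  proof (intro equalityI subsetI)
    fix s assume "s \<in> ?T \<union> ?R"
    then show "s \<in> {i..<n + e}"
    proof
      assume "s \<in> ?T"
      then show ?thesis using T_set_less[OF _ n(2,4)] by simp
    next
      assume "s \<in> ?R"
      then obtain k where k: "least_rho_ge i \<le> k" "k < n" "s = \<rho> k" by auto
      have k1: "1 \<le> k" using least_rho_ge(1)[of i] k(1) by simp
      then show ?thesis using k mono[OF k1 k(2)] \<rho>n least_rho_ge_le_iff[OF k1] by simp
    qed
  next
    fix s assume s: "s \<in> {i..<n + e}"
    show "s \<in> ?T \<union> ?R"
    proof (cases "s \<in> T_set \<rho>")
      case False
      then have "s \<in> \<rho> ` {1..}" using s i by (simp add: T_set_def)
      then obtain k where k: "k \<ge> 1" "s = \<rho> k" by auto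
      have "least_rho_ge i \<le> k" using least_rho_ge_le_iff[OF k(1)] s k(2) by simp
      moreover have "k < n"
      proof (rule ccontr)
        assume "\<not> k < n"
        then have "\<rho> n \<le> \<rho> k" by (intro shift_mono[OF shift_\<rho> n(4)]) simp
        then show False using s k(2) \<rho>n by simp
      qed
      ultimately show ?thesis using k(2) by simp
    qed (use s in simp)
  qed
  have "{least_rho_ge i..<n} \<subseteq> {1..}" using least_rho_ge(1)[of i] by auto
  then have disj: "?T \<inter> ?R = {}" unfolding T_set_def by blast
  have "strict_mono_on {least_rho_ge i..<n} \<rho>"
    by (rule strict_mono_onI) (use mono least_rho_ge(1)[of i] in simp)
  then have "inj_on \<rho> {least_rho_ge i..<n}" by (rule strict_mono_on_imp_inj_on)
  then have R: "card ?R = n - least_rho_ge i" by (simp add: card_image)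
  have fin: "finite ?T" using finite_T_set_rho[OF p_ge_2] by simp
  have "card ?T + card ?R = card {i..<n + e}"
    unfolding union[symmetric] by (rule card_Un_disjoint[symmetric]) (use fin disj in auto)
  then show ?thesis using R n by simp
qed

lemma e_star_eq: "e_star \<rho> = p * mu_val"
proof -
  have "p * mu_val \<ge> 2 * 1" using p_ge_2 mu_val_pos by (rule mult_le_mono)
  then have ge: "p * mu_val \<ge> 2" by simp
  have "Max (T_set \<rho>) = p * mu_val - 1"
  proof (rule Max_eqI[OF finite_T_set_rho[OF p_ge_2]])
    fix t assume "t \<in> T_set \<rho>"
    then have "t < mu_val + e" using T_set_less mu_val_pos by blast
    then show "t \<le> p * mu_val - 1" using p_mu_val by simp
  next
    have "p * mu_val - 1 \<noteq> \<rho> k" if "k \<ge> 1" for k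
    proof (cases "k < mu_val")
      case True
      have "\<rho> k \<le> p * (mu_val - 1)" unfolding rho_def using True by (intro min.coboundedI2 mult_le_mono2) simp
      also have "\<dots> = p * mu_val - p" by (simp add: diff_mult_distrib2)
      finally show ?thesis using p_ge_2 ge by simp
    next
      case False
      then have "\<rho> mu_val \<le> \<rho> k" by (intro shift_mono[OF shift_\<rho> mu_val_pos]) simp
      then show ?thesis using rho_mu_val ge by simp
    qed
    then show "p * mu_val - 1 \<in> T_set \<rho>" unfolding T_set_def using ge by auto
  qed
  then show ?thesis unfolding e_star_def using ge by simp
qed

lemma card_T_star_ge:
  assumes "i \<ge> 1"
  shows "card {t \<in> T_star \<rho>. i \<le> t} = least_rho_ge i + e - i + (if least_rho_ge i \<le> mu_val then 1 else 0)"
proof -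
  have fin: "finite {t \<in> T_set \<rho>. i \<le> t}" using finite_T_set_rho[OF p_ge_2] by simp
  have "e_star \<rho> \<notin> T_set \<rho>"
    using Max_ge[OF finite_T_set_rho[OF p_ge_2]] unfolding e_star_def by (metis Suc_eq_plus1 not_less_eq_eq order_refl)
  moreover have "i \<le> e_star \<rho> \<longleftrightarrow> least_rho_ge i \<le> mu_val"
    unfolding e_star_eq rho_mu_val[symmetric] using least_rho_ge_le_iff[OF mu_val_pos] by simp
  moreover have "{t \<in> T_star \<rho>. i \<le> t} =
      (if i \<le> e_star \<rho> then insert (e_star \<rho>) {t \<in> T_set \<rho>. i \<le> t} else {t \<in> T_set \<rho>. i \<le> t})"
    by (auto simp: T_star_def)
  ultimately show ?thesis using fin card_T_set_ge[OF assms] by simp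
qed

end

section \<open>Coordinates on a direct sum and the transitivity theorem\<close>

text \<open>\<open>(Some k, t)\<close> stands for the generator of weight \<open>t\<close> in the \<open>k\<close>-th copy of the first module, and
\<open>(None, t)\<close> for the one in the second module.\<close>

definition sum_index :: "nat \<Rightarrow> nat set \<Rightarrow> nat set \<Rightarrow> (nat option \<times> nat) set" where
  "sum_index n T T' = (Some ` {..<n}) \<times> T \<union> {None} \<times> T'"

definition sum_coord ::
  "nat \<Rightarrow> nat set \<Rightarrow> nat set \<Rightarrow> (nat \<Rightarrow> nat \<Rightarrow> 'z) \<times> (nat \<Rightarrow> 'z) \<Rightarrow> nat option \<times> nat \<Rightarrow> 'z" where
  "sum_coord n T T' x =
     (\<lambda>j\<in>sum_index n T T'. case fst j of Some k \<Rightarrow> fst x k (snd j) | None \<Rightarrow> snd x (snd j))"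

lemma card_sum_index:
  assumes "finite T" "finite T'"
  shows "card {j \<in> sum_index n T T'. i \<le> snd j} = n * card {t \<in> T. i \<le> t} + card {t \<in> T'. i \<le> t}"
proof -
  have "{j \<in> sum_index n T T'. i \<le> snd j} =
      (Some ` {..<n}) \<times> {t \<in> T. i \<le> t} \<union> {None} \<times> {t \<in> T'. i \<le> t}"
    by (auto simp: sum_index_def)
  also have "card \<dots> = card ((Some ` {..<n}) \<times> {t \<in> T. i \<le> t}) + card ({None :: nat option} \<times> {t \<in> T'. i \<le> t})"
    by (rule card_Un_disjoint) (use assms in auto)
  finally show ?thesis by (simp add: card_cartesian_product card_image)
qed

lemma sum_index_iff:
  "(Some k, t) \<in> sum_index n T T' \<longleftrightarrow> k < n \<and> t \<in> T" "(None, t) \<in> sum_index n T T' \<longleftrightarrow> t \<in> T'"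
  by (auto simp: sum_index_def)

lemma ball_sum_index:
  "(\<forall>j\<in>sum_index n T T'. P j) \<longleftrightarrow> (\<forall>k<n. \<forall>t\<in>T. P (Some k, t)) \<and> (\<forall>t\<in>T'. P (None, t))"
  by (auto simp: sum_index_def)

lemma sum_coord_simps:
  "k < n \<Longrightarrow> t \<in> T \<Longrightarrow> sum_coord n T T' x (Some k, t) = fst x k t"
  "t \<in> T' \<Longrightarrow> sum_coord n T T' x (None, t) = snd x t"
  by (simp_all add: sum_coord_def sum_index_iff)

lemma free_filtered_module_sum:
  assumes p: "p > 1" and \<rho>: "shift \<rho>" and T: "finite T" "T \<subseteq> {1..}" and T': "finite T'" "T' \<subseteq> {1..}"
  shows "free_filtered_module p
    (power_filt (prod_filt T (S_mod p \<rho>)) n \<oplus>\<^sub>f prod_filt T' (S_mod p \<rho>))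
    \<rho> (sum_index n T T') snd (sum_coord n T T')"
proof -
  let ?M = "power_filt (prod_filt T (S_mod p \<rho>)) n \<oplus>\<^sub>f prod_filt T' (S_mod p \<rho>)"
  let ?J = "sum_index n T T'" and ?c = "sum_coord n T T'"
  have Z: "cring (Zp p)" by (rule Zp_cring) (use p in simp)
  have S: "filtered_module (Zp p) (S_mod p \<rho> t)" if "t \<ge> 1" for t
    by (rule filtered_module_S_mod[OF p \<rho> that])
  have fm: "filtered_module (Zp p) ?M"
    unfolding power_filt_def
    by (intro filtered_module_dsum_filt filtered_module_prod_filt Z S) (use T T' in auto)
  have S_simps: "carrier (S_mod p \<rho> t) = carrier (Zp p)" "x \<oplus>\<^bsub>S_mod p \<rho> t\<^esub> y = x \<oplus>\<^bsub>Zp p\<^esub> y"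
    "a \<odot>\<^bsub>S_mod p \<rho> t\<^esub> x = a \<otimes>\<^bsub>Zp p\<^esub> x" for t a x y
    by (simp_all add: S_mod_def)
  note simps = power_filt_def prod_filt_simps dsum_filt_simps S_simps
  show ?thesis
  proof (intro free_filtered_module.intro free_filtered_module_axioms.intro fm p \<rho>)
    show "finite ?J" using T T' by (simp add: sum_index_def)
    show "snd j \<ge> 1" if "j \<in> ?J" for j using that T T' by (auto simp: sum_index_def)
    show "bij_betw ?c (carrier ?M) (?J \<rightarrow>\<^sub>E carrier (Zp p))"
    proof (rule bij_betw_byWitness[where f' =
          "\<lambda>c. (\<lambda>k\<in>{..<n}. \<lambda>t\<in>T. c (Some k, t), \<lambda>t\<in>T'. c (None, t))"])
      show "\<forall>x\<in>carrier ?M. (\<lambda>k\<in>{..<n}. \<lambda>t\<in>T. ?c x (Some k, t), \<lambda>t\<in>T'. ?c x (None, t)) = x"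
      proof
        fix x assume x: "x \<in> carrier ?M"
        have "(\<lambda>k\<in>{..<n}. \<lambda>t\<in>T. ?c x (Some k, t)) = fst x"
        proof (rule extensionalityI[of _ "{..<n}"])
          fix k assume k: "k \<in> {..<n}"
          show "(\<lambda>k\<in>{..<n}. \<lambda>t\<in>T. ?c x (Some k, t)) k = fst x k"
            by (rule extensionalityI[of _ T]; use x k in \<open>auto simp: simps sum_coord_simps PiE_iff\<close>)
        qed (use x in \<open>auto simp: simps PiE_iff\<close>)
        moreover have "(\<lambda>t\<in>T'. ?c x (None, t)) = snd x"
          by (rule extensionalityI[of _ T']) (use x in \<open>auto simp: simps sum_coord_simps PiE_iff\<close>)
        ultimately show "(\<lambda>k\<in>{..<n}. \<lambda>t\<in>T. ?c x (Some k, t), \<lambda>t\<in>T'. ?c x (None, t)) = x" by simp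
      qed
      show "\<forall>c\<in>?J \<rightarrow>\<^sub>E carrier (Zp p). ?c (\<lambda>k\<in>{..<n}. \<lambda>t\<in>T. c (Some k, t), \<lambda>t\<in>T'. c (None, t)) = c"
      proof
        fix c assume c: "c \<in> ?J \<rightarrow>\<^sub>E carrier (Zp p)"
        show "?c (\<lambda>k\<in>{..<n}. \<lambda>t\<in>T. c (Some k, t), \<lambda>t\<in>T'. c (None, t)) = c"
        proof (rule extensionalityI[of _ ?J])
          fix j assume "j \<in> ?J"
          then show "?c (\<lambda>k\<in>{..<n}. \<lambda>t\<in>T. c (Some k, t), \<lambda>t\<in>T'. c (None, t)) j = c j"
            by (auto simp: sum_index_def sum_coord_simps)
        qed (use c in \<open>auto simp: sum_coord_def PiE_iff\<close>)
      qed
      show "?c ` carrier ?M \<subseteq> ?J \<rightarrow>\<^sub>E carrier (Zp p)"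
      proof
        fix c assume "c \<in> ?c ` carrier ?M"
        then obtain x where x: "x \<in> carrier ?M" "c = ?c x" by blast
        have "\<forall>j\<in>?J. ?c x j \<in> carrier (Zp p)"
          unfolding ball_sum_index using x(1) by (auto simp: simps sum_coord_simps PiE_iff)
        then show "c \<in> ?J \<rightarrow>\<^sub>E carrier (Zp p)" using x(2) by (auto simp: PiE_iff sum_coord_def)
      qed
      show "(\<lambda>c. (\<lambda>k\<in>{..<n}. \<lambda>t\<in>T. c (Some k, t), \<lambda>t\<in>T'. c (None, t))) ` (?J \<rightarrow>\<^sub>E carrier (Zp p)) \<subseteq> carrier ?M"
        by (auto simp: simps PiE_iff sum_index_iff)
    qed
    show "?c (x \<oplus>\<^bsub>?M\<^esub> y) j = ?c x j \<oplus>\<^bsub>Zp p\<^esub> ?c y j" if "j \<in> ?J" for x y j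
      using that by (auto simp: sum_index_def sum_coord_simps simps)
    show "?c (a \<odot>\<^bsub>?M\<^esub> x) j = a \<otimes>\<^bsub>Zp p\<^esub> ?c x j" if "j \<in> ?J" for a x j
      using that by (auto simp: sum_index_def sum_coord_simps simps)
    show "x \<in> fil ?M i \<longleftrightarrow> (\<forall>j\<in>?J. ?c x j \<in> fil (S_mod p \<rho> (snd j)) i)" if "x \<in> carrier ?M" for x i
      unfolding ball_sum_index using that by (cases x) (auto simp: simps sum_coord_simps PiE_iff)
  qed
qed

theorem proposition1p3:
  fixes absv :: "'a::field \<Rightarrow> real"
    and p e f :: nat
    and \<rho> :: "nat \<Rightarrow> nat"
    and M :: "(padic, (nat \<Rightarrow> nat \<Rightarrow> padic) \<times> (nat \<Rightarrow> padic)) filt_module"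
  assumes "local_field absv"
    and "p = residue_char absv"
    and "(mu p :: 'a set) \<noteq> {1}"
    and "f = residue_degree absv"
    and "int e = norm_val absv (of_nat p)"
    and "\<rho> = rho e p"
    and "M = power_filt (M_mod p \<rho>) (f - 1) \<oplus>\<^sub>f M_star p \<rho>"
  shows "transitive_action (Aut_filt (Zp p) M) (Epi_filt (Zp p) M (U_filt absv))
           (precomp_action (Zp p) M (U_filt absv))"
proof -
  interpret K: local_field_mu absv p
    using assms(1-3) by (simp add: local_field_mu_def local_field_mu_axioms_def)
  have e: "e = K.e" using assms(5) K.e_eq_norm_val by simp
  have \<rho>: "\<rho> = rho K.e p" using assms(6) e by simp
  let ?T = "T_set \<rho>" and ?T' = "T_star \<rho>"
  have p: "p > 1" using K.p_ge_2 by simp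
  have T: "finite ?T" "?T \<subseteq> {1..}"
    unfolding \<rho> using finite_T_set_rho[OF K.p_ge_2] by (auto simp: T_set_def)
  then have T': "finite ?T'" "?T' \<subseteq> {1..}" by (auto simp: T_star_def e_star_def)
  interpret free_filtered_module p M \<rho> "sum_index (f - 1) ?T ?T'" snd "sum_coord (f - 1) ?T ?T'"
    using free_filtered_module_sum[OF p _ T T', of \<rho> "f - 1"] K.shift_\<rho>
    unfolding assms(7) M_mod_def M_star_def \<rho> by simp
  have f: "f \<ge> 1" using K.residue_degree_pos assms(4) by simp
  show ?thesis
  proof (rule transitive_onto_U_filt)
    show "mult_subgroup (U absv i)" if "i \<ge> 1" for i by (rule K.mult_subgroup_U[OF that])
    show "U absv i \<subseteq> U absv 1" if "i \<ge> 1" for i by (rule K.U_antimono[OF that])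
    show "card (cosets (U absv i) ((\<lambda>v. v ^ p) ` U absv 1)) =
        p ^ card {j \<in> sum_index (f - 1) ?T ?T'. i \<le> snd j}" if i: "i \<ge> 1" for i
    proof -
      let ?d = "K.least_rho_ge i + K.e - i"
      have "card {j \<in> sum_index (f - 1) ?T ?T'. i \<le> snd j} =
          (f - 1) * ?d + (?d + (if K.least_rho_ge i \<le> K.mu_val then 1 else 0))"
        using card_sum_index[OF T(1) T'(1), of "f - 1" i] K.card_T_set_ge[OF i] K.card_T_star_ge[OF i]
        by (simp only: \<rho>)
      also have "\<dots> = f * ?d + (if K.least_rho_ge i \<le> K.mu_val then 1 else 0)"
        using f by (simp add: mult_eq_if[of f])
      finally show ?thesis
        unfolding K.card_U_mod_powers[OF i] K.card_residue_field assms(2)[symmetric] assms(4)[symmetric]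
        by (simp add: power_add power_mult)
    qed
    show "\<exists>k v'. 1 \<le> k \<and> k < i \<and> i \<le> \<rho> k \<and> v' \<in> U absv k \<and> v' ^ p = v ^ p"
      if "v \<in> U absv 1" "i > 1" "v ^ p \<in> U absv i" for v i
      using K.power_lift[OF that(1,3)] K.least_rho_ge[of i] K.least_rho_ge_less[OF that(2)] unfolding \<rho> by blast
  qed
qed

end
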